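(* Let $0<p<\infty$, $0<s<2/p$, and $1/\tau=s/2+1/p$. Then there is a constant $c>0$, depending only on $s$, $p$ and the structural constants $N_0$, $c_0$, $\beta$, such that for every $n\ge n_0$ and all $S_1,S_2\in\mathcal{S}(n,1)$: $$|S_1|_{B^s_\tau}\le |S_2|_{B^s_\tau}+c\,n^{s/2}\|S_1-S_2\|_{L^p(\Omega)}\quad\text{if }\tau\ge 1,$$ and $$|S_1|_{B^s_\tau}^\tau\le |S_2|_{B^s_\tau}^\tau+c\,n^{\tau s/2}\|S_1-S_2\|_{L^p(\Omega)}^\tau\quad\text{if }\tau<1.$$
   Context: Fix constants $N_0\in\mathbb{N}$, $c_0\ge 1$ and $0<\beta\le\pi/3$. A compact convex set $Q\subset\mathbb{R}^2$ is regular if there are balls $B(x_2,r_2)\subset Q\subset B(x_1,r_1)$ with $r_1\le c_0r_2$. A set $R\subset\mathbb{R}^2$ is a ring if $R=Q_1\setminus Q_2$ where: (a) $Q_2\subset Q_1$ or $Q_2=\emptyset$; (b) each of $Q_1,Q_2$ (when nonempty) is a compact regular convex set whose boundary is a polygon consisting of at most $N_0$ line segments; (c) each edge $E$ of $\partial R$ can be written as $E=E_1\cup E_2$, a union of at most two segments with disjoint one-dimensional interiors, such that for each $i$ there is a triangle $\triangle_i\subset R$ having $E_i$ as a side with both angles adjacent to $E_i$ equal to $\beta$. The domain $\Omega$ is either $\mathbb{R}^2$ or a compact polygonal domain, i.e. a union of finitely many triangles with disjoint interiors obeying the minimum angle condition; in the compact case it is assumed that $\Omega$ is the union of $n_0$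 rings with disjoint interiors for some fixed $n_0\ge1$, and if $\Omega=\mathbb{R}^2$ then $n_0:=1$. $\mathcal{S}(n,1)$: if $\Omega$ is compact, the set of all functions $S=\sum_{j=1}^n c_j\mathbb{1}_{R_j}$, $c_j\in\mathbb{R}$, where $R_1,\dots,R_n$ are rings with disjoint interiors and $\Omega=\bigcup_j R_j$; if $\Omega=\mathbb{R}^2$, the same but with the requirement that $\bigcup_j R_j$ is a ring. Besov spaces: for $k\ge1$, $h\in\mathbb{R}^2$, set $\Delta_h^kf(x)=\sum_{\nu=0}^k(-1)^{k+\nu}\binom{k}{\nu}f(x+\nu h)$ if the segment $[x,x+kh]\subset\Omega$ and $\Delta_h^kf(x)=0$ otherwise; $\omega_k(f,t)_\tau=\sup_{|h|\le t}\|\Delta_h^kf\|_{L^\tau(\Omega)}$; $|f|_{B^{s,k}_\tau}=\big(\int_0^\infty[t^{-s}\omega_k(f,t)_\tau]^\tau\,dt/t\big)^{1/\tau}$. Here $B^s_\tau:=B^{s,1}_\tau$ (the case $k=1$). *)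

theory Defs
  imports "HOL-Analysis.Analysis"
begin

type_synonym pt = "real ^ 2"

definition vec_angle :: "pt \<Rightarrow> pt \<Rightarrow> real" where
  "vec_angle u v = arccos ((u \<bullet> v) / (norm u * norm v))"

definition regular_set :: "real \<Rightarrow> pt set \<Rightarrow> bool" where
  "regular_set c0 Q \<longleftrightarrow> compact Q \<and> convex Q \<and>
     (\<exists>x1 r1 x2 r2. 0 < r2 \<and> ball x2 r2 \<subseteq> Q \<and> Q \<subseteq> ball x1 r1 \<and> r1 \<le> c0 * r2)"

definition polygonal_boundary :: "nat \<Rightarrow> pt set \<Rightarrow> bool" where
  "polygonal_boundary N0 Q \<longleftrightarrow>
     (\<exists>segs :: (pt \<times> pt) list. length segs \<le> N0 \<and>
        frontier Q = (\<Union>(a, b) \<in> set segs. closed_segment a b))"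

definition admissible_convex :: "nat \<Rightarrow> real \<Rightarrow> pt set \<Rightarrow> bool" where
  "admissible_convex N0 c0 Q \<longleftrightarrow> regular_set c0 Q \<and> polygonal_boundary N0 Q"

definition boundary_edge :: "pt set \<Rightarrow> pt \<Rightarrow> pt \<Rightarrow> bool" where
  "boundary_edge R a b \<longleftrightarrow> a \<noteq> b \<and> closed_segment a b \<subseteq> frontier R \<and>
     (\<forall>u v. closed_segment a b \<subseteq> closed_segment u v \<and> closed_segment u v \<subseteq> frontier R
            \<longrightarrow> closed_segment u v = closed_segment a b)"

text \<open>There is a triangle in R with side [u,v] and both angles adjacent to [u,v] equal to beta.
  (R = Q1 - Q2 is not closed; the triangle is required to lie in the closure of R.)\<close>
definition beta_triangle_on :: "real \<Rightarrow> pt set \<Rightarrow> pt \<Rightarrow> pt \<Rightarrow> bool" where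
  "beta_triangle_on \<beta> R u v \<longleftrightarrow>
     (\<exists>w. convex hull {u, v, w} \<subseteq> closure R \<and>
          vec_angle (v - u) (w - u) = \<beta> \<and> vec_angle (u - v) (w - v) = \<beta>)"

definition is_ring :: "nat \<Rightarrow> real \<Rightarrow> real \<Rightarrow> pt set \<Rightarrow> bool" where
  "is_ring N0 c0 \<beta> R \<longleftrightarrow>
     (\<exists>Q1 Q2. R = Q1 - Q2 \<and> admissible_convex N0 c0 Q1 \<and>
        (Q2 = {} \<or> (Q2 \<subseteq> Q1 \<and> admissible_convex N0 c0 Q2))) \<and>
     (\<forall>a b. boundary_edge R a b \<longrightarrow>
        (\<exists>m \<in> closed_segment a b.
           (m \<noteq> a \<longrightarrow> beta_triangle_on \<beta> R a m) \<and>
           (m \<noteq> b \<longrightarrow> beta_triangle_on \<beta> R m b)))"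

text \<open>Compact polygonal domain: finite union of nondegenerate triangles with disjoint interiors
  (for a finite triangulation the minimum angle condition holds automatically with some
  positive angle).\<close>
definition polygonal_domain :: "pt set \<Rightarrow> bool" where
  "polygonal_domain \<Omega> \<longleftrightarrow>
     (\<exists>T :: (pt \<times> pt \<times> pt) set. finite T \<and>
        (\<forall>(a, b, c) \<in> T. \<not> collinear {a, b, c}) \<and>
        (\<forall>t1 \<in> T. \<forall>t2 \<in> T. t1 \<noteq> t2 \<longrightarrow>
            interior (case t1 of (a, b, c) \<Rightarrow> convex hull {a, b, c}) \<inter>
            interior (case t2 of (a, b, c) \<Rightarrow> convex hull {a, b, c}) = {}) \<and>
        \<Omega> = (\<Union>(a, b, c) \<in> T. convex hull {a, b, c}))"

definition disjoint_interiors :: "nat \<Rightarrow> (nat \<Rightarrow> pt set) \<Rightarrow> bool" where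
  "disjoint_interiors n Rs \<longleftrightarrow>
     (\<forall>i<n. \<forall>j<n. i \<noteq> j \<longrightarrow> interior (Rs i) \<inter> interior (Rs j) = {})"

definition admissible_domain :: "nat \<Rightarrow> real \<Rightarrow> real \<Rightarrow> nat \<Rightarrow> pt set \<Rightarrow> bool" where
  "admissible_domain N0 c0 \<beta> n0 \<Omega> \<longleftrightarrow>
     (\<Omega> = UNIV \<and> n0 = 1) \<or>
     (\<Omega> \<noteq> UNIV \<and> polygonal_domain \<Omega> \<and> n0 \<ge> 1 \<and>
        (\<exists>Rs. (\<forall>j<n0. is_ring N0 c0 \<beta> (Rs j)) \<and> disjoint_interiors n0 Rs \<and>
              \<Omega> = (\<Union>j<n0. Rs j)))"

definition step_functions :: "nat \<Rightarrow> real \<Rightarrow> real \<Rightarrow> pt set \<Rightarrow> nat \<Rightarrow> (pt \<Rightarrow> real) set" where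
  "step_functions N0 c0 \<beta> \<Omega> n =
     {S. \<exists>Rs cs. (\<forall>j<n. is_ring N0 c0 \<beta> (Rs j)) \<and> disjoint_interiors n Rs \<and>
          (if \<Omega> = UNIV then is_ring N0 c0 \<beta> (\<Union>j<n. Rs j) else \<Omega> = (\<Union>j<n. Rs j)) \<and>
          S = (\<lambda>x. \<Sum>j<n. cs j * indicator (Rs j) x)}"

text \<open>Real powers of extended nonnegative reals (for positive exponents).\<close>
definition epowr :: "ennreal \<Rightarrow> real \<Rightarrow> ennreal" where
  "epowr x a = (if x = \<infinity> then \<infinity> else ennreal (enn2real x powr a))"

definition Lnorm :: "pt set \<Rightarrow> real \<Rightarrow> (pt \<Rightarrow> real) \<Rightarrow> ennreal" where
  "Lnorm \<Omega> \<tau> g = epowr (\<integral>\<^sup>+ x. indicator \<Omega> x * ennreal (\<bar>g x\<bar> powr \<tau>) \<partial>lborel) (1 / \<tau>)"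

definition kdiff :: "pt set \<Rightarrow> nat \<Rightarrow> pt \<Rightarrow> (pt \<Rightarrow> real) \<Rightarrow> pt \<Rightarrow> real" where
  "kdiff \<Omega> k h f x =
     (if closed_segment x (x + real k *\<^sub>R h) \<subseteq> \<Omega>
      then (\<Sum>\<nu>\<le>k. (-1) ^ (k + \<nu>) * real (k choose \<nu>) * f (x + real \<nu> *\<^sub>R h))
      else 0)"

definition modulus_smoothness :: "pt set \<Rightarrow> nat \<Rightarrow> (pt \<Rightarrow> real) \<Rightarrow> real \<Rightarrow> real \<Rightarrow> ennreal" where
  "modulus_smoothness \<Omega> k f t \<tau> = (SUP h \<in> {h. norm h \<le> t}. Lnorm \<Omega> \<tau> (kdiff \<Omega> k h f))"

definition besov_seminorm :: "pt set \<Rightarrow> real \<Rightarrow> nat \<Rightarrow> real \<Rightarrow> (pt \<Rightarrow> real) \<Rightarrow> ennreal" where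
  "besov_seminorm \<Omega> s k \<tau> f =
     epowr (\<integral>\<^sup>+ t. indicator {0<..} t *
        epowr (ennreal (t powr (- s)) * modulus_smoothness \<Omega> k f t \<tau>) \<tau> * ennreal (1 / t) \<partial>lborel)
       (1 / \<tau>)"

abbreviation besov1 :: "pt set \<Rightarrow> real \<Rightarrow> real \<Rightarrow> (pt \<Rightarrow> real) \<Rightarrow> ennreal" where
  "besov1 \<Omega> s \<tau> f \<equiv> besov_seminorm \<Omega> s 1 \<tau> f"

end

theory Submission
  imports Defs
begin

text \<open>
  The vertices of the rings of both partitions form a set \<open>V\<close> of at most \<open>C n\<close> nodes; let
  \<open>\<rho>\<close> be the distance to \<open>V\<close>. By the triangle condition every ring contains a half disc of
  radius comparable to \<open>\<rho>(y)\<close> at each boundary point \<open>y\<close>, so in a disc of that radius each of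
  \<open>S\<^sub>1\<close>, \<open>S\<^sub>2\<close> takes at most two values, separated by a straight line.

  Write \<open>S = S\<^sub>1 - S\<^sub>2\<close>. On almost every line in the direction \<open>h\<close>, an isolated jump of \<open>S\<^sub>1\<close> is either
  far from the jumps of \<open>S\<^sub>2\<close> or can be paired with a single one. Translating the paired jump of \<open>S\<^sub>2\<close>
  onto that of \<open>S\<^sub>1\<close> does not change the norm of the difference of \<open>S\<^sub>2\<close>, and it leaves an error
  which only sees the values of \<open>S\<close> on intervals of length comparable to \<open>\<rho>\<close>. This matters because
  the thin strips between two nearly parallel edges make the Bernstein inequality fail for \<open>S\<close> itself.
  Hence the difference of \<open>S\<^sub>1\<close> is bounded by the difference of \<open>S\<^sub>2\<close>, with constant one, plus the
  integral of \<open>|S|\<^sup>\<tau> min(1, |h|/\<rho>)\<close>, and integrating over the step size reduces the theorem to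
  \<open>\<integral>|S|\<^sup>\<tau> \<rho>\<^bsup>-s\<tau>\<^esup> \<le> C n\<^bsup>s\<tau>/2\<^esup> \<parallel>S\<parallel>\<^sub>p\<^sup>\<tau>\<close>.

  Hoelder's inequality alone fails logarithmically here, since \<open>\<rho>\<^bsup>-2\<^esup>\<close> is not integrable. It does
  apply where the nodes branch at the scale \<open>\<rho>(x)\<close>. Elsewhere the nodes near \<open>x\<close> form an isolated
  cluster; there are \<open>O(n)\<close> clusters because they are laminar, around each of them \<open>S\<close> takes boundedly
  many values, and on a set \<open>T\<close> where \<open>S\<close> is constant the integral of \<open>\<rho>\<^bsup>-s\<tau>\<^esup>\<close> is at most
  \<open>C |T|\<^bsup>1-s\<tau>/2\<^esup>\<close>.
\<close>

section \<open>Polygonal boundaries\<close>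

text \<open>The factor one in front of \<open>S\<^sub>2\<close> decides the form of the proof. No
  triangle inequality with a constant may touch that term, so on a line each part of the difference
  of \<open>S\<^sub>2\<close> may be used once only: the translated unit intervals are kept in
  disjoint windows around the jumps, and away from the places where both functions are compared at
  the same point. For \<tau> >= 1 the seminorms are subadditive, whereas the regions add up as
  \<tau>-th powers; hence \<open>split_ineq\<close> with free factors \<open>A\<close>,
  \<open>B\<close> is carried through all integrals and optimised only at the end. The hypothesis
  \<open>s < 2 / p\<close> is equivalent to s\<tau> < 1, which makes the integral of t^(-s\<tau>-1)
  min(1, t/\<rho>) over the step sizes converge at 0 and produces the weight. The exponents in
  Hoelder's inequality are \<tau>/p and s\<tau>/2, with sum one; the second factor always comes from
  a function with integral O(n). On the branching part this function is 1/\<rho>^2, on the clusters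
  it is the sum of the normalised indicators of the pieces on which \<open>S\<close> is
  constant.\<close>

lemma plane_decomp:
  fixes e \<nu> x :: pt
  assumes "norm e = 1" "norm \<nu> = 1" "e \<bullet> \<nu> = 0"
  shows "x = (x \<bullet> e) *\<^sub>R e + (x \<bullet> \<nu>) *\<^sub>R \<nu>"
proof -
  have "e$1 * e$1 + e$2 * e$2 = 1" "\<nu>$1 * \<nu>$1 + \<nu>$2 * \<nu>$2 = 1" "e$1 * \<nu>$1 + e$2 * \<nu>$2 = 0"
    using assms by (simp_all add: norm_eq_1 inner_vec_def sum_2)
  then have "x$1 = (x$1 * e$1 + x$2 * e$2) * e$1 + (x$1 * \<nu>$1 + x$2 * \<nu>$2) * \<nu>$1"
    "x$2 = (x$1 * e$1 + x$2 * e$2) * e$2 + (x$1 * \<nu>$1 + x$2 * \<nu>$2) * \<nu>$2"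
    by algebra+
  then show ?thesis
    by (simp add: vec_eq_iff inner_vec_def sum_2 forall_2)
qed

lemma unit_normal_exists:
  fixes e :: pt
  assumes "norm e = 1"
  obtains \<nu> :: pt where "norm \<nu> = 1" "e \<bullet> \<nu> = 0"
proof
  let ?n = "vector [- e$2, e$1] :: pt"
  show "norm ?n = 1" using assms by (simp add: norm_eq_1 inner_vec_def sum_2 add.commute)
  show "e \<bullet> ?n = 0" by (simp add: inner_vec_def sum_2)
qed

lemma norm_decomp:
  fixes e \<nu> :: "'a::real_inner"
  assumes "norm e = 1" "norm \<nu> = 1" "e \<bullet> \<nu> = 0"
  shows "(norm (\<alpha> *\<^sub>R e + \<gamma> *\<^sub>R \<nu>))\<^sup>2 = \<alpha>\<^sup>2 + \<gamma>\<^sup>2"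
proof -
  have "e \<bullet> e = 1" "\<nu> \<bullet> \<nu> = 1" "\<nu> \<bullet> e = 0" using assms by (simp_all add: norm_eq_1 inner_commute)
  then show ?thesis using assms(3)
    unfolding power2_norm_eq_inner by (simp add: inner_add_left inner_add_right power2_eq_square)
qed

text \<open>The line through \<open>a\<close> and \<open>w\<close> has distance
  \<open>dist y a * ((w - a) \<bullet> \<nu>) / dist w a\<close> from \<open>y\<close>, which is at
  least \<open>\<kappa> * dist y a\<close>; likewise for \<open>b\<close>. So the half disc cannot
  cross either leg. In other words, \<kappa> is a lower bound for the sines of the two base
  angles.\<close>

lemma half_disc_subset_triangle:
  fixes a b w y z \<nu> :: pt
  assumes y: "y \<in> open_segment a b" and \<nu>: "norm \<nu> = 1" "(b - a) \<bullet> \<nu> = 0"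
    and H: "0 < (w - a) \<bullet> \<nu>" "\<kappa> * dist w a \<le> (w - a) \<bullet> \<nu>" "\<kappa> * dist w b \<le> (w - a) \<bullet> \<nu>"
    and z: "dist y z < \<kappa> * min (dist y a) (dist y b)" "0 \<le> (z - y) \<bullet> \<nu>"
  shows "z \<in> convex hull {a, b, w}"
proof -
  define L where "L = norm (b - a)"
  define e where "e = (1 / L) *\<^sub>R (b - a)"
  define h where "h = (w - a) \<bullet> \<nu>"
  define \<alpha> where "\<alpha> = (w - a) \<bullet> e"
  have ab: "a \<noteq> b" using y by auto
  have L: "L > 0" using ab by (simp add: L_def)
  have e: "norm e = 1" "e \<bullet> \<nu> = 0" using L \<nu> by (simp_all add: e_def L_def)
  have b: "b = a + L *\<^sub>R e" using L by (simp add: e_def)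
  obtain u where u: "0 < u" "u < 1" and yu: "y = (1 - u) *\<^sub>R a + u *\<^sub>R b"
    using y by (auto simp: in_segment)
  define Y where "Y = u * L"
  have Y: "0 < Y" "Y < L" using u L by (auto simp: Y_def)
  have yY: "y = a + Y *\<^sub>R e"
    unfolding yu b Y_def by (simp add: algebra_simps)
  have dya: "dist y a = Y" using Y e by (simp add: yY dist_norm)
  have "y - b = - ((L - Y) *\<^sub>R e)" by (simp add: yY b algebra_simps)
  then have dyb: "dist y b = L - Y" using Y e by (simp add: dist_norm)
  define \<xi> where "\<xi> = (z - y) \<bullet> e"
  define \<eta> where "\<eta> = (z - y) \<bullet> \<nu>"
  have zy: "z - y = \<xi> *\<^sub>R e + \<eta> *\<^sub>R \<nu>"
    unfolding \<xi>_def \<eta>_def by (rule plane_decomp) (use e \<nu> in auto)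
  have wa: "w - a = \<alpha> *\<^sub>R e + h *\<^sub>R \<nu>"
    unfolding \<alpha>_def h_def by (rule plane_decomp) (use e \<nu> in auto)
  have wb: "w - b = (\<alpha> - L) *\<^sub>R e + h *\<^sub>R \<nu>"
    using wa unfolding b by (simp add: algebra_simps)
  have hp: "h > 0" using H by (simp add: h_def)
  have \<eta>: "\<eta> \<ge> 0" using z by (simp add: \<eta>_def)
  have dz: "(dist y z)\<^sup>2 = \<xi>\<^sup>2 + \<eta>\<^sup>2"
    using norm_decomp[OF e(1) \<nu>(1) e(2), of \<xi> \<eta>] zy[symmetric] by (simp add: dist_norm norm_minus_commute)
  \<comment> \<open>Cauchy-Schwarz in coordinates: up to the sign of \<open>q\<close>, the left side
    is the cross product of \<open>z - y\<close> with a leg \<open>(A, h)\<close> of the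
    triangle.\<close>
  have CS: "\<eta> * A - q * h \<le> dist y z * N" if N: "N\<^sup>2 = A\<^sup>2 + h\<^sup>2" "N \<ge> 0" and q: "q\<^sup>2 = \<xi>\<^sup>2" for A N q
  proof -
    have "(q\<^sup>2 + \<eta>\<^sup>2) * (A\<^sup>2 + h\<^sup>2) - (\<eta> * A - q * h)\<^sup>2 = (q * A + \<eta> * h)\<^sup>2"
      by (simp add: power2_eq_square algebra_simps)
    then have "(\<eta> * A - q * h)\<^sup>2 \<le> (q\<^sup>2 + \<eta>\<^sup>2) * (A\<^sup>2 + h\<^sup>2)"
      by (smt (verit) zero_le_power2)
    also have "\<dots> = (dist y z * N)\<^sup>2" using dz N q by (simp add: power_mult_distrib)
    finally show ?thesis using N by (meson power2_le_imp_le zero_le_dist mult_nonneg_nonneg)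
  qed
  have na: "(dist w a)\<^sup>2 = \<alpha>\<^sup>2 + h\<^sup>2"
    using norm_decomp[OF e(1) \<nu>(1) e(2), of \<alpha> h] wa by (simp add: dist_norm)
  have nb: "(dist w b)\<^sup>2 = (L - \<alpha>)\<^sup>2 + h\<^sup>2"
    using norm_decomp[OF e(1) \<nu>(1) e(2), of "\<alpha> - L" h] wb by (simp add: dist_norm power2_commute)
  have zlt: "dist y z < \<kappa> * Y" "dist y z < \<kappa> * (L - Y)"
  proof -
    have "\<kappa> > 0" using z(1) dya dyb Y
      by (smt (verit, best) mult_nonneg_nonneg mult_nonpos_nonneg zero_le_dist)
    then show "dist y z < \<kappa> * Y" "dist y z < \<kappa> * (L - Y)"
      using z(1) dya dyb by (smt (verit, best) mult_left_mono min_def)+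
  qed
  \<comment> \<open>\<open>i1\<close> and \<open>i2\<close> put \<open>z\<close> on the inner side
    of the legs at \<open>a\<close> and at \<open>b\<close>; they become the signs of the
    barycentric coordinates \<open>q\<close> and \<open>1 - p - q\<close>.\<close>
  have i1: "\<eta> * \<alpha> - \<xi> * h \<le> Y * h"
  proof -
    have "\<eta> * \<alpha> - \<xi> * h \<le> dist y z * dist w a" using CS[OF na, of \<xi>] by simp
    also have "\<dots> \<le> (\<kappa> * Y) * dist w a" using zlt by (intro mult_right_mono) auto
    also have "\<dots> = Y * (\<kappa> * dist w a)" by simp
    also have "\<dots> \<le> Y * h" using H Y by (intro mult_left_mono) (auto simp: h_def)
    finally show ?thesis .
  qed
  have i2: "\<eta> * (L - \<alpha>) + \<xi> * h \<le> (L - Y) * h"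
  proof -
    have "\<eta> * (L - \<alpha>) + \<xi> * h \<le> dist y z * dist w b" using CS[OF nb, of "- \<xi>"] by simp
    also have "\<dots> \<le> (\<kappa> * (L - Y)) * dist w b" using zlt by (intro mult_right_mono) auto
    also have "\<dots> = (L - Y) * (\<kappa> * dist w b)" by simp
    also have "\<dots> \<le> (L - Y) * h" using H Y by (intro mult_left_mono) (auto simp: h_def)
    finally show ?thesis .
  qed
  define p where "p = \<eta> / h"
  define q where "q = (Y + \<xi> - p * \<alpha>) / L"
  have "p \<ge> 0" using \<eta> hp by (simp add: p_def)
  moreover have "q \<ge> 0" using i1 hp L by (simp add: q_def p_def field_simps)
  moreover have "1 - p - q \<ge> 0"
  proof -
    have "p * (L - \<alpha>) + \<xi> \<le> L - Y" using i2 hp by (simp add: p_def field_simps)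
    then have "(Y + \<xi> - p * \<alpha>) \<le> (1 - p) * L" by (simp add: algebra_simps)
    then have "q \<le> 1 - p" using L by (simp add: q_def pos_divide_le_eq)
    then show ?thesis by simp
  qed
  moreover have "z = (1 - p - q) *\<^sub>R a + q *\<^sub>R b + p *\<^sub>R w"
  proof -
    have "p *\<^sub>R (w - a) + q *\<^sub>R (b - a) = (p * \<alpha> + q * L) *\<^sub>R e + (p * h) *\<^sub>R \<nu>"
      unfolding wa unfolding b by (simp add: algebra_simps)
    also have "p * \<alpha> + q * L = Y + \<xi>" using L by (simp add: q_def)
    also have "p * h = \<eta>" using hp by (simp add: p_def)
    also have "(Y + \<xi>) *\<^sub>R e + \<eta> *\<^sub>R \<nu> = z - a" using zy yY by (simp add: algebra_simps)
    finally show ?thesis by (simp add: algebra_simps)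
  qed
  ultimately show ?thesis unfolding convex_hull_3
    by (intro CollectI exI[of _ "1 - p - q"] exI[of _ q] exI[of _ p]) auto
qed

section \<open>Edges of a frontier that is covered by finitely many segments\<close>

definition seg_of :: "pt \<times> pt \<Rightarrow> pt set" where
  "seg_of s = closed_segment (fst s) (snd s)"

text \<open>The segments of a frontier come as an arbitrary list and may cross or overlap, so
  crossing points count as vertices. An overlap along an interval adds nothing, since its ends are
  endpoints of segments.\<close>

definition seg_nodes :: "(pt \<times> pt) set \<Rightarrow> pt set" where
  "seg_nodes L = fst ` L \<union> snd ` L \<union> {q. \<exists>s\<in>L. \<exists>t\<in>L. seg_of s \<inter> seg_of t = {q}}"

lemma seg_nodes_finite_card:
  assumes "finite L"
  shows "finite (seg_nodes L)" "card (seg_nodes L) \<le> 2 * card L + (card L)\<^sup>2"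
proof -
  let ?X = "{q. \<exists>s\<in>L. \<exists>t\<in>L. seg_of s \<inter> seg_of t = {q}}"
  let ?f = "\<lambda>(s,t). the_elem (seg_of s \<inter> seg_of t)"
  have sub: "?X \<subseteq> ?f ` (L \<times> L)"
  proof
    fix q assume "q \<in> ?X"
    then obtain s t where "s \<in> L" "t \<in> L" "seg_of s \<inter> seg_of t = {q}" by auto
    then show "q \<in> ?f ` (L \<times> L)" by (intro image_eqI[of _ _ "(s,t)"]) auto
  qed
  have finX: "finite ?X" using sub assms by (meson finite_SigmaI finite_imageI finite_subset)
  then show "finite (seg_nodes L)" using assms by (simp add: seg_nodes_def)
  have "card ?X \<le> card (L \<times> L)"
    using sub assms by (meson card_image_le card_mono finite_SigmaI finite_imageI order_trans)
  then have "card ?X \<le> (card L)\<^sup>2" by (simp only: power2_eq_square card_cartesian_product)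
  moreover have "card (seg_nodes L) \<le> card (fst ` L \<union> snd ` L) + card ?X"
    unfolding seg_nodes_def by (rule card_Un_le)
  moreover have "card (fst ` L \<union> snd ` L) \<le> card L + card L"
    by (meson add_mono card_Un_le card_image_le[OF assms] order_trans)
  ultimately show "card (seg_nodes L) \<le> 2 * card L + (card L)\<^sup>2" by linarith
qed

lemma seg_of_line:
  assumes "p \<in> seg_of s" "q \<in> seg_of s" "p \<noteq> q" "(q - p) \<bullet> \<nu> = 0" "z \<in> seg_of s"
  shows "(z - p) \<bullet> \<nu> = 0"
proof -
  let ?d = "snd s - fst s"
  obtain u where u: "p = fst s + u *\<^sub>R ?d" using assms(1) by (auto simp: seg_of_def in_segment algebra_simps)
  obtain v where v: "q = fst s + v *\<^sub>R ?d" using assms(2) by (auto simp: seg_of_def in_segment algebra_simps)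
  obtain w where w: "z = fst s + w *\<^sub>R ?d" using assms(5) by (auto simp: seg_of_def in_segment algebra_simps)
  have "q - p = (v - u) *\<^sub>R ?d" unfolding u v by (simp add: algebra_simps)
  moreover have "v \<noteq> u" using assms(3) u v by auto
  ultimately have "?d \<bullet> \<nu> = 0" using assms(4) by simp
  moreover have "z - p = (w - u) *\<^sub>R ?d" unfolding u w by (simp add: algebra_simps)
  ultimately show ?thesis by simp
qed

lemma convex_half_ball:
  fixes y \<nu> :: "'a::real_inner"
  shows "convex {z \<in> ball y \<delta>. 0 < (z - y) \<bullet> \<nu>}"
proof -
  have "{z \<in> ball y \<delta>. 0 < (z - y) \<bullet> \<nu>} = ball y \<delta> \<inter> {z. \<nu> \<bullet> z > \<nu> \<bullet> y}"
    by (auto simp: inner_diff_right inner_diff_left inner_commute)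
  then show ?thesis by (simp add: convex_Int convex_halfspace_gt)
qed

lemma line_not_open:
  fixes y \<nu> :: "'a::real_inner"
  assumes "open U" "\<nu> \<noteq> 0" "U \<subseteq> {z. (z - y) \<bullet> \<nu> = 0}"
  shows "U = {}"
proof (rule ccontr)
  assume "U \<noteq> {}"
  then obtain z where z: "z \<in> U" by auto
  then obtain e where e: "e > 0" "ball z e \<subseteq> U" using assms(1) open_contains_ball by blast
  let ?w = "z + (e / (2 * norm \<nu>)) *\<^sub>R \<nu>"
  have "dist z ?w < e" using e assms(2) by (simp add: dist_norm)
  then have "?w \<in> U" using e by auto
  then have "(?w - y) \<bullet> \<nu> = 0" "(z - y) \<bullet> \<nu> = 0" using assms(3) z by auto
  then show False using e assms(2) by (simp add: algebra_simps inner_add_left)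
qed

text \<open>Two segments through \<open>y\<close> share a second point, as \<open>y\<close> is no
  node, and hence lie on one line; the other segments stay away from \<open>y\<close>. Each open
  half of a small disc then lies in \<open>D\<close> or in its complement. Regularity of both sets
  excludes that the two halves lie in the same one, so the frontier fills the whole
  diameter.\<close>

lemma flat_frontier:
  fixes D :: "pt set"
  assumes L: "finite L" and fr: "frontier D \<subseteq> (\<Union>s\<in>L. seg_of s)"
    and D: "D \<subseteq> closure (interior D)" "- D \<subseteq> closure (interior (- D))"
    and y: "y \<in> frontier D" "y \<notin> seg_nodes L"
  obtains \<nu> \<delta> where "norm \<nu> = 1" "\<delta> > 0" "\<And>z. z \<in> ball y \<delta> \<Longrightarrow> z \<in> frontier D \<longleftrightarrow> (z - y) \<bullet> \<nu> = 0"
proof -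
  obtain s0 where s0: "s0 \<in> L" "y \<in> seg_of s0" using fr y by auto
  have yn: "y \<noteq> fst s0" "y \<noteq> snd s0" using y(2) s0 by (auto simp: seg_nodes_def)
  define e where "e = (1 / norm (fst s0 - y)) *\<^sub>R (fst s0 - y)"
  have "norm e = 1" using yn by (simp add: e_def)
  then obtain \<nu> where \<nu>: "norm \<nu> = 1" "e \<bullet> \<nu> = 0" using unit_normal_exists by blast
  have s0\<nu>: "(fst s0 - y) \<bullet> \<nu> = 0" using \<nu>(2) yn by (simp add: e_def)
  have line0: "(z - y) \<bullet> \<nu> = 0" if "z \<in> seg_of s0" for z
    by (rule seg_of_line[OF s0(2) _ _ s0\<nu> that]) (use yn in \<open>auto simp: seg_of_def\<close>)
  have line: "(z - y) \<bullet> \<nu> = 0" if "s \<in> L" "y \<in> seg_of s" "z \<in> seg_of s" for s z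
  proof -
    have "seg_of s \<inter> seg_of s0 \<noteq> {y}" using y(2) that s0 by (auto simp: seg_nodes_def)
    then have "\<exists>q. q \<in> seg_of s \<and> q \<in> seg_of s0 \<and> y \<noteq> q" using that(2) s0(2) by blast
    then obtain q where q: "q \<in> seg_of s" "q \<in> seg_of s0" "y \<noteq> q" by blast
    show ?thesis by (rule seg_of_line[OF that(2) q(1,3) line0[OF q(2)] that(3)])
  qed
  let ?F = "\<Union>s\<in>{s\<in>L. y \<notin> seg_of s}. seg_of s"
  have "closed ?F" using L by (intro closed_UN) (auto simp: seg_of_def)
  then have "open (- ?F)" by (rule open_Compl)
  moreover have "y \<in> - ?F" by blast
  ultimately obtain \<delta> where \<delta>: "\<delta> > 0" "ball y \<delta> \<subseteq> - ?F" by (rule openE)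
  have sub: "(z - y) \<bullet> \<nu> = 0" if z: "z \<in> ball y \<delta>" "z \<in> frontier D" for z
  proof -
    obtain s where "s \<in> L" "z \<in> seg_of s" using fr z by auto
    then show ?thesis using line \<delta> z by blast
  qed
  let ?P = "{z \<in> ball y \<delta>. 0 < (z - y) \<bullet> \<nu>}" and ?M = "{z \<in> ball y \<delta>. 0 < (z - y) \<bullet> (- \<nu>)}"
  have type: "U \<subseteq> D \<or> U \<inter> D = {}" if "U = ?P \<or> U = ?M" for U
  proof -
    have "connected U" using that convex_half_ball convex_connected by blast
    moreover have "U \<inter> frontier D = {}" using that sub by fastforce
    ultimately show ?thesis by (metis Diff_eq_empty_iff connected_Int_frontier Int_commute)
  qed
  have cl: "z \<in> closure ?P" "z \<in> closure ?M" if "z \<in> ball y \<delta>" "(z - y) \<bullet> \<nu> = 0" for z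
  proof -
    have "z \<in> closure {x \<in> ball y \<delta>. 0 < (x - y) \<bullet> n}" if n: "norm n = 1" "(z - y) \<bullet> n = 0" for n
      unfolding closure_approachable
    proof (intro allI impI)
      fix \<epsilon> :: real assume "\<epsilon> > 0"
      define k where "k = min (\<epsilon>/2) ((\<delta> - dist y z)/2)"
      have k: "k > 0" "k < \<epsilon>" "k < \<delta> - dist y z"
        using \<open>\<epsilon> > 0\<close> \<open>z \<in> ball y \<delta>\<close> by (auto simp: k_def min_def)
      let ?x = "z + k *\<^sub>R n"
      have d: "dist ?x z = k" using k n by (simp add: dist_norm)
      have "dist y ?x < \<delta>" using d k dist_triangle[of y ?x z] by (simp add: dist_commute)
      moreover have "n \<bullet> n = 1" using n by (simp add: norm_eq_1)
      then have "0 < (?x - y) \<bullet> n" using n k by (simp add: inner_add_left inner_diff_left algebra_simps)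
      ultimately show "\<exists>x\<in>{x \<in> ball y \<delta>. 0 < (x - y) \<bullet> n}. dist x z < \<epsilon>"
        using d k by (intro bexI[of _ ?x]) auto
    qed
    from this[of \<nu>] this[of "-\<nu>"] show "z \<in> closure ?P" "z \<in> closure ?M" using \<nu> that by auto
  qed
  \<comment> \<open>A set that misses both half discs is confined to a line near \<open>y\<close>,
    so its interior is empty there. This is used for \<open>D\<close> and for
    \<open>- D\<close>.\<close>
  have no_both: False if X: "X \<subseteq> closure (interior X)" and y: "y \<in> frontier X" and "?P \<inter> X = {}" "?M \<inter> X = {}" for X
  proof -
    have "ball y \<delta> \<inter> X \<subseteq> {z. (z - y) \<bullet> \<nu> = 0}"
    proof
      fix z assume "z \<in> ball y \<delta> \<inter> X"
      then have "z \<notin> ?P" "z \<notin> ?M" "z \<in> ball y \<delta>" using that(3,4) by blast+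
      then show "z \<in> {z. (z - y) \<bullet> \<nu> = 0}" by simp
    qed
    then have "ball y \<delta> \<inter> interior X \<subseteq> {z. (z - y) \<bullet> \<nu> = 0}" using interior_subset by blast
    then have "ball y \<delta> \<inter> interior X = {}" using \<nu>
      by (intro line_not_open) auto
    then have "ball y \<delta> \<inter> closure (interior X) = {}" by (simp add: open_Int_closure_eq_empty)
    moreover have "closure X \<subseteq> closure (interior X)" using X by (simp add: closure_minimal)
    ultimately have "ball y \<delta> \<inter> closure X = {}" by blast
    moreover have "y \<in> closure X" using y by (simp add: frontier_def)
    moreover have "y \<in> ball y \<delta>" using \<delta>(1) by simp
    ultimately show False by blast
  qed
  have fr_iff: "z \<in> frontier D" if "z \<in> closure D" "z \<in> closure (- D)" for z
    using that by (simp add: frontier_def closure_complement)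
  have "(?P \<subseteq> D \<and> ?M \<subseteq> - D) \<or> (?P \<subseteq> - D \<and> ?M \<subseteq> D)"
  proof -
    have "?P \<subseteq> D \<or> ?P \<inter> D = {}" "?M \<subseteq> D \<or> ?M \<inter> D = {}" using type by blast+
    moreover have "\<not> (?P \<inter> D = {} \<and> ?M \<inter> D = {})" using no_both[OF D(1) y(1)] by blast
    moreover have "\<not> (?P \<subseteq> D \<and> ?M \<subseteq> D)"
    proof
      assume "?P \<subseteq> D \<and> ?M \<subseteq> D"
      then have "?P \<inter> (- D) = {}" "?M \<inter> (- D) = {}" by blast+
      moreover have "y \<in> frontier (- D)" using y(1) by (simp add: frontier_complement)
      ultimately show False using no_both[OF D(2)] by blast
    qed
    ultimately show ?thesis by blast
  qed
  then have "z \<in> frontier D" if "z \<in> ball y \<delta>" "(z - y) \<bullet> \<nu> = 0" for z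
    using cl[OF that] closure_mono[of ?P D] closure_mono[of ?M D]
      closure_mono[of ?P "-D"] closure_mono[of ?M "- D"] fr_iff[of z] by blast
  then show thesis using that[OF \<nu>(1) \<delta>(1)] sub by blast
qed

text \<open>The ray is followed up to the supremum \<open>b\<close> of the parameters reached within
  the frontier. Its end must be a node: at any other point the frontier is straight by
  \<open>flat_frontier\<close>, and the ray would run on along it.\<close>

lemma frontier_ray:
  fixes D :: "pt set"
  assumes L: "finite L" and fr: "frontier D \<subseteq> (\<Union>s\<in>L. seg_of s)"
    and D: "D \<subseteq> closure (interior D)" "- D \<subseteq> closure (interior (- D))"
    and e: "norm e = 1" and d: "d > 0" "\<And>r. 0 \<le> r \<Longrightarrow> r < d \<Longrightarrow> y + r *\<^sub>R e \<in> frontier D"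
  obtains b where "b > 0" "y + b *\<^sub>R e \<in> seg_nodes L" "\<And>r. 0 \<le> r \<Longrightarrow> r \<le> b \<Longrightarrow> y + r *\<^sub>R e \<in> frontier D"
    "\<And>s. s > b \<Longrightarrow> \<exists>r. 0 \<le> r \<and> r \<le> s \<and> y + r *\<^sub>R e \<notin> frontier D"
proof -
  define X where "X = {s. 0 \<le> s \<and> (\<forall>r. 0 \<le> r \<and> r \<le> s \<longrightarrow> y + r *\<^sub>R e \<in> frontier D)}"
  have "compact (\<Union>s\<in>L. seg_of s)" using L by (intro compact_UN) (auto simp: seg_of_def)
  then have "bounded (frontier D)" using fr bounded_subset compact_imp_bounded by blast
  then obtain M where M: "\<And>z. z \<in> frontier D \<Longrightarrow> norm z \<le> M" by (auto simp: bounded_iff)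
  have bdd: "s \<le> M + norm y" if "s \<in> X" for s
  proof -
    have "norm (y + s *\<^sub>R e) \<le> M" using that M by (auto simp: X_def)
    moreover have "norm (s *\<^sub>R e) \<le> norm (y + s *\<^sub>R e) + norm y"
      by (metis add_diff_cancel_left' norm_triangle_ineq4)
    ultimately show ?thesis using that e by (simp add: X_def)
  qed
  have BA: "bdd_above X" using bdd by (auto simp: bdd_above_def)
  have dX: "d/2 \<in> X" using d by (auto simp: X_def)
  define b where "b = Sup X"
  have "b \<ge> d/2" unfolding b_def by (rule cSup_upper[OF dX BA])
  then have b: "b > 0" using d by simp
  have lt: "y + r *\<^sub>R e \<in> frontier D" if r: "0 \<le> r" "r < b" for r
  proof -
    have "X \<noteq> {}" using dX by blast
    then obtain s where "s \<in> X" "r < s" using r(2) BA less_cSup_iff[of X r] unfolding b_def by blast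
    then show ?thesis using r by (auto simp: X_def)
  qed
  have lim: "((\<lambda>r. y + r *\<^sub>R e) \<longlongrightarrow> y + b *\<^sub>R e) (at_left b)"
    by (intro tendsto_intros)
  have "\<forall>\<^sub>F r in at_left b. y + r *\<^sub>R e \<in> frontier D"
    using lt b by (subst eventually_at_left[OF b]) (auto intro!: exI[of _ 0])
  then have bfr: "y + b *\<^sub>R e \<in> frontier D"
    by (rule Lim_in_closed_set[OF frontier_closed _ _ lim]) simp
  have le: "y + r *\<^sub>R e \<in> frontier D" if "0 \<le> r" "r \<le> b" for r
    using lt bfr that by (cases "r = b") auto
  have gt: "\<exists>r. 0 \<le> r \<and> r \<le> s \<and> y + r *\<^sub>R e \<notin> frontier D" if "s > b" for s
  proof (rule ccontr)
    assume "\<not> ?thesis"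
    then have "s \<in> X" using that b by (auto simp: X_def)
    then show False using that BA cSup_upper b_def by fastforce
  qed
  have "y + b *\<^sub>R e \<in> seg_nodes L"
  proof (rule ccontr)
    assume "y + b *\<^sub>R e \<notin> seg_nodes L"
    then obtain \<nu> \<delta> where \<nu>: "norm \<nu> = 1" "\<delta> > 0"
      "\<And>z. z \<in> ball (y + b *\<^sub>R e) \<delta> \<Longrightarrow> z \<in> frontier D \<longleftrightarrow> (z - (y + b *\<^sub>R e)) \<bullet> \<nu> = 0"
      using flat_frontier[OF L fr D bfr] by metis
    have in_ball: "y + r *\<^sub>R e \<in> ball (y + b *\<^sub>R e) \<delta>" if "\<bar>r - b\<bar> < \<delta>" for r
    proof -
      have "(y + b *\<^sub>R e) - (y + r *\<^sub>R e) = (b - r) *\<^sub>R e" by (simp add: algebra_simps)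
      then show ?thesis using that e by (simp add: dist_norm abs_minus_commute)
    qed
    have iff: "y + r *\<^sub>R e \<in> frontier D \<longleftrightarrow> (r - b) * (e \<bullet> \<nu>) = 0" if "\<bar>r - b\<bar> < \<delta>" for r
    proof -
      have "(y + r *\<^sub>R e) - (y + b *\<^sub>R e) = (r - b) *\<^sub>R e" by (simp add: algebra_simps)
      then show ?thesis using \<nu>(3)[OF in_ball[OF that]] by simp
    qed
    \<comment> \<open>A frontier point just before \<open>b\<close> forces \<open>e\<close> to be
      parallel to the flat piece; then the frontier also continues just behind \<open>b\<close>,
      against the choice of \<open>b\<close>.\<close>
    define k where "k = min (b/2) (\<delta>/2)"
    have k: "k > 0" "k < b" "k < \<delta>" using b \<nu> by (auto simp: k_def min_def)
    have "y + (b - k) *\<^sub>R e \<in> frontier D" using lt k by simp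
    then have "e \<bullet> \<nu> = 0" using iff[of "b - k"] k by simp
    then have "y + r *\<^sub>R e \<in> frontier D" if "\<bar>r - b\<bar> < \<delta>" for r using iff that by simp
    then have "b + k \<in> X" using k b le unfolding X_def
      by (smt (verit) mem_Collect_eq)
    then show False using k BA cSup_upper b_def by fastforce
  qed
  then show thesis using that b le gt by blast
qed

text \<open>The two opposite rays from \<open>y\<close> along the flat piece end in nodes. Their
  union is maximal in the sense of \<open>boundary_edge\<close>, because a larger segment would lie
  on the same line and leave the frontier. Edges in this sense are what the triangle condition of a
  ring speaks about.\<close>

lemma boundary_edge_through:
  fixes D :: "pt set"
  assumes L: "finite L" and fr: "frontier D \<subseteq> (\<Union>s\<in>L. seg_of s)"
    and D: "D \<subseteq> closure (interior D)" "- D \<subseteq> closure (interior (- D))"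
    and y: "y \<in> frontier D" "y \<notin> seg_nodes L"
  obtains a b where "a \<in> seg_nodes L" "b \<in> seg_nodes L" "boundary_edge D a b" "y \<in> open_segment a b"
proof -
  obtain \<nu> \<delta> where \<nu>: "norm \<nu> = 1" "\<delta> > 0" "\<And>z. z \<in> ball y \<delta> \<Longrightarrow> z \<in> frontier D \<longleftrightarrow> (z - y) \<bullet> \<nu> = 0"
    using flat_frontier[OF L fr D y] by metis
  obtain e where e: "norm e = 1" "\<nu> \<bullet> e = 0" using unit_normal_exists[OF \<nu>(1)] by blast
  have near: "y + r *\<^sub>R (c *\<^sub>R e) \<in> frontier D" if "\<bar>r\<bar> < \<delta>" "\<bar>c\<bar> = 1" for r c
  proof -
    have "y + r *\<^sub>R (c *\<^sub>R e) \<in> ball y \<delta>" using that e by (simp add: dist_norm abs_mult)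
    then show ?thesis using \<nu>(3) e by (simp add: inner_commute)
  qed
  have n1: "norm (1 *\<^sub>R e) = 1" "norm ((-1) *\<^sub>R e) = 1" using e by auto
  obtain rb where rb: "rb > 0" "y + rb *\<^sub>R (1 *\<^sub>R e) \<in> seg_nodes L"
    "\<And>r. 0 \<le> r \<Longrightarrow> r \<le> rb \<Longrightarrow> y + r *\<^sub>R (1 *\<^sub>R e) \<in> frontier D"
    "\<And>s. s > rb \<Longrightarrow> \<exists>r. 0 \<le> r \<and> r \<le> s \<and> y + r *\<^sub>R (1 *\<^sub>R e) \<notin> frontier D"
    by (rule frontier_ray[OF L fr D n1(1) \<nu>(2)]) (use near[of _ 1] in auto)
  obtain ra where ra: "ra > 0" "y + ra *\<^sub>R ((-1) *\<^sub>R e) \<in> seg_nodes L"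
    "\<And>r. 0 \<le> r \<Longrightarrow> r \<le> ra \<Longrightarrow> y + r *\<^sub>R ((-1) *\<^sub>R e) \<in> frontier D"
    "\<And>s. s > ra \<Longrightarrow> \<exists>r. 0 \<le> r \<and> r \<le> s \<and> y + r *\<^sub>R ((-1) *\<^sub>R e) \<notin> frontier D"
    by (rule frontier_ray[OF L fr D n1(2) \<nu>(2)]) (use near[of _ "-1"] in auto)
  define g where "g = (\<lambda>r. y + r *\<^sub>R e)"
  define a where "a = g (- ra)"
  define b where "b = g rb"
  have inj: "g r = g s \<longleftrightarrow> r = s" for r s using e by (auto simp: g_def)
  have seg: "closed_segment (g r) (g s) = g ` closed_segment r s" for r s
  proof -
    have "linear (\<lambda>x. x *\<^sub>R e)" by (auto intro!: linearI simp: algebra_simps)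
    then have "(\<lambda>x. x *\<^sub>R e) ` closed_segment r s = closed_segment (r *\<^sub>R e) (s *\<^sub>R e)"
      by (rule closed_segment_linear_image[symmetric])
    then have "closed_segment (g r) (g s) = (\<lambda>x. y + x) ` ((\<lambda>x. x *\<^sub>R e) ` closed_segment r s)"
      unfolding g_def by (simp only: closed_segment_translation)
    then show ?thesis by (simp only: image_image g_def)
  qed
  have in_fr: "g r \<in> frontier D" if "- ra \<le> r" "r \<le> rb" for r
    using ra(3)[of "-r"] rb(3)[of r] that by (cases "r \<ge> 0") (auto simp: g_def)
  have ab: "a \<noteq> b" using inj ra rb by (auto simp: a_def b_def)
  have segab: "closed_segment a b = g ` {- ra..rb}" 
    using ra rb by (simp add: a_def b_def seg closed_segment_eq_real_ivl)
  have "boundary_edge D a b"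
    unfolding boundary_edge_def
  proof (intro conjI allI impI)
    show "a \<noteq> b" by fact
    show "closed_segment a b \<subseteq> frontier D" using in_fr segab by auto
    fix u v assume uv: "closed_segment a b \<subseteq> closed_segment u v \<and> closed_segment u v \<subseteq> frontier D"
    have "a \<in> closed_segment u v" "b \<in> closed_segment u v" using uv by auto
    then obtain \<alpha> \<gamma> where \<alpha>: "a = u + \<alpha> *\<^sub>R (v - u)" and \<gamma>: "b = u + \<gamma> *\<^sub>R (v - u)"
      by (auto simp: in_segment algebra_simps)
    have ne: "\<alpha> \<noteq> \<gamma>" using ab \<alpha> \<gamma> by auto
    define k where "k = (rb + ra) / (\<gamma> - \<alpha>)"
    have "b - a = (rb + ra) *\<^sub>R e" by (simp add: a_def b_def g_def algebra_simps)
    moreover have ba: "b - a = (\<gamma> - \<alpha>) *\<^sub>R (v - u)" unfolding \<alpha> \<gamma> by (simp add: algebra_simps)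
    ultimately have vu: "v - u = k *\<^sub>R e"
    proof -
      have "v - u = (1 / (\<gamma> - \<alpha>)) *\<^sub>R (b - a)" using ne unfolding ba by simp
      then show ?thesis using \<open>b - a = (rb + ra) *\<^sub>R e\<close> by (simp add: k_def)
    qed
    have u: "u = g (- ra - \<alpha> * k)"
      using \<alpha> vu by (simp add: a_def g_def algebra_simps)
    have v: "v = g (- ra - \<alpha> * k + k)"
      using u vu by (simp add: g_def algebra_simps)
    obtain r s where rs: "u = g r" "v = g s" using u v by blast
    have uvs: "closed_segment u v = g ` closed_segment r s" using rs seg by simp
    have "g ` {- ra..rb} \<subseteq> g ` closed_segment r s" using uv uvs segab by simp
    then have sub: "{- ra..rb} \<subseteq> closed_segment r s" using inj by (auto simp: inj_image_subset_iff inj_on_def)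
    have frs: "g x \<in> frontier D" if "x \<in> closed_segment r s" for x using uv uvs that by auto
    have cs: "closed_segment r s = {min r s..max r s}" by (auto simp: closed_segment_eq_real_ivl)
    have mm: "min r s \<le> - ra" "rb \<le> max r s" using sub ra rb unfolding cs by auto
    have "\<not> max r s > rb"
    proof
      assume "max r s > rb"
      then obtain q where "0 \<le> q" "q \<le> max r s" "g q \<notin> frontier D" using rb(4) by (auto simp: g_def)
      then show False using frs[of q] mm ra unfolding cs by auto
    qed
    moreover have "\<not> - min r s > ra"
    proof
      assume "- min r s > ra"
      then obtain q where "0 \<le> q" "q \<le> - min r s" "g (- q) \<notin> frontier D" using ra(4) by (auto simp: g_def)
      then show False using frs[of "-q"] mm rb unfolding cs by auto
    qed
    ultimately have "closed_segment r s = {- ra..rb}" unfolding cs using mm by auto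
    then show "closed_segment u v = closed_segment a b" using uvs segab by simp
  qed
  moreover have "y \<in> open_segment a b"
  proof -
    have y0: "y = g 0" by (simp add: g_def)
    have "y \<in> closed_segment a b" unfolding segab y0 using ra rb by auto
    moreover have "y \<noteq> a" "y \<noteq> b" unfolding y0 a_def b_def inj using ra rb by auto
    ultimately show ?thesis by (simp add: open_segment_def)
  qed
  ultimately show thesis using that[of a b] ra(2) rb(2) by (simp add: a_def b_def g_def)
qed

section \<open>Cells with half discs\<close>

text \<open>\<open>V\<close> is a set of nodes (vertices) of the cell \<open>D\<close>. An empty \<open>V\<close> would make the condition void,
  because then \<open>infdist y V = 0\<close>.\<close>

definition half_disc_cell :: "real \<Rightarrow> pt set \<Rightarrow> pt set \<Rightarrow> bool" where
  "half_disc_cell \<kappa> V D \<longleftrightarrow> D \<subseteq> closure (interior D) \<and>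
     (\<forall>y \<in> frontier D - V. \<exists>\<nu>. norm \<nu> = 1 \<and>
        (\<forall>z. dist y z < \<kappa> * infdist y V \<and> 0 \<le> (z - y) \<bullet> \<nu> \<longrightarrow> z \<in> closure D))"

lemma half_disc_cell_mono:
  assumes "half_disc_cell \<kappa> V D" "V \<subseteq> V'" "V \<noteq> {}" "\<kappa>' \<le> \<kappa>" "0 \<le> \<kappa>'"
  shows "half_disc_cell \<kappa>' V' D"
proof -
  have "\<kappa>' * infdist y V' \<le> \<kappa> * infdist y V" for y
    using assms by (intro mult_mono infdist_mono infdist_nonneg) auto
  then show ?thesis using assms unfolding half_disc_cell_def
    by (meson Diff_iff order_less_le_trans subset_iff)
qed

section \<open>Rings, convex polygons and their complements as cells\<close>

lemma closed_convex_subset_closure_interior: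
  fixes Q :: "'a::euclidean_space set"
  assumes "convex Q" "interior Q \<noteq> {}"
  shows "Q \<subseteq> closure (interior Q)"
  using convex_closure_interior[OF assms] closure_subset by blast

lemma admissible_convex_facts:
  assumes "admissible_convex N0 c0 Q"
  obtains L x1 r1 x2 r2 where "compact Q" "convex Q" "Q \<subseteq> closure (interior Q)" "finite L" "card L \<le> N0"
    "frontier Q = (\<Union>s\<in>L. seg_of s)" "0 < r2" "ball x2 r2 \<subseteq> Q" "Q \<subseteq> ball x1 r1" "r1 \<le> c0 * r2"
proof -
  obtain segs :: "(pt \<times> pt) list" where s: "length segs \<le> N0"
    "frontier Q = (\<Union>(a, b) \<in> set segs. closed_segment a b)"
    using assms by (auto simp: admissible_convex_def polygonal_boundary_def)
  obtain x1 r1 x2 r2 where r: "0 < r2" "ball x2 r2 \<subseteq> Q" "Q \<subseteq> ball x1 r1" "r1 \<le> c0 * r2"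
    and Q: "compact Q" "convex Q"
    using assms by (auto simp: admissible_convex_def regular_set_def)
  have "ball x2 r2 \<subseteq> interior Q" using r(2) by (simp add: interior_maximal)
  then have "interior Q \<noteq> {}" using r(1) by (metis ball_eq_empty not_less subset_empty)
  then have "Q \<subseteq> closure (interior Q)" using Q closed_convex_subset_closure_interior by blast
  moreover have "card (set segs) \<le> N0" using s(1) card_length order_trans by blast
  moreover have "frontier Q = (\<Union>s\<in>set segs. seg_of s)"
    using s(2) by (auto simp: seg_of_def split_beta)
  ultimately show thesis using that[of "set segs" r2 x2 x1 r1] r Q by simp
qed

lemma angle_height:
  fixes d x \<nu> :: pt
  assumes "vec_angle d x = \<beta>" "0 < \<beta>" "\<beta> \<le> pi / 3" "d \<noteq> 0" "norm \<nu> = 1" "d \<bullet> \<nu> = 0"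
  shows "\<bar>x \<bullet> \<nu>\<bar> = sin \<beta> * norm x" "x \<noteq> 0"
proof -
  let ?X = "(d \<bullet> x) / (norm d * norm x)"
  show x: "x \<noteq> 0"
  proof
    assume "x = 0"
    \<comment> \<open>For \<open>x = 0\<close> the quotient in \<open>vec_angle\<close> is 0 by the
      convention for division by zero, so the angle would be the arccos of 0.\<close>
    then have "\<beta> = pi / 2" using assms(1) by (simp add: vec_angle_def)
    then show False using assms(3) pi_gt_zero by linarith
  qed
  have "\<bar>?X\<bar> \<le> 1"
    using Cauchy_Schwarz_ineq2[of d x] x assms(4) by (simp add: abs_mult)
  then have "cos \<beta> = ?X" using assms(1) unfolding vec_angle_def by (metis abs_le_D1 abs_le_D2 cos_arccos minus_le_iff)
  then have dx: "d \<bullet> x = cos \<beta> * norm d * norm x" using x assms(4) by (simp add: field_simps)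
  define e where "e = (1 / norm d) *\<^sub>R d"
  have e: "norm e = 1" "e \<bullet> \<nu> = 0" using assms by (simp_all add: e_def)
  have xe: "x \<bullet> e = cos \<beta> * norm x" using dx assms(4) by (simp add: e_def inner_commute field_simps)
  have "x = (x \<bullet> e) *\<^sub>R e + (x \<bullet> \<nu>) *\<^sub>R \<nu>" by (rule plane_decomp) (use e assms in auto)
  then have "(norm x)\<^sup>2 = (x \<bullet> e)\<^sup>2 + (x \<bullet> \<nu>)\<^sup>2" using norm_decomp[OF e(1) assms(5) e(2)] by metis
  then have "(x \<bullet> \<nu>)\<^sup>2 = (1 - (cos \<beta>)\<^sup>2) * (norm x)\<^sup>2" unfolding xe by (simp add: power_mult_distrib algebra_simps)
  also have "\<dots> = (sin \<beta> * norm x)\<^sup>2" by (simp add: sin_squared_eq power_mult_distrib)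
  finally have "\<bar>x \<bullet> \<nu>\<bar> = \<bar>sin \<beta> * norm x\<bar>" by (simp add: power2_eq_iff abs_eq_iff)
  moreover have "sin \<beta> \<ge> 0" using assms by (intro sin_ge_zero) auto
  ultimately show "\<bar>x \<bullet> \<nu>\<bar> = sin \<beta> * norm x" by (simp add: abs_mult)
qed

text \<open>With both base angles equal to \<beta>, the height is \<open>sin \<beta>\<close> times
  either leg, so \<open>half_disc_subset_triangle\<close> applies with this factor and with the
  normal pointing to the apex.\<close>

lemma beta_triangle_half_disc:
  assumes T: "beta_triangle_on \<beta> R u v" and \<beta>: "0 < \<beta>" "\<beta> \<le> pi / 3" and y: "y \<in> open_segment u v"
  obtains \<nu> where "norm \<nu> = 1"
    "\<And>z. dist y z < sin \<beta> * min (dist y u) (dist y v) \<Longrightarrow> 0 \<le> (z - y) \<bullet> \<nu> \<Longrightarrow> z \<in> closure R"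
proof -
  obtain w where w: "convex hull {u, v, w} \<subseteq> closure R"
    "vec_angle (v - u) (w - u) = \<beta>" "vec_angle (u - v) (w - v) = \<beta>"
    using T by (auto simp: beta_triangle_on_def)
  have uv: "u \<noteq> v" using y by auto
  define e where "e = (1 / norm (v - u)) *\<^sub>R (v - u)"
  have "norm e = 1" using uv by (simp add: e_def)
  then obtain \<nu>0 where \<nu>0: "norm \<nu>0 = 1" "e \<bullet> \<nu>0 = 0" using unit_normal_exists by blast
  define \<nu> where "\<nu> = (if 0 \<le> (w - u) \<bullet> \<nu>0 then \<nu>0 else - \<nu>0)"
  have \<nu>: "norm \<nu> = 1" "(v - u) \<bullet> \<nu> = 0" "0 \<le> (w - u) \<bullet> \<nu>"
    using \<nu>0 uv by (auto simp: \<nu>_def e_def)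
  have h1: "(w - u) \<bullet> \<nu> = sin \<beta> * dist w u" "w \<noteq> u"
    using angle_height[OF w(2) \<beta> _ \<nu>(1,2)] uv \<nu>(3) by (auto simp: dist_norm)
  have "(u - v) \<bullet> \<nu> = 0" using \<nu>(2) by (simp add: inner_diff_left)
  then have h2: "\<bar>(w - v) \<bullet> \<nu>\<bar> = sin \<beta> * dist w v"
    using angle_height[OF w(3) \<beta> _ \<nu>(1)] uv by (auto simp: dist_norm)
  have h3: "(w - v) \<bullet> \<nu> = (w - u) \<bullet> \<nu>" using \<nu>(2) by (simp add: inner_diff_left)
  have "sin \<beta> > 0" using \<beta> pi_gt_zero by (intro sin_gt_zero) linarith+
  then have "0 < (w - u) \<bullet> \<nu>" using h1 by simp
  moreover have "sin \<beta> * dist w v \<le> (w - u) \<bullet> \<nu>" using h2 h3 \<nu>(3) by simp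
  ultimately have "z \<in> closure R" if "dist y z < sin \<beta> * min (dist y u) (dist y v)" "0 \<le> (z - y) \<bullet> \<nu>" for z
    using half_disc_subset_triangle[OF y \<nu>(1,2) _ _ _ that, of w] h1(1) w(1) by auto
  then show thesis using that[OF \<nu>(1)] by blast
qed

lemma infdist_le2:
  assumes "a \<in> V" "b \<in> V"
  shows "infdist y V \<le> min (dist y a) (dist y b)"
  using assms by (simp add: infdist_le)

text \<open>\<open>flat_frontier\<close> needs a set and a complement that are both regular,
  although \<open>Q1 - Q2\<close> is not closed. On one side the open complement of
  \<open>Q2\<close> cuts the regular set \<open>Q1\<close>, on the other the open complement of
  \<open>Q1\<close> is joined to the regular set \<open>Q2\<close>.\<close>

lemma ring_facts:
  assumes "admissible_convex N0 c0 Q1" "Q2 = {} \<or> admissible_convex N0 c0 Q2"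
  obtains L where "finite L" "card L \<le> 2 * N0" "frontier (Q1 - Q2) \<subseteq> (\<Union>s\<in>L. seg_of s)"
    "Q1 - Q2 \<subseteq> closure (interior (Q1 - Q2))" "- (Q1 - Q2) \<subseteq> closure (interior (- (Q1 - Q2)))"
    "negligible (frontier (Q1 - Q2))" "closed Q1" "closed Q2"
proof -
  obtain L1 where 1: "finite L1" "card L1 \<le> N0" "frontier Q1 = (\<Union>s\<in>L1. seg_of s)" "Q1 \<subseteq> closure (interior Q1)" "compact Q1" "convex Q1"
    using admissible_convex_facts[OF assms(1)] by metis
  obtain L2 where 2: "finite L2" "card L2 \<le> N0" "frontier Q2 = (\<Union>s\<in>L2. seg_of s)" "Q2 \<subseteq> closure (interior Q2)" "compact Q2" "convex Q2"
  proof (cases "Q2 = {}")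
    case True
    then show ?thesis using that[of "{}"] by simp
  next
    case False
    then show ?thesis using assms(2) admissible_convex_facts that by metis
  qed
  have cl: "closed Q1" "closed Q2" using 1(5) 2(5) by (simp_all add: compact_imp_closed)
  have "card (L1 \<union> L2) \<le> 2 * N0" using card_Un_le[of L1 L2] 1 2 by linarith
  moreover have fr: "frontier (Q1 - Q2) \<subseteq> frontier Q1 \<union> frontier Q2"
    using frontier_Int_subset[of Q1 "- Q2"] by (simp add: Diff_eq)
  moreover have "negligible (frontier (Q1 - Q2))"
    using fr negligible_subset[OF negligible_Un[OF negligible_convex_frontier negligible_convex_frontier]] 1 2 by blast
  moreover have "Q1 - Q2 \<subseteq> closure (interior (Q1 - Q2))"
  proof -
    have "Q1 - Q2 \<subseteq> - Q2 \<inter> closure (interior Q1)" using 1 by auto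
    also have "\<dots> \<subseteq> closure (- Q2 \<inter> interior Q1)" using cl by (intro open_Int_closure_subset) auto
    also have "- Q2 \<inter> interior Q1 \<subseteq> interior (Q1 - Q2)"
      using cl interior_subset by (intro interior_maximal) auto
    then have "closure (- Q2 \<inter> interior Q1) \<subseteq> closure (interior (Q1 - Q2))" by (rule closure_mono)
    finally show ?thesis .
  qed
  moreover have "- (Q1 - Q2) \<subseteq> closure (interior (- (Q1 - Q2)))"
  proof -
    have "- Q1 \<subseteq> interior (- (Q1 - Q2))" using cl by (intro interior_maximal) auto
    moreover have "closure (interior Q2) \<subseteq> closure (interior (- (Q1 - Q2)))"
      by (intro closure_mono interior_mono) auto
    moreover have "- (Q1 - Q2) = - Q1 \<union> Q2" by auto
    ultimately show ?thesis using 2(4) closure_subset[of "interior (- (Q1 - Q2))"] by simp blast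
  qed
  ultimately show thesis using that[of "L1 \<union> L2"] 1 2 cl by auto
qed

text \<open>\<open>K\<close> bounds the nodes of at most \<open>2 * N\<close> segments, endpoints
  and crossings together. One splitting point is allowed for each pair of nodes, hence
  \<open>K\<^sup>2\<close>, and 1 counts the origin, which keeps the node set nonempty.\<close>

definition node_bound :: "nat \<Rightarrow> nat" where
  "node_bound N = (let K = 2 * (2 * N) + (2 * N)\<^sup>2 in 1 + K + K\<^sup>2)"

lemma seg_nodes_card_bound:
  assumes "finite L" "card L \<le> 2 * N"
  shows "card (seg_nodes L) \<le> 2 * (2 * N) + (2 * N)\<^sup>2"
proof -
  have "(card L)\<^sup>2 \<le> (2 * N)\<^sup>2" using assms(2) by (rule power_mono) simp
  then show ?thesis using seg_nodes_finite_card(2)[OF assms(1)] assms(2) by linarith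
qed

lemma ring_cell:
  assumes R: "is_ring N0 c0 \<beta> R" and \<beta>: "0 < \<beta>" "\<beta> \<le> pi / 3"
  obtains V where "finite V" "V \<noteq> {}" "card V \<le> node_bound N0" "half_disc_cell (sin \<beta>) V R"
    "negligible (frontier R)" "R \<in> sets borel"
proof -
  obtain Q1 Q2 where Q: "R = Q1 - Q2" "admissible_convex N0 c0 Q1" "Q2 = {} \<or> admissible_convex N0 c0 Q2"
    and edges: "\<And>a b. boundary_edge R a b \<Longrightarrow>
        (\<exists>m \<in> closed_segment a b. (m \<noteq> a \<longrightarrow> beta_triangle_on \<beta> R a m) \<and> (m \<noteq> b \<longrightarrow> beta_triangle_on \<beta> R m b))"
    using R unfolding is_ring_def by blast
  obtain L where L: "finite L" "card L \<le> 2 * N0" "frontier R \<subseteq> (\<Union>s\<in>L. seg_of s)"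
    "R \<subseteq> closure (interior R)" "- R \<subseteq> closure (interior (- R))" "negligible (frontier R)" and cl: "closed Q1" "closed Q2"
    using ring_facts[OF Q(2,3)] unfolding Q(1)[symmetric] by metis
  define m where "m = (\<lambda>(a, b). SOME m. m \<in> closed_segment a b \<and>
      (m \<noteq> a \<longrightarrow> beta_triangle_on \<beta> R a m) \<and> (m \<noteq> b \<longrightarrow> beta_triangle_on \<beta> R m b))"
  have m: "m (a, b) \<in> closed_segment a b \<and> (m (a, b) \<noteq> a \<longrightarrow> beta_triangle_on \<beta> R a (m (a, b))) \<and>
      (m (a, b) \<noteq> b \<longrightarrow> beta_triangle_on \<beta> R (m (a, b)) b)" if "boundary_edge R a b" for a b
    unfolding m_def prod.case by (rule someI_ex) (use edges[OF that] in blast)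
  define P where "P = seg_nodes L"
  \<comment> \<open>The triangles stand on the two halves of an edge and give no room at the
    splitting point between them, so this point has to be a node as well.\<close>
  define V where "V = insert 0 (P \<union> m ` (P \<times> P))"
  have finP: "finite P" using L seg_nodes_finite_card by (simp add: P_def)
  have cP: "card P \<le> 2 * (2 * N0) + (2 * N0)\<^sup>2" using L seg_nodes_card_bound by (simp add: P_def)
  have "card V \<le> node_bound N0"
  proof -
    have "card (m ` (P \<times> P)) \<le> card (P \<times> P)" using finP by (intro card_image_le) auto
    also have "\<dots> = (card P)\<^sup>2" by (simp only: card_cartesian_product power2_eq_square)
    also have "\<dots> \<le> (2 * (2 * N0) + (2 * N0)\<^sup>2)\<^sup>2" using cP by (intro power_mono) auto
    finally have "card (P \<union> m ` (P \<times> P)) \<le> (2 * (2 * N0) + (2 * N0)\<^sup>2) + (2 * (2 * N0) + (2 * N0)\<^sup>2)\<^sup>2"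
      using cP card_Un_le[of P "m ` (P \<times> P)"] by linarith
    moreover have "card V \<le> Suc (card (P \<union> m ` (P \<times> P)))" unfolding V_def by (rule card_insert_le_m1[THEN order_trans]) auto
    ultimately show ?thesis by (simp add: node_bound_def Let_def)
  qed
  moreover have "half_disc_cell (sin \<beta>) V R"
    unfolding half_disc_cell_def
  proof (intro conjI ballI L(4))
    fix y assume y: "y \<in> frontier R - V"
    then have "y \<notin> seg_nodes L" by (auto simp: V_def P_def)
    then obtain a b where ab: "a \<in> P" "b \<in> P" "boundary_edge R a b" "y \<in> open_segment a b"
      using boundary_edge_through[OF L(1,3,4,5), of y] y unfolding P_def by blast
    let ?m = "m (a, b)"
    note mm = m[OF ab(3)]
    have V: "a \<in> V" "b \<in> V" "?m \<in> V" using ab by (auto simp: V_def)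
    have "y \<in> closed_segment a ?m \<union> closed_segment ?m b"
      using ab(4) mm Un_closed_segment[of ?m a b] by (auto simp: open_segment_def)
    moreover have ne: "y \<noteq> a" "y \<noteq> b" "y \<noteq> ?m" using y V by auto
    ultimately have "y \<in> open_segment a ?m \<or> y \<in> open_segment ?m b" by (auto simp: open_segment_def)
    then obtain u v where uv: "u \<in> V" "v \<in> V" "y \<in> open_segment u v" "beta_triangle_on \<beta> R u v"
      using V mm by (metis empty_iff open_segment_idem)
    obtain \<nu> where \<nu>: "norm \<nu> = 1"
      "\<And>z. dist y z < sin \<beta> * min (dist y u) (dist y v) \<Longrightarrow> 0 \<le> (z - y) \<bullet> \<nu> \<Longrightarrow> z \<in> closure R"
      using beta_triangle_half_disc[OF uv(4) \<beta> uv(3)] by metis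
    have "sin \<beta> \<ge> 0" using \<beta> pi_gt_zero by (intro sin_ge_zero) linarith+
    then have "sin \<beta> * infdist y V \<le> sin \<beta> * min (dist y u) (dist y v)"
      using infdist_le2[OF uv(1,2)] by (rule mult_left_mono[rotated])
    then show "\<exists>\<nu>. norm \<nu> = 1 \<and>
        (\<forall>z. dist y z < sin \<beta> * infdist y V \<and> 0 \<le> (z - y) \<bullet> \<nu> \<longrightarrow> z \<in> closure R)"
      using \<nu> by (metis order_less_le_trans)
  qed
  moreover have "R \<in> sets borel" unfolding Q using cl by auto
  ultimately show thesis
    using that[of V] finP L(6) by (simp add: V_def)
qed

lemma supporting_line:
  fixes Q :: "pt set"
  assumes "convex Q" "closed Q" "y \<in> frontier Q"
  obtains \<nu> where "norm \<nu> = 1" "\<And>z. z \<in> Q \<Longrightarrow> 0 \<le> (z - y) \<bullet> \<nu>"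
proof -
  have y: "y \<in> closure Q" "y \<notin> interior Q" using assms by (auto simp: frontier_def)
  obtain a where a: "a \<noteq> 0" "\<And>x. x \<in> Q \<Longrightarrow> a \<bullet> y \<le> a \<bullet> x"
  proof (cases "rel_interior Q = interior Q")
    case True
    then show ?thesis
      using supporting_hyperplane_rel_boundary[OF assms(1), of y] y assms(2) that by (metis closure_closed)
  next
    case False
    \<comment> \<open>A convex set with empty interior lies in a line, which then serves as
      supporting line.\<close>
    then have "interior Q = {}" using rel_interior_nonempty_interior by blast
    then obtain a b where ab: "a \<noteq> 0" "Q \<subseteq> {x. a \<bullet> x = b}"
      using empty_interior_subset_hyperplane[OF assms(1)] by metis
    have "y \<in> Q" using y assms(2) by (simp add: closure_closed)
    moreover have "a \<bullet> x = b" if "x \<in> Q" for x using ab(2) that by blast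
    ultimately show ?thesis using that[OF ab(1)] by simp
  qed
  show thesis
  proof (rule that[of "(1 / norm a) *\<^sub>R a"])
    show "norm ((1 / norm a) *\<^sub>R a) = 1" using a by simp
    fix z assume "z \<in> Q"
    then have "0 \<le> a \<bullet> (z - y)" using a by (simp add: inner_diff_right)
    then show "0 \<le> (z - y) \<bullet> ((1 / norm a) *\<^sub>R a)"
      by (simp add: inner_commute)
  qed
qed

text \<open>The hole of the outer ring is only known to be regular, with no triangle condition from
  its inside. The centre \<open>x2\<close> of the inner ball replaces the apex: its height over
  every edge is at least \<open>r2\<close>, and its distance from the ends of the edge is at most
  \<open>2 * r1\<close>, so the sines of the base angles are at least
  \<open>1 / (2 * c0)\<close>.\<close>

lemma convex_polygon_cell:
  assumes Q: "admissible_convex N0 c0 Q" and c0: "1 \<le> c0"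
  obtains V where "finite V" "V \<noteq> {}" "card V \<le> node_bound N0" "half_disc_cell (1 / (2 * c0)) V Q"
    "negligible (frontier Q)" "closed Q"
proof -
  obtain L x1 r1 x2 r2 where Q: "compact Q" "convex Q" "Q \<subseteq> closure (interior Q)" and L: "finite L" "card L \<le> N0"
    "frontier Q = (\<Union>s\<in>L. seg_of s)" and r: "0 < r2" "ball x2 r2 \<subseteq> Q" "Q \<subseteq> ball x1 r1" "r1 \<le> c0 * r2"
    using admissible_convex_facts[OF Q] by metis
  have cl: "closed Q" using Q compact_imp_closed by auto
  have compl: "- Q \<subseteq> closure (interior (- Q))"
    using cl by (simp add: interior_open open_Compl closure_subset)
  define V where "V = insert 0 (seg_nodes L)"
  have "card (seg_nodes L) \<le> 2 * (2 * N0) + (2 * N0)\<^sup>2" using L by (intro seg_nodes_card_bound) auto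
  moreover have "card V \<le> Suc (card (seg_nodes L))" unfolding V_def by (rule card_insert_le_m1[THEN order_trans]) auto
  ultimately have cV: "card V \<le> node_bound N0" by (simp add: node_bound_def Let_def)
  have "half_disc_cell (1 / (2 * c0)) V Q"
    unfolding half_disc_cell_def
  proof (intro conjI ballI Q(3))
    fix y assume y: "y \<in> frontier Q - V"
    then obtain a b where ab: "a \<in> seg_nodes L" "b \<in> seg_nodes L" "boundary_edge Q a b" "y \<in> open_segment a b"
      using boundary_edge_through[OF L(1) _ Q(3) compl, of y] L(3) unfolding V_def by blast
    have abQ: "a \<in> Q" "b \<in> Q"
      using ab(3) cl by (auto simp: boundary_edge_def frontier_def closure_closed)
    have yQ: "y \<in> frontier Q" using y by auto
    obtain \<nu> where \<nu>: "norm \<nu> = 1" "\<And>z. z \<in> Q \<Longrightarrow> 0 \<le> (z - y) \<bullet> \<nu>"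
      using supporting_line[OF Q(2) cl yQ] by metis
    obtain u where u: "0 < u" "u < 1" "y = (1 - u) *\<^sub>R a + u *\<^sub>R b" using ab(4) by (auto simp: in_segment)
    have "a - y = (- u) *\<^sub>R (b - a)" "b - y = (1 - u) *\<^sub>R (b - a)" unfolding u(3) by (simp_all add: algebra_simps)
    then have "0 \<le> (- u) * ((b - a) \<bullet> \<nu>)" "0 \<le> (1 - u) * ((b - a) \<bullet> \<nu>)"
      using \<nu>(2)[OF abQ(1)] \<nu>(2)[OF abQ(2)] by simp_all
    then have ba: "(b - a) \<bullet> \<nu> = 0" using u(1,2)
      by (metis antisym diff_gt_0_iff_gt mult_minus_left neg_0_le_iff_le mult_le_0_iff zero_le_mult_iff linorder_not_le)
    have ya: "(x2 - a) \<bullet> \<nu> = (x2 - y) \<bullet> \<nu>" using ba \<open>a - y = _\<close>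
      by (metis (no_types, lifting) diff_add_cancel inner_add_left inner_scaleR_left mult_zero_right add_diff_eq add.right_neutral)
    \<comment> \<open>The ball about \<open>x2\<close> lies on one side of the supporting line. As
      it is open, the contradiction uses a shift \<open>k\<close> strictly below
      \<open>r2\<close>.\<close>
    have H: "r2 \<le> (x2 - y) \<bullet> \<nu>"
    proof (rule ccontr)
      assume "\<not> ?thesis"
      define k where "k = max 0 (((x2 - y) \<bullet> \<nu> + r2) / 2)"
      have k: "0 \<le> k" "k < r2" "(x2 - y) \<bullet> \<nu> < k" using \<open>\<not> _\<close> r(1) by (auto simp: k_def max_def)
      have "x2 - k *\<^sub>R \<nu> \<in> Q" using r(2) k \<nu>(1) by (intro subsetD[OF r(2)]) (simp add: dist_norm)
      then have "0 \<le> (x2 - k *\<^sub>R \<nu> - y) \<bullet> \<nu>" by (rule \<nu>)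
      moreover have "(x2 - k *\<^sub>R \<nu> - y) \<bullet> \<nu> = (x2 - y) \<bullet> \<nu> - k"
        using \<nu>(1) by (simp add: inner_diff_left norm_eq_1)
      ultimately show False using k by simp
    qed
    have D: "1 / (2 * c0) * dist x2 q \<le> r2" if "q \<in> Q" for q
    proof -
      have "x2 \<in> Q" using r by auto
      then have "dist x1 x2 < r1" "dist x1 q < r1" using that r(3) by auto
      then have "dist x2 q \<le> 2 * r1" using dist_triangle3[of x2 q x1] by simp
      also have "\<dots> \<le> 2 * (c0 * r2)" using r by simp
      finally show ?thesis using c0 by (simp add: field_simps)
    qed
    have hull: "convex hull {a, b, x2} \<subseteq> Q"
      using abQ r Q(2) by (intro hull_minimal) auto
    have "z \<in> closure Q" if z: "dist y z < 1 / (2 * c0) * infdist y V" "0 \<le> (z - y) \<bullet> \<nu>" for z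
    proof -
      have "1 / (2 * c0) * infdist y V \<le> 1 / (2 * c0) * min (dist y a) (dist y b)"
        using ab c0 by (intro mult_left_mono infdist_le2) (auto simp: V_def)
      then have zz: "dist y z < 1 / (2 * c0) * min (dist y a) (dist y b)" using z by simp
      have "z \<in> convex hull {a, b, x2}"
        by (rule half_disc_subset_triangle[OF ab(4) \<nu>(1) ba _ _ _ zz z(2)])
          (use H r(1) D[OF abQ(1)] D[OF abQ(2)] ya in linarith)+
      then show ?thesis using hull closure_subset by blast
    qed
    then show "\<exists>\<nu>. norm \<nu> = 1 \<and>
        (\<forall>z. dist y z < 1 / (2 * c0) * infdist y V \<and> 0 \<le> (z - y) \<bullet> \<nu> \<longrightarrow> z \<in> closure Q)"
      using \<nu>(1) by blast
  qed
  then show thesis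
    using that[of V] cV seg_nodes_finite_card(1)[OF L(1)] negligible_convex_frontier[OF Q(2)] cl by (simp add: V_def)
qed

text \<open>Beyond a supporting line lies an entire half plane of the complement, so half discs of
  every radius fit, for arbitrary \<kappa> and \<open>V\<close>.\<close>

lemma convex_compl_cell:
  assumes "closed Q" "convex Q"
  shows "half_disc_cell \<kappa> V (- Q)"
  unfolding half_disc_cell_def
proof (intro conjI ballI)
  show "- Q \<subseteq> closure (interior (- Q))"
    using assms by (simp add: interior_open open_Compl closure_subset)
  fix y assume "y \<in> frontier (- Q) - V"
  then have "y \<in> frontier Q" by (simp add: frontier_complement)
  then obtain \<nu> where \<nu>: "norm \<nu> = 1" "\<And>z. z \<in> Q \<Longrightarrow> 0 \<le> (z - y) \<bullet> \<nu>"
    using supporting_line assms by metis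
  have "{z. (- \<nu>) \<bullet> z > (- \<nu>) \<bullet> y} \<subseteq> - Q"
  proof
    fix z assume "z \<in> {z. (- \<nu>) \<bullet> z > (- \<nu>) \<bullet> y}"
    then show "z \<in> - Q" using \<nu>(2)[of z] by (auto simp: inner_diff_left inner_diff_right inner_commute)
  qed
  then have "closure {z. (- \<nu>) \<bullet> z > (- \<nu>) \<bullet> y} \<subseteq> closure (- Q)" by (rule closure_mono)
  moreover have "closure {z. (- \<nu>) \<bullet> z > (- \<nu>) \<bullet> y} = {z. (- \<nu>) \<bullet> z \<ge> (- \<nu>) \<bullet> y}"
    using \<nu>(1) by (intro closure_halfspace_gt) auto
  ultimately have "z \<in> closure (- Q)" if "0 \<le> (z - y) \<bullet> (- \<nu>)" for z
    using that by (auto simp: inner_diff_left inner_diff_right inner_commute)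
  then show "\<exists>\<nu>. norm \<nu> = 1 \<and> (\<forall>z. dist y z < \<kappa> * infdist y V \<and> 0 \<le> (z - y) \<bullet> \<nu> \<longrightarrow> z \<in> closure (- Q))"
    using \<nu>(1) by (intro exI[of _ "- \<nu>"]) auto
qed

text \<open>Only the interiors are disjoint, as cells may share boundary points; statements about
  values therefore hold off the null set of frontiers. \<open>V\<close> is a parameter of its own so
  that two tilings can use the same nodes.\<close>

definition cell_tiling :: "real \<Rightarrow> pt set \<Rightarrow> nat set \<Rightarrow> (nat \<Rightarrow> pt set) \<Rightarrow> pt set \<Rightarrow> bool" where
  "cell_tiling \<kappa> V I D \<Omega> \<longleftrightarrow> finite I \<and> finite V \<and> V \<noteq> {} \<and> closed \<Omega> \<and> \<Omega> = (\<Union>i\<in>I. D i) \<and>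
     (\<forall>i\<in>I. half_disc_cell \<kappa> V (D i) \<and> negligible (frontier (D i)) \<and> D i \<in> sets borel) \<and>
     (\<forall>i\<in>I. \<forall>j\<in>I. i \<noteq> j \<longrightarrow> interior (D i) \<inter> interior (D j) = {})"

lemma polygonal_domain_closed:
  assumes "polygonal_domain \<Omega>"
  shows "closed \<Omega>"
proof -
  obtain T :: "(pt \<times> pt \<times> pt) set" where T: "finite T" "\<Omega> = (\<Union>(a, b, c) \<in> T. convex hull {a, b, c})"
    using assms by (auto simp: polygonal_domain_def)
  show ?thesis unfolding T(2)
    by (intro closed_UN T(1)) (auto intro!: compact_imp_closed finite_imp_compact_convex_hull)
qed

lemma ring_family_nodes:
  assumes \<beta>: "0 < \<beta>" "\<beta> \<le> pi / 3" and R: "\<And>j. j < n \<Longrightarrow> is_ring N0 c0 \<beta> (Rs j)" and n: "n \<ge> 1"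
  obtains V where "finite V" "V \<noteq> {}" "card V \<le> n * node_bound N0"
    "\<And>j. j < n \<Longrightarrow> half_disc_cell (sin \<beta>) V (Rs j) \<and> negligible (frontier (Rs j)) \<and> Rs j \<in> sets borel"
proof -
  have "\<exists>V. finite V \<and> V \<noteq> {} \<and> card V \<le> node_bound N0 \<and> half_disc_cell (sin \<beta>) V (Rs j) \<and>
    negligible (frontier (Rs j)) \<and> Rs j \<in> sets borel" if "j < n" for j
    using ring_cell[OF R[OF that] \<beta>] by metis
  then obtain W where W: "\<And>j. j < n \<Longrightarrow> finite (W j) \<and> W j \<noteq> {} \<and> card (W j) \<le> node_bound N0 \<and> half_disc_cell (sin \<beta>) (W j) (Rs j) \<and>
    negligible (frontier (Rs j)) \<and> Rs j \<in> sets borel" by metis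
  define V where "V = (\<Union>j<n. W j)"
  have "sin \<beta> \<ge> 0" using \<beta> pi_gt_zero by (intro sin_ge_zero) linarith+
  have "half_disc_cell (sin \<beta>) V (Rs j)" if "j < n" for j
  proof (rule half_disc_cell_mono)
    show "half_disc_cell (sin \<beta>) (W j) (Rs j)" "W j \<noteq> {}" using W[OF that] by blast+
    show "W j \<subseteq> V" using that by (auto simp: V_def)
  qed (use \<open>sin \<beta> \<ge> 0\<close> in simp_all)
  moreover have "card V \<le> (\<Sum>j<n. card (W j))" unfolding V_def by (rule card_UN_le) auto
  moreover have "(\<Sum>j<n. card (W j)) \<le> (\<Sum>j<n. node_bound N0)"
    by (rule sum_mono) (use W in blast)
  ultimately have "card V \<le> n * node_bound N0" by simp
  moreover have "finite V" unfolding V_def using W by blast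
  moreover have "W 0 \<noteq> {}" "W 0 \<subseteq> V" using W[of 0] n by (auto simp: V_def)
  then have "V \<noteq> {}" by blast
  moreover note \<open>\<And>j. j < n \<Longrightarrow> half_disc_cell (sin \<beta>) V (Rs j)\<close>
  ultimately show thesis using that[of V] W by blast
qed

text \<open>If \<open>\<Omega>\<close> is the whole plane, the hole of the outer ring and its unbounded complement are added as
  two further cells, on which the function vanishes.\<close>

lemma step_function_tiling:
  assumes \<beta>: "0 < \<beta>" "\<beta> \<le> pi / 3" and c0: "1 \<le> c0"
    and \<Omega>: "admissible_domain N0 c0 \<beta> n0 \<Omega>" and n: "n0 \<le> n" and S: "S \<in> step_functions N0 c0 \<beta> \<Omega> n"
  obtains V I D c where "cell_tiling (min (sin \<beta>) (1 / (2 * c0))) V I D \<Omega>"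
    "card V \<le> 2 * n * node_bound N0" "S = (\<lambda>x. \<Sum>i\<in>I. c i * indicator (D i) x)"
proof -
  define \<kappa> where "\<kappa> = min (sin \<beta>) (1 / (2 * c0))"
  have sb: "sin \<beta> \<ge> 0" using \<beta> pi_gt_zero by (intro sin_ge_zero) linarith+
  have \<kappa>: "0 \<le> \<kappa>" "\<kappa> \<le> sin \<beta>" "\<kappa> \<le> 1 / (2 * c0)" using sb c0 by (auto simp: \<kappa>_def)
  have n1: "n \<ge> 1" using \<Omega> n by (auto simp: admissible_domain_def)
  obtain Rs cs where R: "\<And>j. j < n \<Longrightarrow> is_ring N0 c0 \<beta> (Rs j)" and dj: "disjoint_interiors n Rs"
    and un: "if \<Omega> = UNIV then is_ring N0 c0 \<beta> (\<Union>j<n. Rs j) else \<Omega> = (\<Union>j<n. Rs j)"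
    and Seq: "S = (\<lambda>x. \<Sum>j<n. cs j * indicator (Rs j) x)"
    using S by (auto simp: step_functions_def)
  obtain V where V: "finite V" "V \<noteq> {}" "card V \<le> n * node_bound N0"
    "\<And>j. j < n \<Longrightarrow> half_disc_cell (sin \<beta>) V (Rs j) \<and> negligible (frontier (Rs j)) \<and> Rs j \<in> sets borel"
    by (rule ring_family_nodes[OF \<beta> R n1]) blast+
  show thesis
  proof (cases "\<Omega> = UNIV")
    case False
    then have "closed \<Omega>" using \<Omega> polygonal_domain_closed by (auto simp: admissible_domain_def)
    moreover have "half_disc_cell \<kappa> V (Rs j)" if "j < n" for j
      by (rule half_disc_cell_mono[OF conjunct1[OF V(4)[OF that]] order_refl V(2) \<kappa>(2,1)])
    ultimately have "cell_tiling \<kappa> V {..<n} Rs \<Omega>"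
      using V dj un False by (auto simp: cell_tiling_def disjoint_interiors_def)
    moreover have "card V \<le> 2 * n * node_bound N0" using V by simp
    ultimately show thesis using that Seq unfolding \<kappa>_def by blast
  next
    case True
    then obtain Q1 Q2 where Q: "(\<Union>j<n. Rs j) = Q1 - Q2" "admissible_convex N0 c0 Q1" "Q2 = {} \<or> Q2 \<subseteq> Q1 \<and> admissible_convex N0 c0 Q2"
      using un by (auto simp: is_ring_def)
    obtain V2 where V2: "finite V2" "V2 \<noteq> {}" "card V2 \<le> node_bound N0" "half_disc_cell (1 / (2 * c0)) V2 Q2"
      "negligible (frontier Q2)" "closed Q2"
    proof (cases "Q2 = {}")
      case True
      have "half_disc_cell (1 / (2 * c0)) {0} {}" by (simp add: half_disc_cell_def)
      then show ?thesis using that[of "{0}"] True by (simp add: node_bound_def Let_def)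
    next
      case False
      then show ?thesis using Q(3) convex_polygon_cell[OF _ c0] that by metis
    qed
    have Q1: "closed Q1" "convex Q1" "negligible (frontier Q1)"
      using convex_polygon_cell[OF Q(2) c0] Q(2) by (metis admissible_convex_def regular_set_def)+
    define D where "D = (\<lambda>j. if j < n then Rs j else if j = n then Q2 else - Q1)"
    define c where "c = (\<lambda>j. if j < n then cs j else 0)"
    have D: "D j = Rs j" "c j = cs j" if "j < n" for j using that by (auto simp: D_def c_def)
    have Dn: "D n = Q2" "D (Suc n) = - Q1" "c n = 0" "c (Suc n) = 0" by (auto simp: D_def c_def)
    have I: "i \<in> {..<n+2} \<longleftrightarrow> i < n \<or> i = n \<or> i = Suc n" for i by auto
    have cells: "half_disc_cell \<kappa> (V \<union> V2) (D i)" if "i \<in> {..<n+2}" for i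
    proof -
      have "half_disc_cell \<kappa> (V \<union> V2) (Rs i)" if "i < n" for i
        by (rule half_disc_cell_mono[OF conjunct1[OF V(4)[OF that]] Un_upper1 V(2) \<kappa>(2,1)])
      moreover have "half_disc_cell \<kappa> (V \<union> V2) Q2"
        by (rule half_disc_cell_mono[OF V2(4) Un_upper2 V2(2) \<kappa>(3,1)])
      ultimately show ?thesis using that D Dn convex_compl_cell[OF Q1(1,2)] unfolding I by metis
    qed
    have other: "negligible (frontier (D i)) \<and> D i \<in> sets borel" if "i \<in> {..<n+2}" for i
      using that unfolding I using V V2 Q1 D Dn by (auto simp: frontier_complement)
    have "(\<Union>i\<in>{..<n+2}. D i) = (\<Union>i<n. D i) \<union> D n \<union> D (Suc n)" unfolding set_eq_iff UN_iff bex_simps Un_iff Bex_def I by blast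
    also have "(\<Union>i<n. D i) = Q1 - Q2" using D Q(1) by auto
    finally have cover: "UNIV = (\<Union>i\<in>{..<n+2}. D i)" using Dn by auto
    have sub: "Rs i \<subseteq> Q1 - Q2" if "i < n" for i using that Q(1) by blast
    have disj: "interior (D i) \<inter> interior (D j) = {}" if "i \<in> {..<n+2}" "j \<in> {..<n+2}" "i < j" for i j
    proof (cases "j < n")
      case True
      then show ?thesis using that D dj by (auto simp: disjoint_interiors_def)
    next
      case False
      then have "D i \<inter> D j = {}" using that sub[of i] D Dn Q(3) unfolding I by auto
      then show ?thesis using interior_subset by blast
    qed
    have "interior (D i) \<inter> interior (D j) = {}" if "i \<in> {..<n+2}" "j \<in> {..<n+2}" "i \<noteq> j" for i j
      using that disj[of i j] disj[of j i] by (cases "i < j") (auto simp: Int_commute)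
    then have "cell_tiling \<kappa> (V \<union> V2) {..<n+2} D \<Omega>"
      unfolding cell_tiling_def using V(1,2) V2(1) cells other cover[symmetric] True by auto
    moreover have "card (V \<union> V2) \<le> 2 * n * node_bound N0"
    proof -
      have "card (V \<union> V2) \<le> n * node_bound N0 + 1 * node_bound N0" using card_Un_le[of V V2] V V2 by linarith
      also have "\<dots> \<le> n * node_bound N0 + n * node_bound N0" using n1 by (intro add_mono mult_mono) auto
      finally show ?thesis by simp
    qed
    moreover have "S = (\<lambda>x. \<Sum>i\<in>{..<n+2}. c i * indicator (D i) x)"
      unfolding Seq using D Dn by (auto simp: fun_eq_iff intro!: sum.cong)
    ultimately show thesis using that unfolding \<kappa>_def by blast
  qed
qed

section \<open>Local two-phase structure and counting of cells\<close>

lemma half_disc_cell_closure: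
  assumes "half_disc_cell \<kappa> V D"
  shows "closure D \<subseteq> closure (interior D)"
  using assms by (simp add: half_disc_cell_def closure_minimal)

text \<open>Each closure is the closure of the interior, so a nonempty open set inside two closures
  would meet both interiors in a common point.\<close>

lemma cell_tiling_closure_disjoint:
  assumes T: "cell_tiling \<kappa> V I D \<Omega>" and ij: "i \<in> I" "j \<in> I" "i \<noteq> j"
    and W: "open W" "W \<subseteq> closure (D i)" "W \<subseteq> closure (D j)"
  shows "W = {}"
proof (rule ccontr)
  assume "W \<noteq> {}"
  have c: "closure (D k) \<subseteq> closure (interior (D k))" if "k \<in> I" for k
    using T that half_disc_cell_closure by (auto simp: cell_tiling_def)
  have "W \<inter> closure (interior (D i)) \<noteq> {}" using \<open>W \<noteq> {}\<close> W c[OF ij(1)] by blast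
  then have ne: "W \<inter> interior (D i) \<noteq> {}" by (metis W(1) open_Int_closure_eq_empty)
  have "open (W \<inter> interior (D i))" using W(1) by auto
  moreover have "(W \<inter> interior (D i)) \<inter> closure (interior (D j)) \<noteq> {}" using ne W c[OF ij(2)] by blast
  ultimately have "(W \<inter> interior (D i)) \<inter> interior (D j) \<noteq> {}" by (metis open_Int_closure_eq_empty)
  then show False using T ij by (auto simp: cell_tiling_def)
qed

lemma cell_tiling_value:
  assumes T: "cell_tiling \<kappa> V I D \<Omega>" and i: "i \<in> I" "x \<in> closure (D i)" and x: "x \<notin> (\<Union>i\<in>I. frontier (D i))"
  shows "(\<Sum>i\<in>I. c i * indicator (D i) x) = (c i :: real)" "x \<in> interior (D i)"
proof -
  have int: "x \<in> interior (D k)" if "k \<in> I" "x \<in> closure (D k)" for k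
    using x that by (auto simp: frontier_def)
  then show xi: "x \<in> interior (D i)" using i by blast
  have fin: "finite I" using T by (simp add: cell_tiling_def)
  have "indicator (D k) x = (0::real)" if "k \<in> I" "k \<noteq> i" for k
  proof -
    have "x \<notin> D k"
    proof
      assume "x \<in> D k"
      then have "x \<in> interior (D k)" using int that closure_subset by blast
      then show False using T that i xi by (auto simp: cell_tiling_def)
    qed
    then show ?thesis by simp
  qed
  moreover have "x \<in> D i" using xi interior_subset by blast
  ultimately have "(\<Sum>k\<in>I. c k * indicator (D k) x) = (\<Sum>k\<in>I. if k = i then c i else 0)"
    by (intro sum.cong) auto
  also have "\<dots> = c i" using fin i by simp
  finally show "(\<Sum>i\<in>I. c i * indicator (D i) x) = c i" .
qed

lemma infdist_nbhd:
  "infdist x V \<le> infdist y V + dist x y"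
  using infdist_triangle[of x V y] .

text \<open>The segment from \<open>x\<close> to \<open>x'\<close> is connected and covered by the
  closures of the cells, so some point \<open>y\<close> on it lies in two of them, one belonging to
  the cell of \<open>x\<close>. The half discs of these two cells at \<open>y\<close> cannot overlap
  in an open set. Hence their normals are opposite, and together they fill a disc around
  \<open>y\<close> that contains the ball around \<open>x\<close>. This gives the straight interface
  and also the inclusion in \<Omega>.\<close>

lemma step_function_two_phase:
  fixes S :: "pt \<Rightarrow> real"
  assumes T: "cell_tiling \<kappa> V I D \<Omega>" and \<kappa>: "0 < \<kappa>" "\<kappa> \<le> 1"
    and S: "S = (\<lambda>x. \<Sum>i\<in>I. c i * indicator (D i) x)" and N: "N = (\<Union>i\<in>I. frontier (D i))"
    and x: "x \<notin> N" "x' \<notin> N" "closed_segment x x' \<subseteq> \<Omega>" "dist x x' < \<kappa> / 4 * infdist x V" "S x \<noteq> S x'"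
  obtains y \<nu> c1 c2 where "ball x (\<kappa> / 4 * infdist x V) \<subseteq> \<Omega>" "norm \<nu> = 1"
    "\<And>z. z \<in> ball x (\<kappa> / 4 * infdist x V) - N \<Longrightarrow>
      (0 < (z - y) \<bullet> \<nu> \<and> S z = c1) \<or> ((z - y) \<bullet> \<nu> < 0 \<and> S z = c2)"
proof -
  have fin: "finite I" "finite V" "V \<noteq> {}" and \<Omega>: "\<Omega> = (\<Union>i\<in>I. D i)" "closed \<Omega>" using T by (auto simp: cell_tiling_def)
  have cell: "half_disc_cell \<kappa> V (D i)" if "i \<in> I" for i using T that by (auto simp: cell_tiling_def)
  obtain j where j: "j \<in> I" "x \<in> D j" using x(3) \<Omega> by (metis UN_E ends_in_segment(1) subsetD)
  define B where "B = (\<Union>i\<in>I - {j}. closure (D i))"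
  have "closed B" unfolding B_def using fin by (intro closed_UN) auto
  have val: "S z = c k" if "k \<in> I" "z \<in> closure (D k)" "z \<notin> N" for z k
  proof -
    have "z \<notin> (\<Union>i\<in>I. frontier (D i))" using that(3) unfolding N .
    then show ?thesis unfolding S by (rule cell_tiling_value(1)[OF T that(1,2)])
  qed
  have "x' \<notin> closure (D j)"
    using val[OF j(1)] x j(2) closure_subset by (metis subsetD)
  moreover have "x' \<in> \<Omega>" using x(3) by auto
  ultimately have "x' \<in> B" using \<Omega> closure_subset unfolding B_def by blast
  have "closed_segment x x' \<subseteq> closure (D j) \<union> B"
    using x(3) \<Omega> closure_subset unfolding B_def by blast
  moreover have "closure (D j) \<inter> closed_segment x x' \<noteq> {}" using j(2) closure_subset by (metis disjoint_iff ends_in_segment(1) subsetD)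
  moreover have "B \<inter> closed_segment x x' \<noteq> {}" using \<open>x' \<in> B\<close> by auto
  ultimately have "closure (D j) \<inter> B \<inter> closed_segment x x' \<noteq> {}"
    using connected_closedD[OF connected_segment(1)[of x x'], of "closure (D j)" B] \<open>closed B\<close> by auto
  then obtain y i where y: "y \<in> closed_segment x x'" "y \<in> closure (D j)" "i \<in> I" "i \<noteq> j" "y \<in> closure (D i)"
    unfolding B_def by blast
  have fr: "y \<in> frontier (D k)" if "k \<in> I" "l \<in> I" "k \<noteq> l" "y \<in> closure (D k)" "y \<in> closure (D l)" for k l
  proof -
    have "y \<notin> interior (D k)"
    proof
      assume yk: "y \<in> interior (D k)"
      have "y \<in> closure (interior (D l))" using half_disc_cell_closure[OF cell[OF that(2)]] that by auto
      then have "interior (D k) \<inter> interior (D l) \<noteq> {}" using yk by (metis disjoint_iff open_Int_closure_eq_empty open_interior)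
      then show False using T that by (auto simp: cell_tiling_def)
    qed
    then show ?thesis using that by (simp add: frontier_def)
  qed
  have yfr: "y \<in> frontier (D j)" "y \<in> frontier (D i)" using fr y j by blast+
  let ?\<rho> = "infdist x V"
  have dxy: "dist x y < \<kappa> / 4 * ?\<rho>" using dist_in_closed_segment[OF y(1)] x(4) by (simp add: dist_commute)
  have \<rho>: "?\<rho> > 0" using x(4) \<kappa> by (smt (verit) zero_le_dist infdist_nonneg mult_not_zero mult_nonneg_nonneg zero_less_mult_iff)
  \<comment> \<open>Since \<open>dist x y\<close> is below \<open>\<kappa> / 4 * ?\<rho>\<close> and
    \<open>\<kappa> \<le> 1\<close>, three quarters of \<open>?\<rho>\<close> remain at
    \<open>y\<close>; two radii \<open>\<kappa> / 4 * ?\<rho>\<close> then fit into the disc of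
    radius \<open>?R\<close>.\<close>
  have \<rho>y: "3 / 4 * ?\<rho> \<le> infdist y V"
  proof -
    have "?\<rho> \<le> infdist y V + dist x y" by (rule infdist_nbhd)
    moreover have "\<kappa> / 4 * ?\<rho> \<le> 1 / 4 * ?\<rho>" using \<kappa> \<rho> by (intro mult_right_mono) auto
    ultimately show ?thesis using dxy by simp
  qed
  have yV: "y \<notin> V" using \<rho>y \<rho> by auto
  obtain \<nu> where \<nu>: "norm \<nu> = 1" "\<And>z. dist y z < \<kappa> * infdist y V \<Longrightarrow> 0 \<le> (z - y) \<bullet> \<nu> \<Longrightarrow> z \<in> closure (D j)"
    using cell[OF j(1)] yfr(1) yV unfolding half_disc_cell_def by blast
  obtain \<mu> where \<mu>: "norm \<mu> = 1" "\<And>z. dist y z < \<kappa> * infdist y V \<Longrightarrow> 0 \<le> (z - y) \<bullet> \<mu> \<Longrightarrow> z \<in> closure (D i)"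
    using cell[OF y(3)] yfr(2) yV unfolding half_disc_cell_def by blast
  let ?R = "\<kappa> * infdist y V"
  have R: "?R > 0" using \<kappa> \<rho> \<rho>y by simp
  \<comment> \<open>Otherwise \<open>\<nu> + \<mu>\<close> has the positive inner product
    \<open>q\<close> with both normals, and a small step in this direction enters both half
    discs.\<close>
  have \<mu>\<nu>: "\<mu> = - \<nu>"
  proof (rule ccontr)
    assume ne: "\<mu> \<noteq> - \<nu>"
    define q where "q = 1 + \<nu> \<bullet> \<mu>"
    have "(norm (\<nu> + \<mu>))\<^sup>2 = 2 * q" using \<nu>(1) \<mu>(1)
      by (simp add: power2_norm_eq_inner inner_add_left inner_add_right norm_eq_1 inner_commute q_def)
    moreover have "norm (\<nu> + \<mu>) > 0" using ne by (metis add.commute eq_neg_iff_add_eq_0 zero_less_norm_iff)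
    ultimately have q: "q > 0" by (smt (verit) zero_less_power)
    define W where "W = ball y ?R \<inter> {z. \<nu> \<bullet> z > \<nu> \<bullet> y} \<inter> {z. \<mu> \<bullet> z > \<mu> \<bullet> y}"
    have "open W" unfolding W_def by (intro open_Int open_halfspace_gt open_ball)
    moreover have "W \<subseteq> closure (D i)" "W \<subseteq> closure (D j)"
      using \<nu>(2) \<mu>(2) by (auto simp: W_def inner_diff_left inner_diff_right inner_commute)
    ultimately have "W = {}" using cell_tiling_closure_disjoint[OF T y(3) j(1) y(4)] by blast
    moreover have "y + (?R / 4) *\<^sub>R (\<nu> + \<mu>) \<in> W"
    proof -
      have "norm (\<nu> + \<mu>) \<le> 2" using norm_triangle_ineq[of \<nu> \<mu>] \<nu> \<mu> by simp
      then have "?R / 4 * norm (\<nu> + \<mu>) \<le> ?R / 4 * 2" using R by (intro mult_left_mono) auto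
      then have "dist y (y + (?R / 4) *\<^sub>R (\<nu> + \<mu>)) < ?R" using R by (simp add: dist_norm)
      moreover have "\<nu> \<bullet> (\<nu> + \<mu>) = q" "\<mu> \<bullet> (\<nu> + \<mu>) = q"
        using \<nu> \<mu> by (simp_all add: q_def inner_add_right norm_eq_1 inner_commute)
      ultimately show ?thesis using R q by (simp add: W_def inner_add_right[of _ y])
    qed
    ultimately show False by blast
  qed
  have sub: "z \<in> ball y ?R" if "z \<in> ball x (\<kappa> / 4 * ?\<rho>)" for z
  proof -
    have "dist y z \<le> dist x y + dist x z" by (metis dist_commute dist_triangle)
    also have "\<dots> < \<kappa> / 4 * ?\<rho> + \<kappa> / 4 * ?\<rho>" using dxy that by simp
    also have "\<dots> \<le> \<kappa> * (3 / 4 * ?\<rho>)" using \<kappa> \<rho> by simp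
    also have "\<dots> \<le> ?R" using \<rho>y \<kappa> by (intro mult_left_mono) auto
    finally show ?thesis by simp
  qed
  have half: "(0 \<le> (z - y) \<bullet> \<nu> \<longrightarrow> z \<in> closure (D j)) \<and> ((z - y) \<bullet> \<nu> \<le> 0 \<longrightarrow> z \<in> closure (D i))"
    if "z \<in> ball x (\<kappa> / 4 * ?\<rho>)" for z
    using sub[OF that] \<nu>(2)[of z] \<mu>(2)[of z] \<mu>\<nu> by auto
  show thesis
  proof (rule that[of \<nu> y "c j" "c i"])
    have "closure (D k) \<subseteq> \<Omega>" if "k \<in> I" for k using \<Omega> that by (intro closure_minimal) auto
    then show "ball x (\<kappa> / 4 * ?\<rho>) \<subseteq> \<Omega>" using half j y(3) by (meson linear subsetD subsetI)
    fix z assume z: "z \<in> ball x (\<kappa> / 4 * ?\<rho>) - N"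
    have "(z - y) \<bullet> \<nu> \<noteq> 0"
    proof
      assume "(z - y) \<bullet> \<nu> = 0"
      then have "z \<in> closure (D j)" "z \<in> closure (D i)" using half[of z] z by auto
      then have "z \<in> interior (D j)" "z \<in> interior (D i)"
        using cell_tiling_value(2)[OF T] j y(3) z N by blast+
      then show False using T j(1) y(3,4) by (auto simp: cell_tiling_def)
    qed
    then show "(0 < (z - y) \<bullet> \<nu> \<and> S z = c j) \<or> ((z - y) \<bullet> \<nu> < 0 \<and> S z = c i)"
      using half[of z] z val[OF j(1)] val[OF y(3)] by (meson DiffD1 DiffD2 linorder_neqE_linordered_idom order_less_imp_le)
  qed (rule \<nu>(1))
qed

text \<open>A point of the cell in the disc that is farthest from \<open>c\<close> lies on the circle: otherwise it could
  be moved outwards along the edge, as there are no nodes nearby.\<close>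

lemma cell_reaches_circle:
  assumes cell: "half_disc_cell \<kappa> V D" and \<kappa>: "0 < \<kappa>" and V: "finite V" "V \<noteq> {}"
    and x: "x \<in> closure D" "dist c x \<le> R" and free: "\<And>z. dist c x \<le> dist c z \<Longrightarrow> dist c z \<le> R \<Longrightarrow> z \<notin> V"
  obtains z where "z \<in> closure D" "dist c z = R"
proof -
  have "compact (closure D \<inter> cball c R)" by (simp add: closed_Int_compact)
  moreover have "x \<in> closure D \<inter> cball c R" using x by auto
  then have "closure D \<inter> cball c R \<noteq> {}" by blast
  moreover have "continuous_on (closure D \<inter> cball c R) (dist c)" by (intro continuous_intros)
  ultimately obtain z where "z \<in> closure D \<inter> cball c R" "\<forall>w\<in>closure D \<inter> cball c R. dist c w \<le> dist c z"
    using continuous_attains_sup[of "closure D \<inter> cball c R" "dist c"] by blast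
  then have z: "z \<in> closure D" "dist c z \<le> R" "\<And>w. w \<in> closure D \<Longrightarrow> dist c w \<le> R \<Longrightarrow> dist c w \<le> dist c z"
    by auto
  have "dist c z = R"
  proof (rule ccontr)
    assume "dist c z \<noteq> R"
    then have lt: "dist c z < R" using z by simp
    have "z \<notin> V" using free[of z] z x by blast
    then have pos: "infdist z V > 0" using V
      by (metis finite_imp_closed in_closed_iff_infdist_zero infdist_nonneg le_less)
    have "\<exists>e \<delta>. norm e = 1 \<and> 0 < \<delta> \<and> (\<forall>k. \<bar>k\<bar> < \<delta> \<longrightarrow> z + k *\<^sub>R e \<in> closure D)"
    proof (cases "z \<in> frontier D")
      case True
      then obtain \<nu> where \<nu>: "norm \<nu> = 1" "\<And>w. dist z w < \<kappa> * infdist z V \<Longrightarrow> 0 \<le> (w - z) \<bullet> \<nu> \<Longrightarrow> w \<in> closure D"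
        using cell \<open>z \<notin> V\<close> unfolding half_disc_cell_def by blast
      obtain e where e: "norm e = 1" "\<nu> \<bullet> e = 0" using unit_normal_exists[OF \<nu>(1)] by blast
      then have "\<forall>k. \<bar>k\<bar> < \<kappa> * infdist z V \<longrightarrow> z + k *\<^sub>R e \<in> closure D"
        using \<nu>(2) by (auto simp: dist_norm inner_commute)
      moreover have "0 < \<kappa> * infdist z V" using pos \<kappa> by simp
      ultimately show ?thesis using e by blast
    next
      case False
      then have "z \<in> interior D" using z by (simp add: frontier_def)
      then obtain \<delta> where \<delta>: "\<delta> > 0" "ball z \<delta> \<subseteq> D" by (meson mem_interior)
      have "z + k *\<^sub>R axis 1 1 \<in> closure D" if "\<bar>k\<bar> < \<delta>" for k
      proof -
        have "z + k *\<^sub>R axis 1 1 \<in> ball z \<delta>" using that by (simp add: dist_norm)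
        then show ?thesis using \<delta> closure_subset by blast
      qed
      then show ?thesis using \<delta> by (intro exI[of _ "axis 1 1"]) auto
    qed
    then obtain e \<delta> where e: "norm e = 1" "\<delta> > 0" "\<And>k. \<bar>k\<bar> < \<delta> \<Longrightarrow> z + k *\<^sub>R e \<in> closure D" by blast
    define t where "t = min (\<delta> / 2) (R - dist c z)"
    have t: "0 < t" "t < \<delta>" "t \<le> R - dist c z" using e lt by (auto simp: t_def min_def)
    \<comment> \<open>The sign makes the linear term of the squared distance nonnegative; the
      quadratic term then moves the point strictly outwards, even if \<open>e\<close> is tangential
      to the circle.\<close>
    define k where "k = (if 0 \<le> (z - c) \<bullet> e then t else - t)"
    have k: "\<bar>k\<bar> = t" "0 \<le> k * ((z - c) \<bullet> e)" using t by (auto simp: k_def mult_le_0_iff)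
    have "dist c (z + k *\<^sub>R e) \<le> dist c z + dist z (z + k *\<^sub>R e)" by (rule dist_triangle)
    also have "\<dots> \<le> R" using e t k by (simp add: dist_norm)
    finally have "dist c (z + k *\<^sub>R e) \<le> dist c z" using z(3) e(3) k t by simp
    then have "(norm ((z - c) + k *\<^sub>R e))\<^sup>2 \<le> (norm (z - c))\<^sup>2"
      by (simp add: dist_norm norm_minus_commute algebra_simps power_mono)
    moreover have "(norm ((z - c) + k *\<^sub>R e))\<^sup>2 = (norm (z - c))\<^sup>2 + 2 * (k * ((z - c) \<bullet> e)) + k\<^sup>2"
      using e(1) unfolding power2_norm_eq_inner
      by (simp add: inner_add_left inner_add_right inner_commute norm_eq_1 power2_eq_square)
    ultimately have "k\<^sup>2 \<le> 0" using k by linarith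
    then show False using k t by simp
  qed
  then show thesis using that z by blast
qed

text \<open>Either the ball of radius \<open>r / 2\<close> around \<open>z\<close> misses the
  frontier and lies in the cell, or it contains a frontier point \<open>y\<close>. In the latter
  case \<open>infdist y V > r / 2\<close>, and the half disc at \<open>y\<close> has room for a ball
  centred on its normal.\<close>

lemma cell_contains_ball:
  assumes cell: "half_disc_cell \<kappa> V D" and \<kappa>: "0 < \<kappa>" "\<kappa> \<le> 1" and z: "z \<in> closure D" "r \<le> infdist z V" "0 < r"
  obtains q where "ball q (\<kappa> * r / 4) \<subseteq> closure D" "ball q (\<kappa> * r / 4) \<subseteq> ball z r"
proof (cases "ball z (r / 2) \<inter> frontier D = {}")
  case True
  have "ball z (r / 2) \<inter> D \<noteq> {}" using z by (metis centre_in_ball disjoint_iff half_gt_zero open_Int_closure_eq_empty open_ball)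
  then have "ball z (r / 2) \<subseteq> D" using True connected_Int_frontier[OF connected_ball] by blast
  moreover have "\<kappa> * r / 4 \<le> r / 2" "\<kappa> * r / 4 \<le> r" using \<kappa> z by auto
  ultimately show thesis using that[of z] closure_subset
    by (meson order_trans subset_ball)
next
  case False
  then obtain y where y: "y \<in> frontier D" "dist z y < r / 2" by auto
  have \<rho>: "r / 2 < infdist y V" using infdist_nbhd[of z V y] z y by simp
  then have "y \<notin> V" using z by auto
  then obtain \<nu> where \<nu>: "norm \<nu> = 1" "\<And>w. dist y w < \<kappa> * infdist y V \<Longrightarrow> 0 \<le> (w - y) \<bullet> \<nu> \<Longrightarrow> w \<in> closure D"
    using cell y unfolding half_disc_cell_def by blast
  define s where "s = \<kappa> * r / 4"
  have s: "s > 0" "4 * s \<le> r" using \<kappa> z by (auto simp: s_def)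
  define q where "q = y + s *\<^sub>R \<nu>"
  have dyq: "dist y q = s" using \<nu> s by (simp add: q_def dist_norm)
  have near: "dist y w < 2 * s" if "dist q w < s" for w
    using dist_triangle[of y w q] dyq that by simp
  show thesis
  proof (rule that[of q]; fold s_def; rule subsetI)
    fix w assume w: "w \<in> ball q s"
    have "dist y w < 2 * s" using near w by simp
    then show "w \<in> ball z r" using dist_triangle[of z w y] y s by simp
    have "2 * s = \<kappa> * (r / 2)" by (simp add: s_def)
    also have "\<dots> \<le> \<kappa> * infdist y V" using \<rho> \<kappa> by (intro mult_left_mono) auto
    finally have "dist y w < \<kappa> * infdist y V" using \<open>dist y w < 2 * s\<close> by simp
    moreover have "0 \<le> (w - y) \<bullet> \<nu>"
    proof -
      have "\<bar>(w - q) \<bullet> \<nu>\<bar> \<le> norm (w - q)" using Cauchy_Schwarz_ineq2[of "w - q" \<nu>] \<nu> by simp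
      then have "(w - q) \<bullet> \<nu> \<ge> - s" using w by (simp add: dist_norm norm_minus_commute)
      moreover have "(w - y) \<bullet> \<nu> = (w - q) \<bullet> \<nu> + s" using \<nu>(1) by (simp add: q_def inner_diff_left inner_add_left norm_eq_1)
      ultimately show ?thesis by simp
    qed
    ultimately show "w \<in> closure D" by (rule \<nu>(2))
  qed
qed

section \<open>Counting by packing and by laminarity\<close>

lemma card_disjoint_balls:
  fixes q :: "'i \<Rightarrow> pt"
  assumes J: "finite J" "disjoint_family_on (\<lambda>i. ball (q i) s) J" "\<And>i. i \<in> J \<Longrightarrow> ball (q i) s \<subseteq> ball c R"
    and s: "0 < s" "0 < R"
  shows "real (card J) * s\<^sup>2 \<le> R\<^sup>2"
proof -
  let ?u = "unit_ball_vol (real DIM(pt))"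
  have m: "emeasure lborel (ball p r) = ennreal (?u * r\<^sup>2)" if "r > 0" for p :: pt and r
    using emeasure_ball[of r p] that by simp
  have "(\<Sum>i\<in>J. emeasure lborel (ball (q i) s)) = emeasure lborel (\<Union>i\<in>J. ball (q i) s)"
    by (rule sum_emeasure) (use J in auto)
  also have "\<dots> \<le> emeasure lborel (ball c R)" using J by (intro emeasure_mono) auto
  finally have "ennreal (real (card J) * (?u * s\<^sup>2)) \<le> ennreal (?u * R\<^sup>2)"
    using s by (simp add: m ennreal_mult ennreal_of_nat_eq_real_of_nat)
  moreover have "?u > 0" by simp
  ultimately have "real (card J) * (?u * s\<^sup>2) \<le> ?u * R\<^sup>2" by (subst (asm) ennreal_le_iff) auto
  then have "?u * (real (card J) * s\<^sup>2) \<le> ?u * R\<^sup>2" by (simp add: mult_ac)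
  then show ?thesis using \<open>?u > 0\<close> by (simp only: mult_le_cancel_left_pos)
qed

text \<open>Each cell reaches the circle of radius \<open>2 * r\<close> by
  \<open>cell_reaches_circle\<close>, and near it contains a ball of radius
  \<open>\<kappa> * r / 4\<close> inside the disc of radius \<open>4 * r\<close>. These balls are
  disjoint, and the squared ratio of the radii is \<open>256 / \<kappa>\<^sup>2\<close>.\<close>

lemma cells_meeting_free_annulus:
  assumes T: "cell_tiling \<kappa> V I D \<Omega>" and \<kappa>: "0 < \<kappa>" "\<kappa> \<le> 1" and J: "J \<subseteq> I" and r: "0 < r"
    and x: "\<And>i. i \<in> J \<Longrightarrow> x i \<in> closure (D i) \<and> dist c (x i) \<le> 2 * r \<and>
        (\<forall>z. dist c (x i) \<le> dist c z \<and> dist c z \<le> 2 * r \<longrightarrow> z \<notin> V)"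
    and far: "\<And>z. dist c z = 2 * r \<Longrightarrow> r \<le> infdist z V"
  shows "real (card J) \<le> 256 / \<kappa>\<^sup>2"
proof -
  have fin: "finite I" "finite V" "V \<noteq> {}" using T by (auto simp: cell_tiling_def)
  have cell: "half_disc_cell \<kappa> V (D i)" if "i \<in> I" for i using T that by (auto simp: cell_tiling_def)
  have "\<exists>q. ball q (\<kappa> * r / 4) \<subseteq> closure (D i) \<and> ball q (\<kappa> * r / 4) \<subseteq> ball c (4 * r)" if i: "i \<in> J" for i
  proof -
    have ci: "half_disc_cell \<kappa> V (D i)" using i J cell by blast
    obtain z where z: "z \<in> closure (D i)" "dist c z = 2 * r"
      using cell_reaches_circle[OF ci \<kappa>(1) fin(2,3), of "x i" c "2 * r"] x[OF i] by blast
    obtain q where q: "ball q (\<kappa> * r / 4) \<subseteq> closure (D i)" "ball q (\<kappa> * r / 4) \<subseteq> ball z r"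
      using cell_contains_ball[OF ci \<kappa> z(1) far[OF z(2)] r] by blast
    moreover have "ball z r \<subseteq> ball c (4 * r)"
    proof
      fix w assume "w \<in> ball z r"
      then show "w \<in> ball c (4 * r)" using z(2) r dist_triangle[of c w z] by simp
    qed
    ultimately show ?thesis by blast
  qed
  then obtain q where q: "\<And>i. i \<in> J \<Longrightarrow> ball (q i) (\<kappa> * r / 4) \<subseteq> closure (D i) \<and> ball (q i) (\<kappa> * r / 4) \<subseteq> ball c (4 * r)"
    by metis
  have "disjoint_family_on (\<lambda>i. ball (q i) (\<kappa> * r / 4)) J"
    unfolding disjoint_family_on_def
  proof (intro ballI impI)
    fix i j assume ij: "i \<in> J" "j \<in> J" "i \<noteq> j"
    show "ball (q i) (\<kappa> * r / 4) \<inter> ball (q j) (\<kappa> * r / 4) = {}"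
      by (rule cell_tiling_closure_disjoint[OF T _ _ ij(3)]) (use ij J q in \<open>auto intro: open_Int\<close>)
  qed
  then have "real (card J) * (\<kappa> * r / 4)\<^sup>2 \<le> (4 * r)\<^sup>2"
    using card_disjoint_balls[of J q "\<kappa> * r / 4" c "4 * r"] q finite_subset[OF J fin(1)] \<kappa> r by simp
  then show ?thesis using \<kappa> r by (simp add: field_simps power2_eq_square)
qed

text \<open>Induction removes a point \<open>v\<close> from all sets. The sets in
  \<open>\<K>\<close>, which become empty or collide with another member, are at most two: the sets
  containing \<open>v\<close> form a chain, and if \<open>B\<close> is strictly contained in
  \<open>A\<close>, both in \<open>\<K>\<close> and different from \<open>{v}\<close>, then
  \<open>A - {v}\<close> and \<open>B\<close> cross.\<close>

lemma laminar_card_le: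
  assumes "finite V" "\<F> \<subseteq> Pow V" "{} \<notin> \<F>"
    and "\<And>A B. A \<in> \<F> \<Longrightarrow> B \<in> \<F> \<Longrightarrow> A \<inter> B = {} \<or> A \<subseteq> B \<or> B \<subseteq> A"
  shows "card \<F> \<le> 2 * card V"
  using assms
proof (induction V arbitrary: \<F> rule: finite_induct)
  case empty
  then have "\<F> = {}" by auto
  then show ?case by simp
next
  case (insert v V)
  have fin: "finite \<F>" using insert.prems(1) insert.hyps(1) by (meson finite_Pow_iff finite_insert finite_subset)
  define \<G> where "\<G> = {A \<in> \<F>. v \<notin> A}"
  define \<H> where "\<H> = {A \<in> \<F>. v \<in> A \<and> A \<noteq> {v} \<and> A - {v} \<notin> \<F>}"
  define \<K> where "\<K> = {A \<in> \<F>. v \<in> A \<and> (A = {v} \<or> A - {v} \<in> \<F>)}"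
  have F: "\<F> = \<G> \<union> \<H> \<union> \<K>" by (auto simp: \<G>_def \<H>_def \<K>_def)
  define \<F>' where "\<F>' = \<G> \<union> (\<lambda>A. A - {v}) ` \<H>"
  have "inj_on (\<lambda>A. A - {v}) \<H>" by (auto simp: inj_on_def \<H>_def)
  then have cH: "card ((\<lambda>A. A - {v}) ` \<H>) = card \<H>" by (rule card_image)
  have finG: "finite \<G>" "finite \<H>" "finite \<K>" using fin by (auto simp: \<G>_def \<H>_def \<K>_def)
  have "\<G> \<inter> (\<lambda>A. A - {v}) ` \<H> = {}" by (auto simp: \<G>_def \<H>_def)
  then have c': "card \<F>' = card \<G> + card \<H>" unfolding \<F>'_def using finG cH by (simp add: card_Un_disjoint)
  have "card \<F>' \<le> 2 * card V"
  proof (rule insert.IH)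
    show "\<F>' \<subseteq> Pow V" using insert.prems(1) insert.hyps by (auto simp: \<F>'_def \<G>_def \<H>_def)
    show "{} \<notin> \<F>'" using insert.prems(2) by (auto simp: \<F>'_def \<G>_def \<H>_def)
    fix A B assume "A \<in> \<F>'" "B \<in> \<F>'"
    then obtain A' B' where "A' \<in> \<F>" "B' \<in> \<F>" "A = A' - {v}" "B = B' - {v}"
      by (auto simp: \<F>'_def \<G>_def \<H>_def)
    then show "A \<inter> B = {} \<or> A \<subseteq> B \<or> B \<subseteq> A" using insert.prems(3)[of A' B'] by blast
  qed
  moreover have "card \<K> \<le> 2"
  proof -
    have eq: "A = B" if "A \<in> \<K>" "B \<in> \<K>" "A \<noteq> {v}" "B \<noteq> {v}" for A B
    proof -
      have sub: "A \<subseteq> B" if AB: "A \<in> \<K>" "B \<in> \<K>" "A \<noteq> {v}" "B \<noteq> {v}" for A B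
      proof (rule ccontr)
        assume n: "\<not> A \<subseteq> B"
        have m: "A \<in> \<F>" "B \<in> \<F>" "v \<in> A" "v \<in> B" "A - {v} \<in> \<F>" using AB by (auto simp: \<K>_def)
        have "B \<subseteq> A" using insert.prems(3)[OF m(1,2)] m n by blast
        obtain b where b: "b \<in> B" "b \<noteq> v" using AB(4) m by blast
        show False using insert.prems(3)[OF m(5,2)] b \<open>B \<subseteq> A\<close> n m by blast
      qed
      show ?thesis using sub[of A B] sub[of B A] that by blast
    qed
    have "\<exists>B. \<K> \<subseteq> {{v}, B}"
    proof (cases "\<K> \<subseteq> {{v}}")
      case False
      then obtain B where "B \<in> \<K>" "B \<noteq> {v}" by blast
      then have "\<K> \<subseteq> {{v}, B}" using eq by blast
      then show ?thesis ..
    qed blast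
    then obtain B where "\<K> \<subseteq> {{v}, B}" ..
    then have "card \<K> \<le> card {{v}, B}" by (intro card_mono) auto
    also have "\<dots> \<le> 2" by (simp add: card_insert_if)
    finally show ?thesis .
  qed
  moreover have "card \<F> \<le> card \<G> + card \<H> + card \<K>"
    unfolding F by (meson add_mono card_Un_le order_refl order_trans)
  ultimately have "card \<F> \<le> 2 * card V + 2" using c' by linarith
  then show ?case using insert.hyps by simp
qed

section \<open>Geometry of the node set\<close>

lemma emeasure_disc:
  fixes c :: pt
  assumes "0 \<le> r"
  shows "emeasure lborel (cball c r) = ennreal (pi * r\<^sup>2)"
  using emeasure_cball[OF assms, of c] by (simp add: unit_ball_vol_2)

lemma measurable_const_disc [measurable]:
  fixes c :: "'a::euclidean_space"
  shows "(\<lambda>x. ennreal b * indicator (cball c r) x) \<in> borel_measurable lborel"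
  by (intro borel_measurable_times_ennreal borel_measurable_const borel_measurable_indicator) simp

lemma infdist_nearest:
  fixes V :: "'a::heine_borel set"
  assumes "finite V" "V \<noteq> {}"
  obtains v where "v \<in> V" "infdist x V = dist x v"
  using infdist_attains_inf[OF finite_imp_closed[OF assms(1)] assms(2), where y = x] that by metis

text \<open>\<open>\<delta> a\<close> is the distance of \<open>a\<close> from the points preceding it in a farthest-first enumeration of
  \<open>V\<close>, so that the points with \<open>\<delta> \<ge> s\<close> form a maximal \<open>s\<close>-separated set.\<close>

lemma farthest_first_scale:
  fixes V :: "'a::heine_borel set"
  assumes V: "finite V" "V \<noteq> {}"
  obtains \<delta> :: "'a \<Rightarrow> real" where
    "\<And>a b. a \<in> V \<Longrightarrow> b \<in> V \<Longrightarrow> a \<noteq> b \<Longrightarrow> min (\<delta> a) (\<delta> b) \<le> dist a b"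
    "\<And>s v u w. v \<in> V \<Longrightarrow> 0 < s \<Longrightarrow> u \<in> V \<Longrightarrow> w \<in> V \<Longrightarrow> s \<le> dist u w \<Longrightarrow> \<exists>a\<in>V. s \<le> \<delta> a \<and> dist v a < s"
proof -
  define M where "M = Max ((\<lambda>(u, w). dist u w) ` (V \<times> V))"
  have M: "dist u w \<le> M" if "u \<in> V" "w \<in> V" for u w
    unfolding M_def using V that by (intro Max_ge) (auto intro!: rev_image_eqI[of "(u, w)"])
  define cov where "cov = (\<lambda>A. Max ((\<lambda>v. infdist v A) ` V))"
  have cov_ge: "infdist v A \<le> cov A" if "v \<in> V" for v A
    unfolding cov_def using V that by (intro Max_ge) auto
  have cov_le: "cov A \<le> k" if "\<And>v. v \<in> V \<Longrightarrow> infdist v A \<le> k" for A k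
    unfolding cov_def using V that by (subst Max_le_iff) auto
  \<comment> \<open>\<open>cov A\<close> is the covering radius of \<open>A\<close> in
    \<open>V\<close>, and \<open>M\<close> is the diameter of \<open>V\<close>. At each scale
    \<open>s\<close> above the covering radius and up to \<open>M\<close>, the points of
    \<open>A\<close> with \<delta> >= s form an \<open>s\<close>-net. The last conjunct keeps all
    old \<delta> at least as large as the covering radius, which is the value given to the next
    point.\<close>
  define Q where "Q = (\<lambda>k A (\<delta>::'a \<Rightarrow> real). A \<subseteq> V \<and> card A = k \<and> (\<forall>a\<in>A. \<forall>b\<in>A. a \<noteq> b \<longrightarrow> min (\<delta> a) (\<delta> b) \<le> dist a b) \<and>
      (\<forall>s v. v \<in> V \<longrightarrow> cov A < s \<longrightarrow> s \<le> M \<longrightarrow> (\<exists>a\<in>A. s \<le> \<delta> a \<and> dist v a < s)) \<and> (\<forall>a\<in>A. cov A \<le> \<delta> a))"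
  have "\<exists>A \<delta>. Q k A \<delta>"
    if "1 \<le> k" "k \<le> card V" for k
    using that
  proof (induction k rule: nat_induct_at_least)
    case base
    obtain f where f: "f \<in> V" using V by blast
    have "cov {f} \<le> M" using M f by (intro cov_le) auto
    moreover have "dist v f < s" if "v \<in> V" "cov {f} < s" for v s using cov_ge[OF that(1), of "{f}"] that by simp
    ultimately have "Q 1 {f} (\<lambda>_. M)" using f by (auto simp: Q_def)
    then show ?case by blast
  next
    case (Suc k)
    have "k \<le> card V" using Suc.prems by simp
    then obtain A \<delta> where A': "Q k A \<delta>"
      using Suc.IH by blast
    note A'' = A'[unfolded Q_def]
    note A = A''[THEN conjunct1] A''[THEN conjunct2, THEN conjunct1]
      A''[THEN conjunct2, THEN conjunct2, THEN conjunct1, rule_format]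
      A''[THEN conjunct2, THEN conjunct2, THEN conjunct2, THEN conjunct1, rule_format]
      A''[THEN conjunct2, THEN conjunct2, THEN conjunct2, THEN conjunct2, rule_format]
    have finA: "finite A" "A \<noteq> {}" using A(1,2) V Suc.hyps finite_subset by auto
    have "cov A \<in> (\<lambda>v. infdist v A) ` V" unfolding cov_def using V by (intro Max_in) auto
    then obtain u where u: "u \<in> V" "infdist u A = cov A" by auto
    have "u \<notin> A"
    proof
      assume "u \<in> A"
      then have "cov A = 0" using u by simp
      then have "infdist v A = 0" if "v \<in> V" for v using cov_ge[OF that, of A] infdist_nonneg[of v A] by simp
      then have "V \<subseteq> A" using finA by (metis finite_imp_closed in_closed_iff_infdist_zero subsetI)
      then show False using A(1,2) Suc.prems by (metis Suc_n_not_le_n subset_antisym)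
    qed
    define A' where "A' = insert u A"
    define \<delta>' where "\<delta>' = \<delta>(u := cov A)"
    have d': "\<delta>' a = \<delta> a" if "a \<in> A" for a using that \<open>u \<notin> A\<close> by (auto simp: \<delta>'_def)
    have du: "\<delta>' u = cov A" by (simp add: \<delta>'_def)
    have mono: "cov A' \<le> cov A" unfolding A'_def using finA
      by (intro cov_le order_trans[OF infdist_mono cov_ge]) auto
    have ge: "cov A \<le> \<delta>' a" if "a \<in> A'" for a using that A(5) d' du by (auto simp: A'_def)
    have "min (\<delta>' a) (\<delta>' b) \<le> dist a b" if ab: "a \<in> A'" "b \<in> A'" "a \<noteq> b" for a b
    proof -
      have *: "cov A \<le> dist u b" if "b \<in> A" for b using infdist_le[OF that, of u] u by simp
      show ?thesis using ab A(3)[of a b] *[of b] *[of a] d' du unfolding A'_def by (auto simp: min_le_iff_disj dist_commute)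
    qed
    moreover have "\<exists>a\<in>A'. s \<le> \<delta>' a \<and> dist v a < s" if v: "v \<in> V" "cov A' < s" "s \<le> M" for v s
    proof (cases "cov A < s")
      case True
      then show ?thesis using A(4)[OF v(1) True v(3)] d' by (auto simp: A'_def)
    next
      case False
      \<comment> \<open>Here \<open>s\<close> is at most the old covering radius, so every point of
        \<open>A'\<close> has \<delta> >= s and the nearest one serves.\<close>
      obtain a where "a \<in> A'" "infdist v A' = dist v a" using infdist_nearest[of A' v] finA by (auto simp: A'_def)
      then show ?thesis using cov_ge[OF v(1), of A'] ge[of a] v False by (intro bexI[of _ a]) auto
    qed
    moreover have "A' \<subseteq> V" "card A' = Suc k" using A(1,2) u finA \<open>u \<notin> A\<close> by (simp_all add: A'_def)
    moreover have "cov A' \<le> \<delta>' a" if "a \<in> A'" for a using ge[OF that] mono by simp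
    ultimately have "Q (Suc k) A' \<delta>'" unfolding Q_def by (intro conjI ballI allI impI)
    then show ?case by blast
  qed
  moreover have "card V \<ge> 1" using V by (simp add: Suc_le_eq card_gt_0_iff)
  ultimately obtain A \<delta> where A': "Q (card V) A \<delta>" using order_refl[of "card V"] by blast
  note A'' = A'[unfolded Q_def]
  note A = A''[THEN conjunct1] A''[THEN conjunct2, THEN conjunct1]
    A''[THEN conjunct2, THEN conjunct2, THEN conjunct1, rule_format]
    A''[THEN conjunct2, THEN conjunct2, THEN conjunct2, THEN conjunct1, rule_format]
  have AV: "A = V" using A(1,2) V by (simp add: card_subset_eq)
  have "cov V \<le> 0" by (rule cov_le) simp
  show thesis
  proof (rule that)
    show "\<exists>a\<in>V. s \<le> \<delta> a \<and> dist v a < s"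
      if "v \<in> V" "0 < s" "u \<in> V" "w \<in> V" "s \<le> dist u w" for s v u w
    proof -
      have "cov A < s" "s \<le> M" using that M[OF that(3,4)] \<open>cov V \<le> 0\<close> AV by simp_all
      then show ?thesis using A(4)[OF that(1)] AV by simp
    qed
    show "min (\<delta> a) (\<delta> b) \<le> dist a b" if "a \<in> V" "b \<in> V" "a \<noteq> b" for a b
      using A(3)[of a b] that AV by blast
  qed
qed

text \<open>The points whose nearest node has another node at a distance comparable to \<open>\<rho>\<close>; outside of this
  set and \<open>V\<close>, the remaining nodes are much nearer to or much farther from the nearest node.\<close>

definition branching :: "pt set \<Rightarrow> pt set" where
  "branching V = {x. \<exists>v\<in>V. \<exists>w\<in>V. dist x v = infdist x V \<and> infdist x V \<le> 4 * dist v w \<and> dist v w \<le> 4 * infdist x V}"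

lemma infdist_measurable [measurable]: "(\<lambda>x. infdist x V) \<in> borel_measurable borel"
  by (intro borel_measurable_continuous_onI continuous_intros)

lemma branching_borel [measurable]:
  assumes "finite V"
  shows "branching V \<in> sets borel"
proof -
  have eq: "branching V = (\<Union>v\<in>V. \<Union>w\<in>V. {x. dist x v = infdist x V \<and> infdist x V \<le> 4 * dist v w \<and> dist v w \<le> 4 * infdist x V})"
    by (auto simp: branching_def)
  have "{x. dist x v = infdist x V \<and> infdist x V \<le> 4 * dist v w \<and> dist v w \<le> 4 * infdist x V} \<in> sets borel" for v w :: pt
    by measurable
  then show ?thesis unfolding eq using assms by (intro sets.finite_UN) auto
qed

text \<open>At the scale \<rho>/16 the nearest node \<open>v\<close> and the branching node
  \<open>w\<close>, at least \<rho>/4 apart, are approximated by two different net points. By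
  separation one of these has \<delta> at most their distance, so its \<delta> is comparable with
  \<rho>. Each branching point is thus charged to a nearby node at the one scale that belongs to
  this node.\<close>

lemma branching_near_scale:
  assumes V: "finite V" "V \<noteq> {}"
  obtains \<delta> :: "pt \<Rightarrow> real" where "\<And>x. x \<in> branching V - V \<Longrightarrow>
    \<exists>k\<in>V. 0 < \<delta> k \<and> dist k x \<le> 96 * \<delta> k \<and> \<delta> k \<le> 5 * infdist x V"
proof -
  obtain \<delta> :: "pt \<Rightarrow> real" where \<delta>: "\<And>a b. a \<in> V \<Longrightarrow> b \<in> V \<Longrightarrow> a \<noteq> b \<Longrightarrow> min (\<delta> a) (\<delta> b) \<le> dist a b"
    "\<And>s v u w. v \<in> V \<Longrightarrow> 0 < s \<Longrightarrow> u \<in> V \<Longrightarrow> w \<in> V \<Longrightarrow> s \<le> dist u w \<Longrightarrow> \<exists>a\<in>V. s \<le> \<delta> a \<and> dist v a < s"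
    using farthest_first_scale[OF V] by blast
  show thesis
  proof (rule that)
    fix x assume x: "x \<in> branching V - V"
    define r where "r = infdist x V"
    have "r \<noteq> 0" using x V by (metis DiffD2 finite_imp_closed in_closed_iff_infdist_zero r_def)
    then have r: "r > 0" using infdist_nonneg[of x V] by (simp add: r_def)
    obtain v w where vw: "v \<in> V" "w \<in> V" "dist x v = r" "r \<le> 4 * dist v w" "dist v w \<le> 4 * r"
      using x by (auto simp: branching_def r_def)
    define s where "s = r / 16"
    have s: "s > 0" "s \<le> dist v w" using r vw by (auto simp: s_def)
    obtain v' where v': "v' \<in> V" "s \<le> \<delta> v'" "dist v v' < s" using \<delta>(2)[OF vw(1) s(1) vw(1,2) s(2)] by blast
    obtain w' where w': "w' \<in> V" "s \<le> \<delta> w'" "dist w w' < s" using \<delta>(2)[OF vw(2) s(1) vw(1,2) s(2)] by blast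
    have d1: "dist v w \<le> dist v v' + dist v' w' + dist w w'"
      using dist_triangle[of v w v'] dist_triangle[of v' w w'] by (simp add: dist_commute)
    have d2: "dist v' w' \<le> dist v v' + dist v w + dist w w'"
      using dist_triangle[of v' w' v] dist_triangle[of v w' w] by (simp add: dist_commute)
    have "dist v' w' > 0" using d1 v'(3) w'(3) vw(4) r unfolding s_def by linarith
    then have "v' \<noteq> w'" by auto
    then have "min (\<delta> v') (\<delta> w') \<le> dist v' w'" using \<delta>(1) v' w' by blast
    then obtain k where k: "k = v' \<or> k = w'" "\<delta> k \<le> dist v' w'" by (metis min_def)
    have "dist k x \<le> 6 * r"
    proof -
      have "dist v' x \<le> dist v v' + dist x v" using dist_triangle[of v' x v] by (simp add: dist_commute)
      moreover have "dist w' x \<le> dist w w' + dist v w + dist x v"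
        using dist_triangle[of w' x w] dist_triangle[of w x v] by (simp add: dist_commute)
      ultimately show ?thesis using k(1) vw v' w' r by (auto simp: s_def)
    qed
    then show "\<exists>k\<in>V. 0 < \<delta> k \<and> dist k x \<le> 96 * \<delta> k \<and> \<delta> k \<le> 5 * infdist x V"
      using k d2 vw v' w' r unfolding r_def[symmetric]
      by (intro bexI[of _ k]) (auto simp: s_def)
  qed
qed

text \<open>The area of a disc of radius 96\<delta> times the bound 25/\<delta>^2 for 1/\<rho>^2;
  \<delta> cancels.\<close>

definition branching_const :: real where "branching_const = 25 * 96\<^sup>2 * pi"

text \<open>The points charged to a node \<open>k\<close> lie in a disc of radius
  \<open>96 * \<delta> k\<close> and satisfy \<rho> >= \<delta>/5. As \<open>k\<close> is charged at
  a single scale, no logarithm arises.\<close>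

lemma branching_integral:
  assumes V: "finite V" "V \<noteq> {}"
  shows "(\<integral>\<^sup>+x. indicator (branching V - V) x * ennreal (1 / (infdist x V)\<^sup>2) \<partial>lborel) \<le> ennreal (branching_const * real (card V))"
proof -
  obtain \<delta> :: "pt \<Rightarrow> real" where \<delta>: "\<And>x. x \<in> branching V - V \<Longrightarrow>
    \<exists>k\<in>V. 0 < \<delta> k \<and> dist k x \<le> 96 * \<delta> k \<and> \<delta> k \<le> 5 * infdist x V"
    using branching_near_scale[OF V] by blast
  define f where "f = (\<lambda>k x. if 0 < \<delta> k then ennreal (25 / (\<delta> k)\<^sup>2) * indicator (cball k (96 * \<delta> k)) x else 0)"
  have "indicator (branching V - V) x * ennreal (1 / (infdist x V)\<^sup>2) \<le> (\<Sum>k\<in>V. f k x)" for x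
  proof (cases "x \<in> branching V - V")
    case True
    then obtain k where k: "k \<in> V" "0 < \<delta> k" "dist k x \<le> 96 * \<delta> k" "\<delta> k \<le> 5 * infdist x V" using \<delta> by blast
    have "(\<delta> k)\<^sup>2 \<le> (5 * infdist x V)\<^sup>2" using k by (intro power_mono) auto
    then have "(\<delta> k)\<^sup>2 \<le> 25 * (infdist x V)\<^sup>2" by (simp add: power_mult_distrib)
    moreover have "0 < infdist x V" using k by simp
    ultimately have "1 / (infdist x V)\<^sup>2 \<le> 25 / (\<delta> k)\<^sup>2" using k(2) by (simp add: field_simps)
    then have "indicator (branching V - V) x * ennreal (1 / (infdist x V)\<^sup>2) \<le> f k x"
      using True k by (simp add: f_def ennreal_leI)
    also have "\<dots> \<le> (\<Sum>k\<in>V. f k x)" using k V by (intro sum_nonneg_leq_bound[of V "\<lambda>k. f k x"] member_le_sum) auto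
    finally show ?thesis .
  qed simp
  then have "(\<integral>\<^sup>+x. indicator (branching V - V) x * ennreal (1 / (infdist x V)\<^sup>2) \<partial>lborel) \<le> (\<integral>\<^sup>+x. (\<Sum>k\<in>V. f k x) \<partial>lborel)"
    by (intro nn_integral_mono)
  also have "\<dots> = (\<Sum>k\<in>V. \<integral>\<^sup>+x. f k x \<partial>lborel)"
  proof (rule nn_integral_sum)
    fix k
    show "f k \<in> borel_measurable lborel" unfolding f_def by measurable
  qed
  also have "\<dots> \<le> (\<Sum>k\<in>V. ennreal branching_const)"
  proof (rule sum_mono)
    fix k assume "k \<in> V"
    show "(\<integral>\<^sup>+x. f k x \<partial>lborel) \<le> ennreal branching_const"
    proof (cases "0 < \<delta> k")
      case True
      then have "(\<integral>\<^sup>+x. f k x \<partial>lborel) = ennreal (25 / (\<delta> k)\<^sup>2) * ennreal (pi * (96 * \<delta> k)\<^sup>2)"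
        by (simp add: f_def nn_integral_cmult_indicator emeasure_disc)
      also have "\<dots> = ennreal branching_const"
        using True by (simp add: branching_const_def ennreal_mult[symmetric] power_mult_distrib field_simps)
      finally show ?thesis by simp
    qed (simp add: f_def)
  qed
  also have "\<dots> = ennreal (branching_const * real (card V))"
    by (simp add: branching_const_def ennreal_of_nat_eq_real_of_nat ennreal_mult[symmetric] mult.commute)
  finally show ?thesis .
qed

section \<open>Hoelder's inequality, and powers of the distance over a set of given area\<close>

lemma nn_integral_Holder:
  fixes f g :: "'a \<Rightarrow> real"
  assumes [measurable]: "f \<in> borel_measurable M" "g \<in> borel_measurable M"
    and nn: "\<And>x. 0 \<le> f x" "\<And>x. 0 \<le> g x" and uv: "0 < u" "0 < v" "u + v = 1" and XY: "0 < X" "0 < Y"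
    and F: "(\<integral>\<^sup>+x. ennreal (f x) \<partial>M) \<le> ennreal X" and G: "(\<integral>\<^sup>+x. ennreal (g x) \<partial>M) \<le> ennreal Y"
  shows "(\<integral>\<^sup>+x. ennreal (f x powr u * g x powr v) \<partial>M) \<le> ennreal (X powr u * Y powr v)"
proof -
  define K where "K = X powr u * Y powr v"
  have K: "K \<ge> 0" by (simp add: K_def)
  have "f x powr u * g x powr v \<le> K * (u / X) * f x + K * (v / Y) * g x" for x
  proof (cases "f x = 0 \<or> g x = 0")
    case True
    then show ?thesis using uv XY nn K by auto
  next
    case False
    then have pos: "f x > 0" "g x > 0" using nn by (metis less_eq_real_def)+
    \<comment> \<open>Young's inequality is applied after normalising by \<open>X\<close> and
      \<open>Y\<close>, so that the two integrals contribute at most \<open>K * u\<close> and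
      \<open>K * v\<close>.\<close>
    have "(f x / X) powr u * (g x / Y) powr v \<le> u * (f x / X) + v * (g x / Y)"
      using uv XY pos by (intro Youngs_inequality_0) auto
    then have "K * ((f x / X) powr u * (g x / Y) powr v) \<le> K * (u * (f x / X) + v * (g x / Y))"
      using K by (rule mult_left_mono)
    moreover have "K * ((f x / X) powr u * (g x / Y) powr v) = f x powr u * g x powr v"
      using XY pos by (simp add: K_def powr_divide)
    ultimately show ?thesis by (simp add: algebra_simps)
  qed
  then have "(\<integral>\<^sup>+x. ennreal (f x powr u * g x powr v) \<partial>M)
      \<le> (\<integral>\<^sup>+x. ennreal (K * (u / X)) * ennreal (f x) + ennreal (K * (v / Y)) * ennreal (g x) \<partial>M)"
    using K uv XY nn by (intro nn_integral_mono) (simp add: ennreal_mult[symmetric] ennreal_plus[symmetric] ennreal_leI del: ennreal_plus)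
  also have "\<dots> = ennreal (K * (u / X)) * (\<integral>\<^sup>+x. ennreal (f x) \<partial>M) + ennreal (K * (v / Y)) * (\<integral>\<^sup>+x. ennreal (g x) \<partial>M)"
    by (simp add: nn_integral_add nn_integral_cmult)
  also have "\<dots> \<le> ennreal (K * (u / X)) * ennreal X + ennreal (K * (v / Y)) * ennreal Y"
    using F G by (intro add_mono mult_left_mono) auto
  also have "\<dots> = ennreal (K * (u / X) * X + K * (v / Y) * Y)"
    using K uv XY by (simp add: ennreal_mult[symmetric] ennreal_plus[symmetric] del: ennreal_plus)
  also have "K * (u / X) * X + K * (v / Y) * Y = K * (u + v)" using XY by (simp add: algebra_simps)
  finally show ?thesis using uv by (simp add: K_def)
qed

text \<open>With \<open>R = sqrt m\<close>, the points of \<open>T\<close> farther than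
  \<open>R\<close> from \<open>c\<close> contribute at most \<open>R powr (- a) * m\<close>. The
  disc of radius \<open>R\<close> is cut into dyadic shells whose bounds form a geometric series of
  ratio \<open>q < 1\<close>. Both contributions are multiples of
  \<open>R powr (2 - a)\<close>.\<close>

lemma powr_dist_integral_le:
  assumes a: "0 < a" "a < 2"
  obtains C where "0 < C" "\<And>(c::pt) T m. T \<in> sets lborel \<Longrightarrow> emeasure lborel T = ennreal m \<Longrightarrow> 0 < m \<Longrightarrow>
    (\<integral>\<^sup>+x. indicator T x * ennreal (dist c x powr (- a)) \<partial>lborel) \<le> ennreal (C * m powr (1 - a / 2))"
proof -
  define q where "q = 2 powr (a - 2)"
  have q: "0 < q" "q < 1" using a by (auto simp: q_def powr_less_one)
  define C where "C = 1 + 2 powr a * pi / (1 - q)"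
  have main: "(\<integral>\<^sup>+x. indicator T x * ennreal (dist c x powr (- a)) \<partial>lborel) \<le> ennreal (C * m powr (1 - a / 2))"
    if T: "T \<in> sets lborel" "emeasure lborel T = ennreal m" "0 < m" for c :: pt and T m
  proof -
    define R where "R = sqrt m"
    have R: "0 < R" "R\<^sup>2 = m" using T by (auto simp: R_def)
    define r where "r = (\<lambda>k::nat. R / 2 ^ k)"
    have r: "0 < r k" for k using R by (simp add: r_def)
    \<comment> \<open>On the shell between \<open>r (Suc k)\<close> and \<open>r k\<close> the
      integrand is at most its value at the inner radius; the full disc is used in place of the
      shell.\<close>
    define f where "f = (\<lambda>(k::nat) x. ennreal ((r (Suc k)) powr (- a)) * indicator (cball c (r k)) x)"
    have pw: "indicator T x * ennreal (dist c x powr (- a)) \<le> ennreal (R powr (- a)) * indicator T x + (\<Sum>k. f k x)" for x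
    proof (cases "dist c x < R \<and> dist c x \<noteq> 0")
      case True
      then have d: "0 < dist c x" "dist c x < R" by auto
      have "\<exists>k. r k < dist c x"
      proof -
        obtain k where "R / dist c x < 2 ^ k" using real_arch_pow[of 2 "R / dist c x"] by auto
        then have "r k < dist c x" using d by (simp add: r_def field_simps)
        then show ?thesis ..
      qed
      then obtain k where k: "r k < dist c x" "\<And>j. j < k \<Longrightarrow> \<not> r j < dist c x"
        using exists_least_iff[of "\<lambda>k. r k < dist c x"] by blast
      have "k \<noteq> 0"
      proof
        assume "k = 0"
        then show False using k(1) d by (simp add: r_def)
      qed
      then obtain j where j: "k = Suc j" by (cases k) auto
      have "dist c x \<le> r j" using k(2)[of j] j by simp
      moreover have "dist c x powr (- a) \<le> r (Suc j) powr (- a)" using k j r a by (intro powr_mono2') auto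
      ultimately have "ennreal (dist c x powr (- a)) \<le> f j x" by (simp add: f_def ennreal_leI)
      also have "f j x \<le> (\<Sum>k. f k x)"
      proof -
        have "f j x = (\<Sum>k\<in>{j}. f k x)" by simp
        also have "\<dots> \<le> (\<Sum>k. f k x)" by (rule sum_le_suminf) auto
        finally show ?thesis .
      qed
      finally have "ennreal (dist c x powr (- a)) \<le> (\<Sum>k. f k x)" .
      then show ?thesis by (auto simp: indicator_def intro: add_increasing)
    next
      case False
      have "dist c x powr (- a) \<le> R powr (- a)"
      \<comment> \<open>At \<open>x = c\<close> the value of \<open>dist c x powr (- a)\<close> is
        0, not infinite.\<close>
      proof (cases "dist c x = 0")
        case False2: False
        then have "R \<le> dist c x" using False by auto
        then show ?thesis using R a by (intro powr_mono2') auto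
      qed simp
      then have "ennreal (dist c x powr (- a)) \<le> ennreal (R powr (- a))" by (rule ennreal_leI)
      then show ?thesis by (auto simp: indicator_def intro!: add_increasing2)
    qed
    have int_f: "(\<integral>\<^sup>+x. f k x \<partial>lborel) = ennreal (2 powr a * pi * R powr (2 - a) * q ^ k)" for k
    proof -
      have "(\<integral>\<^sup>+x. f k x \<partial>lborel) = ennreal (r (Suc k) powr (- a)) * ennreal (pi * (r k)\<^sup>2)"
        unfolding f_def using r[of k] by (simp add: nn_integral_cmult_indicator emeasure_disc)
      also have "\<dots> = ennreal (r (Suc k) powr (- a) * (pi * (r k)\<^sup>2))" by (simp add: ennreal_mult)
      also have "r (Suc k) powr (- a) * (pi * (r k)\<^sup>2) = 2 powr a * pi * R powr (2 - a) * q ^ k"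
      proof -
        have r_eq: "r j = R * 2 powr (- real j)" for j by (simp add: r_def powr_minus powr_realpow divide_inverse)
        have "r (Suc k) powr (- a) = R powr (- a) * 2 powr (a * (1 + real k))"
          unfolding r_eq using R by (simp add: powr_mult powr_powr algebra_simps)
        moreover have "(r k)\<^sup>2 = R powr 2 * 2 powr (- 2 * real k)"
        proof -
          have "(r k)\<^sup>2 = r k powr 2" using r[of k] by simp
          also have "\<dots> = R powr 2 * 2 powr (- 2 * real k)" unfolding r_eq using R by (simp add: powr_mult powr_powr algebra_simps)
          finally show ?thesis .
        qed
        moreover have "q ^ k = 2 powr ((a - 2) * real k)"
          unfolding q_def by (simp add: powr_realpow[symmetric] powr_powr)
        moreover have "R powr (2 - a) = R powr (- a) * R powr 2" by (simp add: powr_add[symmetric])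
        moreover have "2 powr (a * (1 + real k)) * 2 powr (- 2 * real k) = 2 powr a * 2 powr ((a - 2) * real k)"
          by (simp add: powr_add[symmetric] algebra_simps)
        ultimately show ?thesis by (simp add: mult_ac)
      qed
      finally show ?thesis .
    qed
    have "(\<integral>\<^sup>+x. indicator T x * ennreal (dist c x powr (- a)) \<partial>lborel)
        \<le> (\<integral>\<^sup>+x. ennreal (R powr (- a)) * indicator T x + (\<Sum>k. f k x) \<partial>lborel)"
      by (intro nn_integral_mono pw)
    also have "\<dots> = ennreal (R powr (- a)) * ennreal m + (\<Sum>k. \<integral>\<^sup>+x. f k x \<partial>lborel)"
    proof -
      have mf: "f k \<in> borel_measurable lborel" for k
        unfolding f_def by (rule measurable_const_disc)
      have "(\<integral>\<^sup>+x. (\<Sum>k. f k x) \<partial>lborel) = (\<Sum>k. \<integral>\<^sup>+x. f k x \<partial>lborel)"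
        by (rule nn_integral_suminf) (rule mf)
      moreover have "(\<lambda>x. \<Sum>k. f k x) \<in> borel_measurable lborel"
        by (rule borel_measurable_suminf_order) (rule mf)
      ultimately show ?thesis using T by (subst nn_integral_add) (auto simp: nn_integral_cmult_indicator)
    qed
    also have "ennreal (R powr (- a)) * ennreal m = ennreal (R powr (2 - a))"
    proof -
      have "R powr (2 - a) = R powr (- a) * R powr 2" by (simp add: powr_add[symmetric])
      then show ?thesis using R T(3) by (simp add: ennreal_mult)
    qed
    also have "(\<Sum>k. \<integral>\<^sup>+x. f k x \<partial>lborel) = ennreal (2 powr a * pi * R powr (2 - a) * (1 / (1 - q)))"
    proof -
      have "(\<lambda>k. 2 powr a * pi * R powr (2 - a) * q ^ k) sums (2 powr a * pi * R powr (2 - a) * (1 / (1 - q)))"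
        using q by (intro sums_mult geometric_sums) auto
      then show ?thesis unfolding int_f using q by (intro suminf_ennreal_eq) auto
    qed
    also have "ennreal (R powr (2 - a)) + ennreal (2 powr a * pi * R powr (2 - a) * (1 / (1 - q))) = ennreal (C * R powr (2 - a))"
      using q by (subst ennreal_plus[symmetric]) (auto simp: C_def algebra_simps)
    also have "R powr (2 - a) = m powr (1 - a / 2)"
      unfolding R_def using T by (simp add: powr_half_sqrt[symmetric] powr_powr algebra_simps diff_divide_distrib)
    finally show ?thesis .
  qed
  have "0 < C" using q unfolding C_def by (intro add_pos_nonneg divide_nonneg_nonneg) auto
  then show thesis using that[of C] main by blast
qed

section \<open>The weighted estimate\<close>

text \<open>If \<open>x\<close> is neither a node nor branching, the distances from its nearest node
  to the nodes have a gap between \<rho>/4 and 4\<rho>, and the factor 2 falls into this gap: the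
  nodes of the cluster are close together and all others are far away.\<close>

definition cluster :: "pt set \<Rightarrow> pt \<Rightarrow> pt set" where
  "cluster V x = {w \<in> V. dist x w < 2 * infdist x V}"

lemma infdist_pos:
  fixes V :: "'a::metric_space set"
  assumes "finite V" "V \<noteq> {}" "x \<notin> V"
  shows "0 < infdist x V"
  using assms by (metis finite_imp_closed in_closed_iff_infdist_zero infdist_nonneg le_less)

lemma cluster_centre:
  assumes V: "finite V" "V \<noteq> {}" and x: "x \<notin> V" "x \<notin> branching V"
  obtains v where "v \<in> cluster V x" "dist x v = infdist x V"
    "\<And>w. w \<in> cluster V x \<Longrightarrow> dist v w < infdist x V / 4"
    "\<And>w. w \<in> V - cluster V x \<Longrightarrow> 4 * infdist x V < dist v w"
proof -
  define r where "r = infdist x V"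
  have r: "r > 0" using infdist_pos[OF V x(1)] by (simp add: r_def)
  obtain v where v: "v \<in> V" "dist x v = r" using infdist_nearest[OF V, of x] r_def by metis
  have gap: "dist v w < r / 4 \<or> 4 * r < dist v w" if "w \<in> V" for w
  proof -
    have "\<not> (r \<le> 4 * dist v w \<and> dist v w \<le> 4 * r)"
      using x(2) v that unfolding branching_def r_def by blast
    then show ?thesis by linarith
  qed
  show thesis
  proof (rule that[of v]; (unfold r_def[symmetric])?)
    show "v \<in> cluster V x" using v r by (simp add: cluster_def r_def[symmetric])
    show "dist x v = r" by fact
    fix w
    show "dist v w < r / 4" if "w \<in> cluster V x"
    proof -
      have "dist v w < 3 * r" using that v dist_triangle[of v w x] by (simp add: cluster_def r_def[symmetric] dist_commute)
      then show ?thesis using gap[of w] that r by (auto simp: cluster_def)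
    qed
    show "4 * r < dist v w" if "w \<in> V - cluster V x"
    proof -
      have "2 * r \<le> dist x w" using that by (auto simp: cluster_def r_def[symmetric])
      then have "r \<le> dist v w" using v dist_triangle[of x w v] by simp
      then show ?thesis using gap[of w] that r by auto
    qed
  qed
qed

lemma cluster_nonempty:
  assumes V: "finite V" "V \<noteq> {}" and x: "x \<notin> V" "x \<notin> branching V"
  shows "cluster V x \<noteq> {}"
  by (rule cluster_centre[OF V x]) auto

lemma cluster_distances:
  assumes V: "finite V" "V \<noteq> {}" and x: "x \<notin> V" "x \<notin> branching V" and c: "c \<in> cluster V x"
  shows "infdist x V \<le> dist c x" "dist c x \<le> 5 / 4 * infdist x V"
    "\<And>w. w \<in> cluster V x \<Longrightarrow> dist c w < infdist x V / 2"
    "\<And>w. w \<in> V - cluster V x \<Longrightarrow> 15 / 4 * infdist x V < dist c w"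
proof -
  obtain v where v: "v \<in> cluster V x" "dist x v = infdist x V"
    "\<And>w. w \<in> cluster V x \<Longrightarrow> dist v w < infdist x V / 4"
    "\<And>w. w \<in> V - cluster V x \<Longrightarrow> 4 * infdist x V < dist v w"
    using cluster_centre[OF V x] by blast
  have cV: "c \<in> V" using c by (auto simp: cluster_def)
  show "infdist x V \<le> dist c x" using infdist_le[OF cV, of x] by (simp add: dist_commute)
  show "dist c x \<le> 5 / 4 * infdist x V" using v(2) v(3)[OF c] dist_triangle[of c x v] by (simp add: dist_commute)
  show "dist c w < infdist x V / 2" if "w \<in> cluster V x" for w
    using v(3)[OF c] v(3)[OF that] dist_triangle[of c w v] by (simp add: dist_commute)
  show "15 / 4 * infdist x V < dist c w" if "w \<in> V - cluster V x" for w
    using v(3)[OF c] v(4)[OF that] dist_triangle[of v w c] by (simp add: dist_commute)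
qed

text \<open>Suppose that two clusters share a node \<open>w\<close>. The cluster of the point with
  smaller \<rho> stays within half of this \<rho> around \<open>w\<close>, while the nodes outside
  the other cluster are farther from \<open>w\<close> than 15/4 of the larger \<rho>.\<close>

lemma cluster_laminar:
  assumes V: "finite V" "V \<noteq> {}" and x: "x \<notin> V" "x \<notin> branching V" and y: "y \<notin> V" "y \<notin> branching V"
  shows "cluster V x \<inter> cluster V y = {} \<or> cluster V x \<subseteq> cluster V y \<or> cluster V y \<subseteq> cluster V x"
proof -
  have sub: "cluster V x \<subseteq> cluster V y"
    if x: "x \<notin> V" "x \<notin> branching V" and y: "y \<notin> V" "y \<notin> branching V"
      and le: "infdist x V \<le> infdist y V" and w: "w \<in> cluster V x" "w \<in> cluster V y" for x y w
  proof
    fix u assume u: "u \<in> cluster V x"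
    show "u \<in> cluster V y"
    proof (rule ccontr)
      assume "u \<notin> cluster V y"
      then have "u \<in> V - cluster V y" using u by (auto simp: cluster_def)
      then have "15 / 4 * infdist y V < dist w u" using cluster_distances(4)[OF V y w(2)] by blast
      moreover have "dist w u < infdist x V / 2" using cluster_distances(3)[OF V x w(1) u] .
      ultimately show False using le infdist_nonneg[of x V] by simp
    qed
  qed
  show ?thesis using sub[OF x y] sub[OF y x] by (cases "infdist x V \<le> infdist y V") auto
qed

lemma cluster_card_le:
  assumes V: "finite V" "V \<noteq> {}" and P: "P \<inter> (V \<union> branching V) = {}"
  shows "card (cluster V ` P) \<le> 2 * card V"
proof (rule laminar_card_le[OF V(1)])
  show "cluster V ` P \<subseteq> Pow V" by (auto simp: cluster_def)
  show "{} \<notin> cluster V ` P"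
  proof
    assume "{} \<in> cluster V ` P"
    then obtain x where "x \<in> P" "cluster V x = {}" by (auto simp: image_iff)
    moreover have "x \<notin> V" "x \<notin> branching V" using P calculation(1) by auto
    ultimately show False using cluster_nonempty[OF V, of x] by blast
  qed
  fix A B assume "A \<in> cluster V ` P" "B \<in> cluster V ` P"
  then obtain x y where "x \<in> P" "y \<in> P" "A = cluster V x" "B = cluster V y" by blast
  then show "A \<inter> B = {} \<or> A \<subseteq> B \<or> B \<subseteq> A" using cluster_laminar[OF V, of x y] P by blast
qed

text \<open>One point is chosen in each cell, and \<open>r\<close> is the largest \<rho> among them.
  The nodes of \<open>C\<close> are closer to \<open>c\<close> than every chosen point, and the
  other nodes are farther away than \<open>15 / 4 * r\<close>. So no node lies between a chosen
  point and the circle of radius \<open>2 * r\<close>, and \<open>cells_meeting_free_annulus\<close>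
  counts the cells, at whatever scales they meet the cluster.\<close>

lemma cells_meeting_cluster:
  assumes T: "cell_tiling \<kappa> V I D \<Omega>" and \<kappa>: "0 < \<kappa>" "\<kappa> \<le> 1"
  shows "real (card {i \<in> I. \<exists>x \<in> closure (D i). x \<notin> V \<and> x \<notin> branching V \<and> cluster V x = C}) \<le> 256 / \<kappa>\<^sup>2"
proof -
  define J where "J = {i \<in> I. \<exists>x \<in> closure (D i). x \<notin> V \<and> x \<notin> branching V \<and> cluster V x = C}"
  have V: "finite V" "V \<noteq> {}" "finite I" using T by (auto simp: cell_tiling_def)
  have "real (card J) \<le> 256 / \<kappa>\<^sup>2"
  proof (cases "J = {}")
    case False
    define x where "x = (\<lambda>i. SOME x. x \<in> closure (D i) \<and> x \<notin> V \<and> x \<notin> branching V \<and> cluster V x = C)"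
    have x: "x i \<in> closure (D i) \<and> x i \<notin> V \<and> x i \<notin> branching V \<and> cluster V (x i) = C" if "i \<in> J" for i
    proof -
      have "\<exists>x. x \<in> closure (D i) \<and> x \<notin> V \<and> x \<notin> branching V \<and> cluster V x = C"
        using that unfolding J_def by blast
      then show ?thesis unfolding x_def by (rule someI_ex)
    qed
    have finJ: "finite J" "J \<subseteq> I" using V by (auto simp: J_def)
    define r where "r = Max ((\<lambda>i. infdist (x i) V) ` J)"
    have r_ge: "infdist (x i) V \<le> r" if "i \<in> J" for i using finJ that by (simp add: r_def)
    have "r \<in> (\<lambda>i. infdist (x i) V) ` J" unfolding r_def using finJ False by (intro Max_in) auto
    then obtain m where m: "m \<in> J" "r = infdist (x m) V" by blast
    have r: "r > 0" using infdist_pos[OF V(1,2)] x[OF m(1)] m(2) by simp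
    obtain c where c: "c \<in> C" using cluster_nonempty[OF V(1,2), of "x m"] x[OF m(1)] by blast
    have near: "infdist (x i) V \<le> dist c (x i)" "dist c (x i) \<le> 5 / 4 * infdist (x i) V"
      "\<And>w. w \<in> C \<Longrightarrow> dist c w < infdist (x i) V / 2" "\<And>w. w \<in> V - C \<Longrightarrow> 15 / 4 * infdist (x i) V < dist c w"
      if i: "i \<in> J" for i
      using cluster_distances[OF V(1,2), of "x i" c] x[OF i] c by auto
    show ?thesis
    proof (rule cells_meeting_free_annulus[OF T \<kappa> finJ(2) r])
      fix i assume i: "i \<in> J"
      have "z \<notin> V" if z: "dist c (x i) \<le> dist c z" "dist c z \<le> 2 * r" for z
      proof
        assume "z \<in> V"
        show False
        proof (cases "z \<in> C")
          case True
          then show False using near(1)[OF i] near(3)[OF i True] z infdist_nonneg[of "x i" V] by simp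
        next
          case False
          then show False using near(4)[OF m(1), of z] \<open>z \<in> V\<close> z m(2) r by simp
        qed
      qed
      moreover have "dist c (x i) \<le> 2 * r" using near(2)[OF i] r_ge[OF i] r by simp
      ultimately show "x i \<in> closure (D i) \<and> dist c (x i) \<le> 2 * r \<and>
        (\<forall>z. dist c (x i) \<le> dist c z \<and> dist c z \<le> 2 * r \<longrightarrow> z \<notin> V)" using x[OF i] by blast
    next
      fix z assume z: "dist c z = 2 * r"
      obtain w where w: "w \<in> V" "infdist z V = dist z w" using infdist_nearest[OF V(1,2), of z] by metis
      show "r \<le> infdist z V"
      proof (cases "w \<in> C")
        case True
        then have "dist c w < r / 2" using near(3)[OF m(1), of w] m(2) by simp
        then show ?thesis using dist_triangle[of c z w] z w r by (simp add: dist_commute)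
      next
        case False
        then have "15 / 4 * r < dist c w" using near(4)[OF m(1), of w] m(2) w by simp
        then show ?thesis using dist_triangle[of c w z] z w r by (simp add: dist_commute)
      qed
    qed
  qed simp
  then show ?thesis by (simp add: J_def)
qed

lemma cluster_borel:
  assumes "finite V"
  shows "{x. cluster V x = C} \<in> sets borel"
proof (cases "C \<subseteq> V")
  case True
  have "{x. cluster V x = C} = {x. \<forall>w\<in>V. (dist x w < 2 * infdist x V) = (w \<in> C)}"
    using True by (auto simp: cluster_def)
  moreover have "Measurable.pred borel (\<lambda>x. \<forall>w\<in>V. (dist x w < 2 * infdist x V) = (w \<in> C))"
    using assms by measurable
  ultimately show ?thesis by (simp add: pred_def)
next
  case False
  then have "{x. cluster V x = C} = {}" by (auto simp: cluster_def)
  then show ?thesis by simp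
qed

section \<open>Measurability, and the estimate on pieces where \<open>S\<close> is constant\<close>

lemma step_function_borel:
  assumes "cell_tiling \<kappa> V I D \<Omega>"
  shows "(\<lambda>x. \<Sum>i\<in>I. c i * indicator (D i) x :: real) \<in> borel_measurable borel"
proof -
  have "(\<lambda>x. c i * indicator (D i) x) \<in> borel_measurable borel" if "i \<in> I" for i
    using assms that by (intro borel_measurable_times borel_measurable_const borel_measurable_indicator) (auto simp: cell_tiling_def)
  then show ?thesis by (rule borel_measurable_sum)
qed

lemma frontier_union_null:
  assumes "cell_tiling \<kappa> V I D \<Omega>"
  shows "closed (\<Union>i\<in>I. frontier (D i))" "(\<Union>i\<in>I. frontier (D i)) \<in> null_sets lborel"
proof -
  show c: "closed (\<Union>i\<in>I. frontier (D i))" using assms by (intro closed_UN) (auto simp: cell_tiling_def)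
  have "negligible (\<Union>i\<in>I. frontier (D i))" using assms by (intro negligible_Union) (auto simp: cell_tiling_def)
  then have "(\<Union>i\<in>I. frontier (D i)) \<in> null_sets lebesgue" by (simp add: negligible_iff_null_sets)
  then show "(\<Union>i\<in>I. frontier (D i)) \<in> null_sets lborel"
    using c by (simp add: null_sets_completion_iff borel_closed)
qed

text \<open>The factor \<open>m powr (1 - a / 2)\<close> from the distance integral is written as
  \<open>m\<close> times \<open>(1 / m) powr (a / 2)\<close>, so that the right side is again an
  integral over the piece. The pieces can then be added and treated by one application of Hoelder's
  inequality, with the density \<open>1 / m\<close> on each piece.\<close>

lemma constant_piece_integral_le:
  fixes T V :: "pt set" and S :: "pt \<Rightarrow> real"
  assumes V: "finite V" "V \<noteq> {}" and a: "0 < a" "a < 2" and p: "0 < p" "\<tau> = p * (1 - a / 2)"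
    and C: "0 < C" "\<And>(c::pt) T m. T \<in> sets lborel \<Longrightarrow> emeasure lborel T = ennreal m \<Longrightarrow> 0 < m \<Longrightarrow>
      (\<integral>\<^sup>+x. indicator T x * ennreal (dist c x powr (- a)) \<partial>lborel) \<le> ennreal (C * m powr (1 - a / 2))"
    and T: "T \<in> sets borel" "\<And>x. x \<in> T \<Longrightarrow> S x = val" "\<And>x. x \<in> T \<Longrightarrow> c \<in> V \<and> dist c x \<le> 2 * infdist x V"
    and X: "(\<integral>\<^sup>+x. indicator T x * ennreal (\<bar>S x\<bar> powr p) \<partial>lborel) \<le> ennreal X"
  shows "(\<integral>\<^sup>+x. indicator T x * ennreal (\<bar>S x\<bar> powr \<tau> * infdist x V powr (- a)) \<partial>lborel)
     \<le> ennreal (2 powr a * C) * (\<integral>\<^sup>+x. indicator T x * ennreal (\<bar>S x\<bar> powr \<tau> * (1 / measure lborel T) powr (a / 2)) \<partial>lborel)"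
proof (cases "val = 0 \<or> emeasure lborel T = 0")
  case True
  have "indicator T x * ennreal (\<bar>S x\<bar> powr \<tau> * infdist x V powr (- a)) = 0" if "val = 0" for x
    using T(2)[of x] that by (auto simp: indicator_def)
  moreover have "AE x in lborel. indicator T x * ennreal (\<bar>S x\<bar> powr \<tau> * infdist x V powr (- a)) = 0" if "emeasure lborel T = 0"
  proof -
    have "T \<in> null_sets lborel" using that T(1) by (simp add: null_sets_def)
    then have "AE x in lborel. x \<notin> T" by (rule AE_not_in)
    then show ?thesis by eventually_elim simp
  qed
  ultimately have "AE x in lborel. indicator T x * ennreal (\<bar>S x\<bar> powr \<tau> * infdist x V powr (- a)) = 0"
    using True by auto
  then have "(\<integral>\<^sup>+x. indicator T x * ennreal (\<bar>S x\<bar> powr \<tau> * infdist x V powr (- a)) \<partial>lborel) = (\<integral>\<^sup>+x. 0 \<partial>(lborel::pt measure))"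
    by (rule nn_integral_cong_AE)
  then show ?thesis by simp
next
  case False
  have l0: "\<bar>val\<bar> powr p > 0" using False by simp
  have "ennreal (\<bar>val\<bar> powr p) * emeasure lborel T = (\<integral>\<^sup>+x. ennreal (\<bar>val\<bar> powr p) * indicator T x \<partial>lborel)"
    using T(1) by (simp add: nn_integral_cmult_indicator)
  also have "\<dots> = (\<integral>\<^sup>+x. indicator T x * ennreal (\<bar>S x\<bar> powr p) \<partial>lborel)"
    using T(2) by (intro nn_integral_cong) (auto simp: indicator_def)
  \<comment> \<open>This is where the bound \<open>X\<close> enters: a piece with
    \<open>val \<noteq> 0\<close> has finite area.\<close>
  finally have "ennreal (\<bar>val\<bar> powr p) * emeasure lborel T < \<infinity>" using X by (simp add: order_le_less_trans)
  then have "emeasure lborel T < \<infinity>" using l0 by (auto simp: ennreal_mult_less_top)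
  then obtain m where m: "emeasure lborel T = ennreal m" "0 \<le> m" by (auto simp: less_top_ennreal)
  have mpos: "m > 0" using m False by (auto simp: less_le)
  have ms: "measure lborel T = m" using m by (simp add: measure_def)
  have "(\<integral>\<^sup>+x. indicator T x * ennreal (\<bar>S x\<bar> powr \<tau> * infdist x V powr (- a)) \<partial>lborel)
      \<le> (\<integral>\<^sup>+x. ennreal (\<bar>val\<bar> powr \<tau> * 2 powr a) * (indicator T x * ennreal (dist c x powr (- a))) \<partial>lborel)"
  proof (intro nn_integral_mono_AE)
    have "AE x in lborel. x \<notin> V" using V(1) by (intro AE_not_in finite_imp_null_set_lborel)
    then show "AE x in lborel. indicator T x * ennreal (\<bar>S x\<bar> powr \<tau> * infdist x V powr (- a))
      \<le> ennreal (\<bar>val\<bar> powr \<tau> * 2 powr a) * (indicator T x * ennreal (dist c x powr (- a)))"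
    proof eventually_elim
      case (elim x)
      show ?case
      proof (cases "x \<in> T")
        case True
        have d: "c \<in> V" "dist c x \<le> 2 * infdist x V" "c \<noteq> x" using T(3)[OF True] elim by auto
        have "(2 * infdist x V) powr (- a) \<le> dist c x powr (- a)"
          using d a by (intro powr_mono2') auto
        then have "2 powr a * (2 * infdist x V) powr (- a) \<le> 2 powr a * dist c x powr (- a)" by (intro mult_left_mono) auto
        moreover have "2 powr a * (2 * infdist x V) powr (- a) = infdist x V powr (- a)"
          using infdist_nonneg[of x V] by (simp add: powr_mult powr_minus field_simps)
        ultimately have "infdist x V powr (- a) \<le> 2 powr a * dist c x powr (- a)" by simp
        then have "\<bar>val\<bar> powr \<tau> * infdist x V powr (- a) \<le> \<bar>val\<bar> powr \<tau> * 2 powr a * dist c x powr (- a)"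
          by (simp add: mult.assoc mult_left_mono)
        then show ?thesis using True T(2)[OF True] by (simp add: ennreal_mult[symmetric] ennreal_leI)
      qed simp
    qed
  qed
  also have "\<dots> = ennreal (\<bar>val\<bar> powr \<tau> * 2 powr a) * (\<integral>\<^sup>+x. indicator T x * ennreal (dist c x powr (- a)) \<partial>lborel)"
  proof (rule nn_integral_cmult)
    have "(\<lambda>x. ennreal (dist c x powr - a)) \<in> borel_measurable borel" by measurable
    then show "(\<lambda>x. indicator T x * ennreal (dist c x powr - a)) \<in> borel_measurable lborel"
      using T(1) by simp
  qed
  also have "\<dots> \<le> ennreal (\<bar>val\<bar> powr \<tau> * 2 powr a) * ennreal (C * m powr (1 - a / 2))"
    using T(1) by (intro mult_left_mono C(2) m(1) mpos) auto
  also have "\<dots> = ennreal (2 powr a * C) * (ennreal (\<bar>val\<bar> powr \<tau> * (1 / m) powr (a / 2)) * emeasure lborel T)"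
  proof -
    have "m powr (1 - a / 2) = (1 / m) powr (a / 2) * m"
    proof -
      have "(1 / m) powr (a / 2) = m powr (- (a / 2))" using mpos by (simp add: powr_minus powr_divide inverse_eq_divide)
      moreover have "m powr (- (a / 2)) * m powr 1 = m powr (- (a / 2) + 1)" by (rule powr_add[symmetric])
      ultimately show ?thesis using mpos by simp
    qed
    then show ?thesis using C(1) mpos unfolding m(1) by (simp add: ennreal_mult[symmetric] mult_ac)
  qed
  also have "ennreal (\<bar>val\<bar> powr \<tau> * (1 / m) powr (a / 2)) * emeasure lborel T
      = (\<integral>\<^sup>+x. ennreal (\<bar>val\<bar> powr \<tau> * (1 / m) powr (a / 2)) * indicator T x \<partial>lborel)"
    using T(1) by (simp add: nn_integral_cmult_indicator)
  also have "\<dots> = (\<integral>\<^sup>+x. indicator T x * ennreal (\<bar>S x\<bar> powr \<tau> * (1 / measure lborel T) powr (a / 2)) \<partial>lborel)"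
    using T(2) ms by (intro nn_integral_cong) (auto simp: indicator_def)
  finally show ?thesis .
qed


text \<open>A piece consists of the points of \<open>P\<close> with a given cluster, a given cell of
  the first tiling and a given cell of the second, so \<open>S\<close> is constant on it. There are
  at most \<open>2 * card V\<close> clusters, and around each of them at most \<open>M\<close> cells
  of either tiling.\<close>

lemma clustered_part_le:
  fixes S :: "pt \<Rightarrow> real"
  assumes T1: "cell_tiling \<kappa> V I D \<Omega>" and T2: "cell_tiling \<kappa> V I' D' \<Omega>" and \<kappa>: "0 < \<kappa>" "\<kappa> \<le> 1"
    and S: "S = (\<lambda>x. (\<Sum>i\<in>I. c i * indicator (D i) x) - (\<Sum>i\<in>I'. c' i * indicator (D' i) x))"
    and P: "P = \<Omega> - V - branching V - (\<Union>i\<in>I. frontier (D i)) - (\<Union>i\<in>I'. frontier (D' i))"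
    and a: "0 < a" "a < 2" and p: "0 < p" "\<tau> = p * (1 - a / 2)"
    and C: "0 < C" "\<And>(c::pt) T m. T \<in> sets lborel \<Longrightarrow> emeasure lborel T = ennreal m \<Longrightarrow> 0 < m \<Longrightarrow>
      (\<integral>\<^sup>+x. indicator T x * ennreal (dist c x powr (- a)) \<partial>lborel) \<le> ennreal (C * m powr (1 - a / 2))"
    and X: "0 < X" "(\<integral>\<^sup>+x. indicator \<Omega> x * ennreal (\<bar>S x\<bar> powr p) \<partial>lborel) \<le> ennreal X"
  shows "(\<integral>\<^sup>+x. indicator P x * ennreal (\<bar>S x\<bar> powr \<tau> * infdist x V powr (- a)) \<partial>lborel)
     \<le> ennreal (2 powr a * C * (X powr (1 - a / 2) * (2 * (256 / \<kappa>\<^sup>2)\<^sup>2 * real (card V)) powr (a / 2)))"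
proof -
  have V: "finite V" "V \<noteq> {}" and fin: "finite I" "finite I'" and cl: "closed \<Omega>" and cov: "\<Omega> = (\<Union>i\<in>I. D i)" "\<Omega> = (\<Union>i\<in>I'. D' i)"
    using T1 T2 by (auto simp: cell_tiling_def)
  have Db: "D i \<in> sets borel" if "i \<in> I" for i using T1 that by (auto simp: cell_tiling_def)
  have D'b: "D' i \<in> sets borel" if "i \<in> I'" for i using T2 that by (auto simp: cell_tiling_def)
  have Sb: "S \<in> borel_measurable borel" unfolding S
    by (intro borel_measurable_diff step_function_borel[OF T1] step_function_borel[OF T2])
  have Pb: "P \<in> sets borel" unfolding P
    using V cl frontier_union_null(1)[OF T1] frontier_union_null(1)[OF T2] branching_borel[OF V(1)]
    by (intro sets.Diff) (auto intro: borel_closed finite_imp_closed)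
  have P\<Omega>: "P \<subseteq> \<Omega>" by (auto simp: P)
  define M where "M = 256 / \<kappa>\<^sup>2"
  define F where "F = (\<lambda>x. ennreal (\<bar>S x\<bar> powr \<tau> * infdist x V powr (- a)))"
  define J where "J = (\<lambda>C. {i \<in> I. \<exists>x \<in> closure (D i). x \<notin> V \<and> x \<notin> branching V \<and> cluster V x = C})"
  define J' where "J' = (\<lambda>C. {i \<in> I'. \<exists>x \<in> closure (D' i). x \<notin> V \<and> x \<notin> branching V \<and> cluster V x = C})"
  define \<T> where "\<T> = (SIGMA C:cluster V ` P. J C \<times> J' C)"
  define T where "T = (\<lambda>t. {x \<in> P. cluster V x = fst t} \<inter> D (fst (snd t)) \<inter> D' (snd (snd t)))"
  have J: "finite (J K)" "real (card (J K)) \<le> M" for K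
    using fin cells_meeting_cluster[OF T1 \<kappa>] by (auto simp: J_def M_def)
  have J': "finite (J' K)" "real (card (J' K)) \<le> M" for K
    using fin cells_meeting_cluster[OF T2 \<kappa>] by (auto simp: J'_def M_def)
  have finC: "finite (cluster V ` P)" by (rule finite_subset[of _ "Pow V"]) (use V in \<open>auto simp: cluster_def\<close>)
  have fin\<T>: "finite \<T>" unfolding \<T>_def by (intro finite_SigmaI finC finite_cartesian_product J(1) J'(1))
  have card\<T>: "real (card \<T>) \<le> 2 * M\<^sup>2 * real (card V)"
  proof -
    have "card \<T> = (\<Sum>K\<in>cluster V ` P. card (J K) * card (J' K))"
      unfolding \<T>_def by (simp add: card_SigmaI finC J(1) J'(1) card_cartesian_product)
    then have "real (card \<T>) = (\<Sum>K\<in>cluster V ` P. real (card (J K)) * real (card (J' K)))" by simp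
    also have "\<dots> \<le> (\<Sum>K\<in>cluster V ` P. M * M)"
      by (intro sum_mono mult_mono J(2) J'(2)) (simp_all add: M_def)
    also have "\<dots> = real (card (cluster V ` P)) * M\<^sup>2" by (simp add: power2_eq_square)
    also have "\<dots> \<le> real (2 * card V) * M\<^sup>2"
    proof (rule mult_right_mono)
      have "P \<inter> (V \<union> branching V) = {}" by (auto simp: P)
      then show "real (card (cluster V ` P)) \<le> real (2 * card V)"
        using cluster_card_le[OF V] of_nat_le_iff by blast
    qed simp
    finally show ?thesis by (simp add: mult_ac)
  qed
  have val: "x \<in> interior (D i) \<and> (\<Sum>i\<in>I. c i * indicator (D i) x) = c i" if "x \<in> P" "i \<in> I" "x \<in> D i" for x i
  proof -
    have "x \<in> closure (D i)" "x \<notin> (\<Union>i\<in>I. frontier (D i))" using that closure_subset by (auto simp: P)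
    then show ?thesis using cell_tiling_value[OF T1 that(2)] by blast
  qed
  have val': "x \<in> interior (D' i) \<and> (\<Sum>i\<in>I'. c' i * indicator (D' i) x) = c' i" if "x \<in> P" "i \<in> I'" "x \<in> D' i" for x i
  proof -
    have "x \<in> closure (D' i)" "x \<notin> (\<Union>i\<in>I'. frontier (D' i))" using that closure_subset by (auto simp: P)
    then show ?thesis using cell_tiling_value[OF T2 that(2)] by blast
  qed
  have uniq: "t = t'" if t: "t \<in> \<T>" "t' \<in> \<T>" "x \<in> T t" "x \<in> T t'" for t t' x
  proof -
    obtain K i j where t1: "t = (K, i, j)" by (cases t)
    obtain K' i' j' where t2: "t' = (K', i', j')" by (cases t')
    have I: "i \<in> I" "i' \<in> I" "j \<in> I'" "j' \<in> I'" using t(1,2) by (auto simp: \<T>_def J_def J'_def t1 t2)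
    have x: "x \<in> P" "K = cluster V x" "K' = cluster V x" "x \<in> D i" "x \<in> D i'" "x \<in> D' j" "x \<in> D' j'"
      using t(3,4) by (auto simp: T_def t1 t2)
    have "i = i'" using val[OF x(1) I(1) x(4)] val[OF x(1) I(2) x(5)] T1 I by (auto simp: cell_tiling_def)
    moreover have "j = j'" using val'[OF x(1) I(3) x(6)] val'[OF x(1) I(4) x(7)] T2 I by (auto simp: cell_tiling_def)
    ultimately show ?thesis using t1 t2 x by simp
  qed
  have ex: "\<exists>t\<in>\<T>. x \<in> T t" if x: "x \<in> P" for x
  proof -
    obtain i j where ij: "i \<in> I" "x \<in> D i" "j \<in> I'" "x \<in> D' j" using x P\<Omega> cov by (metis UN_E subsetD)
    have "x \<notin> V" "x \<notin> branching V" using x by (auto simp: P)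
    then have "(cluster V x, i, j) \<in> \<T>" using ij x closure_subset[of "D i"] closure_subset[of "D' j"]
      by (auto simp: \<T>_def J_def J'_def)
    moreover have "x \<in> T (cluster V x, i, j)" using ij x by (simp add: T_def)
    ultimately show ?thesis by blast
  qed
  have Tb: "T t \<in> sets borel" if "t \<in> \<T>" for t
  proof -
    have "{x \<in> P. cluster V x = fst t} = P \<inter> {x. cluster V x = fst t}" by auto
    then have "{x \<in> P. cluster V x = fst t} \<in> sets borel" using Pb cluster_borel[OF V(1)] by simp
    moreover have "fst (snd t) \<in> I" "snd (snd t) \<in> I'" using that by (auto simp: \<T>_def J_def J'_def)
    ultimately show ?thesis unfolding T_def by (intro sets.Int Db D'b)
  qed
  have TP: "T t \<subseteq> P" for t by (auto simp: T_def)
  \<comment> \<open>The sum of the normalised indicators of the pieces; its integral is at most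
    their number.\<close>
  define g where "g = (\<lambda>x. \<Sum>t\<in>\<T>. indicator (T t) x / measure lborel (T t))"
  define f where "f = (\<lambda>x. indicator \<Omega> x * \<bar>S x\<bar> powr p)"
  have g_val: "g x = 1 / measure lborel (T t)" if t: "t \<in> \<T>" "x \<in> T t" for t x
  proof -
    have "indicator (T t') x / measure lborel (T t') = (if t' = t then 1 / measure lborel (T t) else 0)" if "t' \<in> \<T>" for t'
    proof (cases "t' = t")
      case False
      then have "x \<notin> T t'" using uniq[OF that t(1) _ t(2)] by blast
      then show ?thesis using False by simp
    qed (use t in simp)
    then have "g x = (\<Sum>t'\<in>\<T>. if t' = t then 1 / measure lborel (T t) else 0)" unfolding g_def by (rule sum.cong[OF refl])
    then show ?thesis using fin\<T> t by simp
  qed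
  have gb: "g \<in> borel_measurable borel" unfolding g_def
    using Tb by (intro borel_measurable_sum borel_measurable_divide borel_measurable_indicator) auto
  have fb: "f \<in> borel_measurable borel" unfolding f_def
    using Sb cl by (intro borel_measurable_times borel_measurable_indicator) (auto intro: borel_closed)
  have piece: "(\<integral>\<^sup>+x. indicator (T t) x * F x \<partial>lborel)
      \<le> ennreal (2 powr a * C) * (\<integral>\<^sup>+x. indicator (T t) x * ennreal (f x powr (1 - a / 2) * g x powr (a / 2)) \<partial>lborel)" if t: "t \<in> \<T>" for t
  proof -
    obtain K i j where t1: "t = (K, i, j)" by (cases t)
    have I: "i \<in> I" "j \<in> I'" "K \<in> cluster V ` P" using t by (auto simp: \<T>_def J_def J'_def t1)
    then obtain x0 where x0: "x0 \<in> P" "K = cluster V x0" by blast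
    then obtain q where q: "q \<in> K" using cluster_nonempty[OF V, of x0] by (auto simp: P)
    have "(\<integral>\<^sup>+x. indicator (T t) x * F x \<partial>lborel)
      \<le> ennreal (2 powr a * C) * (\<integral>\<^sup>+x. indicator (T t) x * ennreal (\<bar>S x\<bar> powr \<tau> * (1 / measure lborel (T t)) powr (a / 2)) \<partial>lborel)"
      unfolding F_def
    proof (rule constant_piece_integral_le[OF V a p C _ _ _])
      show "T t \<in> sets borel" by (rule Tb[OF t])
      show "S x = c i - c' j" if "x \<in> T t" for x
        using that I val[of x i] val'[of x j] by (auto simp: T_def t1 S)
      show "q \<in> V \<and> dist q x \<le> 2 * infdist x V" if "x \<in> T t" for x
        using that q by (auto simp: T_def t1 cluster_def dist_commute)
      have "(\<integral>\<^sup>+x. indicator (T t) x * ennreal (\<bar>S x\<bar> powr p) \<partial>lborel) \<le> (\<integral>\<^sup>+x. indicator \<Omega> x * ennreal (\<bar>S x\<bar> powr p) \<partial>lborel)"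
        using TP[of t] P\<Omega> by (intro nn_integral_mono mult_right_mono) (auto simp: indicator_def)
      also note X(2)
      finally show "(\<integral>\<^sup>+x. indicator (T t) x * ennreal (\<bar>S x\<bar> powr p) \<partial>lborel) \<le> ennreal X" .
    qed
    also have "(\<integral>\<^sup>+x. indicator (T t) x * ennreal (\<bar>S x\<bar> powr \<tau> * (1 / measure lborel (T t)) powr (a / 2)) \<partial>lborel)
       = (\<integral>\<^sup>+x. indicator (T t) x * ennreal (f x powr (1 - a / 2) * g x powr (a / 2)) \<partial>lborel)"
    proof (rule nn_integral_cong)
      fix x
      show "indicator (T t) x * ennreal (\<bar>S x\<bar> powr \<tau> * (1 / measure lborel (T t)) powr (a / 2))
        = indicator (T t) x * ennreal (f x powr (1 - a / 2) * g x powr (a / 2))"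
      proof (cases "x \<in> T t")
        case True
        then have "x \<in> \<Omega>" using TP P\<Omega> by blast
        then show ?thesis using g_val[OF t True] p by (simp add: f_def powr_powr)
      qed simp
    qed
    finally show ?thesis .
  qed
  have sumT: "indicator P x * h = (\<Sum>t\<in>\<T>. indicator (T t) x * h)" for x and h :: ennreal
  proof (cases "x \<in> P")
    case True
    then obtain t where t: "t \<in> \<T>" "x \<in> T t" using ex by blast
    have "indicator (T t') x * h = (if t' = t then h else 0)" if "t' \<in> \<T>" for t'
    proof (cases "t' = t")
      case False
      then have "x \<notin> T t'" using uniq[OF that t(1) _ t(2)] by blast
      then show ?thesis using False by simp
    qed (use t in simp)
    then have "(\<Sum>t\<in>\<T>. indicator (T t) x * h) = (\<Sum>t'\<in>\<T>. if t' = t then h else 0)" by (rule sum.cong[OF refl])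
    then show ?thesis using True fin\<T> t by simp
  next
    case False
    then have "(\<Sum>t\<in>\<T>. indicator (T t) x * h) = 0"
      using TP by (intro sum.neutral) (auto simp: indicator_def)
    then show ?thesis using False by simp
  qed
  have Fb: "F \<in> borel_measurable borel" unfolding F_def using Sb by measurable
  have fgb: "(\<lambda>x. ennreal (f x powr (1 - a / 2) * g x powr (a / 2))) \<in> borel_measurable borel" using fb gb by measurable
  have "(\<integral>\<^sup>+x. indicator P x * F x \<partial>lborel) = (\<Sum>t\<in>\<T>. \<integral>\<^sup>+x. indicator (T t) x * F x \<partial>lborel)"
    unfolding sumT using Fb Tb by (intro nn_integral_sum) auto
  also have "\<dots> \<le> (\<Sum>t\<in>\<T>. ennreal (2 powr a * C) * (\<integral>\<^sup>+x. indicator (T t) x * ennreal (f x powr (1 - a / 2) * g x powr (a / 2)) \<partial>lborel))"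
    by (intro sum_mono piece)
  also have "\<dots> = ennreal (2 powr a * C) * (\<integral>\<^sup>+x. indicator P x * ennreal (f x powr (1 - a / 2) * g x powr (a / 2)) \<partial>lborel)"
    unfolding sum_distrib_left[symmetric] sumT using fgb Tb by (subst nn_integral_sum) auto
  also have "\<dots> \<le> ennreal (2 powr a * C) * (\<integral>\<^sup>+x. ennreal (f x powr (1 - a / 2) * g x powr (a / 2)) \<partial>lborel)"
    by (intro mult_left_mono nn_integral_mono) (auto simp: indicator_def)
  also have "\<dots> \<le> ennreal (2 powr a * C) * ennreal (X powr (1 - a / 2) * (2 * M\<^sup>2 * real (card V)) powr (a / 2))"
  proof (intro mult_left_mono nn_integral_Holder)
    show "f \<in> borel_measurable lborel" "g \<in> borel_measurable lborel" using fb gb by auto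
    show "0 \<le> f x" "0 \<le> g x" for x by (auto simp: f_def g_def intro!: sum_nonneg)
    show "0 < 1 - a / 2" "0 < a / 2" "1 - a / 2 + a / 2 = 1" "0 < X" using a X by auto
    show "0 < 2 * M\<^sup>2 * real (card V)" using V \<kappa> by (simp add: M_def card_gt_0_iff)
    have "ennreal (f x) = indicator \<Omega> x * ennreal (\<bar>S x\<bar> powr p)" for x by (simp add: f_def indicator_def)
    then show "(\<integral>\<^sup>+x. ennreal (f x) \<partial>lborel) \<le> ennreal X" using X by simp
    have "(\<integral>\<^sup>+x. ennreal (g x) \<partial>lborel) = (\<integral>\<^sup>+x. (\<Sum>t\<in>\<T>. ennreal (1 / measure lborel (T t)) * indicator (T t) x) \<partial>lborel)"
    proof (rule nn_integral_cong)
      fix x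
      have "ennreal (g x) = (\<Sum>t\<in>\<T>. ennreal (indicator (T t) x / measure lborel (T t)))"
        unfolding g_def by (rule sum_ennreal[symmetric]) simp
      also have "\<dots> = (\<Sum>t\<in>\<T>. ennreal (1 / measure lborel (T t)) * indicator (T t) x)"
        by (intro sum.cong) (auto simp: indicator_def)
      finally show "ennreal (g x) = (\<Sum>t\<in>\<T>. ennreal (1 / measure lborel (T t)) * indicator (T t) x)" .
    qed
    also have "\<dots> = (\<Sum>t\<in>\<T>. ennreal (1 / measure lborel (T t)) * emeasure lborel (T t))"
      using Tb by (subst nn_integral_sum) (auto simp: nn_integral_cmult_indicator)
    also have "\<dots> \<le> (\<Sum>t\<in>\<T>. 1)"
    proof (rule sum_mono)
      fix t
      show "ennreal (1 / measure lborel (T t)) * emeasure lborel (T t) \<le> 1"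
      proof (cases "emeasure lborel (T t) = \<infinity>")
        case True
        \<comment> \<open>For infinite area \<open>measure\<close> is 0 and
          \<open>1 / 0 = 0\<close>, so the product vanishes.\<close>
        then show ?thesis by (simp add: measure_def)
      next
        case False
        then have "emeasure lborel (T t) = ennreal (measure lborel (T t))" by (simp add: emeasure_eq_ennreal_measure)
        then show ?thesis by (simp add: ennreal_mult[symmetric])
      qed
    qed
    also have "\<dots> = ennreal (real (card \<T>))" by (simp add: ennreal_of_nat_eq_real_of_nat)
    also have "\<dots> \<le> ennreal (2 * M\<^sup>2 * real (card V))" by (intro ennreal_leI card\<T>)
    finally show "(\<integral>\<^sup>+x. ennreal (g x) \<partial>lborel) \<le> ennreal (2 * M\<^sup>2 * real (card V))" .
  qed simp
  also have "\<dots> = ennreal (2 powr a * C * (X powr (1 - a / 2) * (2 * M\<^sup>2 * real (card V)) powr (a / 2)))"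
    using C by (simp add: ennreal_mult)
  finally show ?thesis unfolding F_def M_def .
qed

text \<open>Off a null set, \<Omega> is covered by the clustered and the branching part. Hoelder's
  inequality with exponents \<open>1 - a / 2\<close> and \<open>a / 2\<close> is applied to both,
  against a function whose integral is at most a multiple of \<open>card V\<close>, so both give the
  same powers of \<open>X\<close> and \<open>card V\<close>.\<close>

lemma weighted_estimate:
  assumes \<kappa>: "0 < \<kappa>" "\<kappa> \<le> 1" and a: "0 < a" "a < 2" and p: "0 < p" "\<tau> = p * (1 - a / 2)"
  obtains K where "0 < K" "\<And>V I D \<Omega> I' D' c c' S X. cell_tiling \<kappa> V I D \<Omega> \<Longrightarrow> cell_tiling \<kappa> V I' D' \<Omega> \<Longrightarrow>
      S = (\<lambda>x. (\<Sum>i\<in>I. c i * indicator (D i) x) - (\<Sum>i\<in>I'. c' i * indicator (D' i) x)) \<Longrightarrow>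
      0 < X \<Longrightarrow> (\<integral>\<^sup>+x. indicator \<Omega> x * ennreal (\<bar>S x\<bar> powr p) \<partial>lborel) \<le> ennreal X \<Longrightarrow>
      (\<integral>\<^sup>+x. indicator \<Omega> x * ennreal (\<bar>S x\<bar> powr \<tau> * infdist x V powr (- a)) \<partial>lborel)
        \<le> ennreal (K * X powr (1 - a / 2) * real (card V) powr (a / 2))"
proof -
  obtain C where C: "0 < C" "\<And>(c::pt) T m. T \<in> sets lborel \<Longrightarrow> emeasure lborel T = ennreal m \<Longrightarrow> 0 < m \<Longrightarrow>
      (\<integral>\<^sup>+x. indicator T x * ennreal (dist c x powr (- a)) \<partial>lborel) \<le> ennreal (C * m powr (1 - a / 2))"
    using powr_dist_integral_le[OF a] by blast
  define K1 where "K1 = 2 powr a * C * (2 * (256 / \<kappa>\<^sup>2)\<^sup>2) powr (a / 2)"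
  define K2 where "K2 = branching_const powr (a / 2)"
  have main: "(\<integral>\<^sup>+x. indicator \<Omega> x * ennreal (\<bar>S x\<bar> powr \<tau> * infdist x V powr (- a)) \<partial>lborel)
        \<le> ennreal ((K1 + K2) * X powr (1 - a / 2) * real (card V) powr (a / 2))"
    if T1: "cell_tiling \<kappa> V I D \<Omega>" and T2: "cell_tiling \<kappa> V I' D' \<Omega>"
    and S: "S = (\<lambda>x. (\<Sum>i\<in>I. c i * indicator (D i) x) - (\<Sum>i\<in>I'. c' i * indicator (D' i) x))"
    and X: "0 < X" "(\<integral>\<^sup>+x. indicator \<Omega> x * ennreal (\<bar>S x\<bar> powr p) \<partial>lborel) \<le> ennreal X"
    for V I D \<Omega> I' D' c c' S X
  proof -
    have V: "finite V" "V \<noteq> {}" and cl: "closed \<Omega>" using T1 by (auto simp: cell_tiling_def)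
    have Sb: "S \<in> borel_measurable borel" unfolding S
      by (intro borel_measurable_diff step_function_borel[OF T1] step_function_borel[OF T2])
    define N where "N = (\<Union>i\<in>I. frontier (D i))"
    define N' where "N' = (\<Union>i\<in>I'. frontier (D' i))"
    define P where "P = \<Omega> - V - branching V - N - N'"
    define F where "F = (\<lambda>x. ennreal (\<bar>S x\<bar> powr \<tau> * infdist x V powr (- a)))"
    define B where "B = branching V - V"
    have Pb: "P \<in> sets borel" unfolding P_def N_def N'_def
      using V cl frontier_union_null(1)[OF T1] frontier_union_null(1)[OF T2] branching_borel[OF V(1)]
      by (intro sets.Diff) (auto intro: borel_closed finite_imp_closed)
    have Bb: "B \<in> sets borel" unfolding B_def using V branching_borel[OF V(1)]
      by (intro sets.Diff) (auto intro: borel_closed finite_imp_closed)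
    have Fb: "F \<in> borel_measurable borel" unfolding F_def using Sb by measurable
    have "(\<integral>\<^sup>+x. indicator \<Omega> x * F x \<partial>lborel) \<le> (\<integral>\<^sup>+x. indicator P x * F x + indicator (B \<inter> \<Omega>) x * F x \<partial>lborel)"
    proof (rule nn_integral_mono_AE)
      have "AE x in lborel. x \<notin> V" using V(1) by (intro AE_not_in finite_imp_null_set_lborel)
      moreover have "AE x in lborel. x \<notin> N" unfolding N_def by (intro AE_not_in frontier_union_null(2)[OF T1])
      moreover have "AE x in lborel. x \<notin> N'" unfolding N'_def by (intro AE_not_in frontier_union_null(2)[OF T2])
      ultimately show "AE x in lborel. indicator \<Omega> x * F x \<le> indicator P x * F x + indicator (B \<inter> \<Omega>) x * F x"
        by eventually_elim (auto simp: P_def B_def indicator_def)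
    qed
    also have "\<dots> = (\<integral>\<^sup>+x. indicator P x * F x \<partial>lborel) + (\<integral>\<^sup>+x. indicator (B \<inter> \<Omega>) x * F x \<partial>lborel)"
    proof (rule nn_integral_add)
      have "B \<inter> \<Omega> \<in> sets borel" by (rule sets.Int[OF Bb borel_closed[OF cl]])
      then show "(\<lambda>x. indicator (B \<inter> \<Omega>) x * F x) \<in> borel_measurable lborel" using Fb by simp
      show "(\<lambda>x. indicator P x * F x) \<in> borel_measurable lborel" using Pb Fb by simp
    qed
    also have "\<dots> \<le> ennreal (K1 * X powr (1 - a / 2) * real (card V) powr (a / 2)) + ennreal (K2 * X powr (1 - a / 2) * real (card V) powr (a / 2))"
    proof (rule add_mono)
      have "(\<integral>\<^sup>+x. indicator P x * F x \<partial>lborel) \<le> ennreal (2 powr a * C * (X powr (1 - a / 2) * (2 * (256 / \<kappa>\<^sup>2)\<^sup>2 * real (card V)) powr (a / 2)))"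
        unfolding F_def by (rule clustered_part_le[OF T1 T2 \<kappa> S _ a p C X]) (simp add: P_def N_def N'_def)
      also have "2 powr a * C * (X powr (1 - a / 2) * (2 * (256 / \<kappa>\<^sup>2)\<^sup>2 * real (card V)) powr (a / 2)) = K1 * X powr (1 - a / 2) * real (card V) powr (a / 2)"
        by (simp add: K1_def powr_mult mult_ac)
      finally show "(\<integral>\<^sup>+x. indicator P x * F x \<partial>lborel) \<le> ennreal (K1 * X powr (1 - a / 2) * real (card V) powr (a / 2))" .
    next
      define f where "f = (\<lambda>x. indicator \<Omega> x * \<bar>S x\<bar> powr p)"
      define g where "g = (\<lambda>x. indicator B x / (infdist x V)\<^sup>2)"
      have "(\<integral>\<^sup>+x. indicator (B \<inter> \<Omega>) x * F x \<partial>lborel) = (\<integral>\<^sup>+x. ennreal (f x powr (1 - a / 2) * g x powr (a / 2)) \<partial>lborel)"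
      proof (rule nn_integral_cong)
        fix x
        show "indicator (B \<inter> \<Omega>) x * F x = ennreal (f x powr (1 - a / 2) * g x powr (a / 2))"
        proof (cases "x \<in> B \<inter> \<Omega>")
          case True
          have d: "infdist x V > 0" using infdist_pos[OF V, of x] True by (auto simp: B_def)
          have "(1 / (infdist x V)\<^sup>2) powr (a / 2) = infdist x V powr (- a)"
          proof -
            have "1 / (infdist x V)\<^sup>2 = infdist x V powr (- 2)" using d by (simp add: powr_minus inverse_eq_divide)
            then show ?thesis using d by (simp add: powr_powr)
          qed
          then show ?thesis using True p by (simp add: f_def g_def F_def powr_powr)
        next
          case False
          then show ?thesis by (auto simp: f_def g_def)
        qed
      qed
      also have "\<dots> \<le> ennreal (X powr (1 - a / 2) * (branching_const * real (card V)) powr (a / 2))"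
      proof (rule nn_integral_Holder)
        show "f \<in> borel_measurable lborel" unfolding f_def
          using Sb cl by (simp add: borel_closed)
        show "g \<in> borel_measurable lborel" unfolding g_def using Bb by simp
        show "0 \<le> f x" "0 \<le> g x" for x by (auto simp: f_def g_def)
        show "0 < 1 - a / 2" "0 < a / 2" "1 - a / 2 + a / 2 = 1" "0 < X" using a X by auto
        show "0 < branching_const * real (card V)" using V by (simp add: branching_const_def card_gt_0_iff)
        have "ennreal (f x) = indicator \<Omega> x * ennreal (\<bar>S x\<bar> powr p)" for x by (simp add: f_def indicator_def)
        then show "(\<integral>\<^sup>+x. ennreal (f x) \<partial>lborel) \<le> ennreal X" using X by simp
        have "ennreal (g x) = indicator (branching V - V) x * ennreal (1 / (infdist x V)\<^sup>2)" for x by (simp add: g_def B_def indicator_def)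
        then show "(\<integral>\<^sup>+x. ennreal (g x) \<partial>lborel) \<le> ennreal (branching_const * real (card V))"
          using branching_integral[OF V] by simp
      qed
      also have "X powr (1 - a / 2) * (branching_const * real (card V)) powr (a / 2) = K2 * X powr (1 - a / 2) * real (card V) powr (a / 2)"
        by (simp add: K2_def powr_mult branching_const_def mult_ac)
      finally show "(\<integral>\<^sup>+x. indicator (B \<inter> \<Omega>) x * F x \<partial>lborel) \<le> ennreal (K2 * X powr (1 - a / 2) * real (card V) powr (a / 2))" .
    qed
    also have "\<dots> = ennreal ((K1 + K2) * X powr (1 - a / 2) * real (card V) powr (a / 2))"
      using C(1) by (subst ennreal_plus[symmetric]) (auto simp: K1_def K2_def algebra_simps)
    finally show ?thesis unfolding F_def .
  qed
  have "0 < K1 + K2" using C(1) \<kappa> by (intro add_pos_nonneg) (auto simp: K1_def K2_def)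
  then show thesis using that[of "K1 + K2"] main by blast
qed

section \<open>Matching jumps on a line\<close>

text \<open>The point \<open>y\<close> may lie outside \<open>J\<close>, and \<open>c = c'\<close>
  is allowed, so constant functions qualify. \<open>N\<close> will be the set of parameters at which
  a line meets the frontiers.\<close>

definition one_jump :: "real set \<Rightarrow> (real \<Rightarrow> real) \<Rightarrow> real set \<Rightarrow> real \<Rightarrow> real \<Rightarrow> real \<Rightarrow> bool" where
  "one_jump N s J y c c' \<longleftrightarrow> (\<forall>q \<in> J - N. (q < y \<and> s q = c) \<or> (y < q \<and> s q = c'))"

text \<open>The trace of \<open>step_function_two_phase\<close> on a line: \<sigma> is the distance
  to the nodes measured in step lengths, and a change of value within reach of \<open>r\<close>
  forces the two-value structure on a symmetric window about \<open>r\<close>.\<close>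

definition jump_controlled :: "real \<Rightarrow> real set \<Rightarrow> real set \<Rightarrow> (real \<Rightarrow> real) \<Rightarrow> (real \<Rightarrow> real) \<Rightarrow> bool" where
  "jump_controlled \<theta> U N \<sigma> s \<longleftrightarrow> (\<forall>r r'. r \<notin> N \<longrightarrow> r' \<notin> N \<longrightarrow> closed_segment r r' \<subseteq> U \<longrightarrow>
     \<bar>r - r'\<bar> < \<theta> * \<sigma> r \<longrightarrow> s r \<noteq> s r' \<longrightarrow>
     {r - \<theta> * \<sigma> r <..< r + \<theta> * \<sigma> r} \<subseteq> U \<and> (\<exists>y c c'. one_jump N s {r - \<theta> * \<sigma> r <..< r + \<theta> * \<sigma> r} y c c'))"

text \<open>Lines are parametrised by multiples of the step vector, so the step is always 1.\<close>

definition line_diff :: "real set \<Rightarrow> (real \<Rightarrow> real) \<Rightarrow> real \<Rightarrow> real" where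
  "line_diff U s r = (if {r..r+1} \<subseteq> U then s (r + 1) - s r else 0)"

text \<open>This is \<open>min 1 (1 / x)\<close> without the junk value \<open>1 / 0 = 0\<close>.\<close>

definition damp :: "real \<Rightarrow> real" where
  "damp x = (if x \<le> 1 then 1 else 1 / x)"

text \<open>The linearised triangle inequality: \<open>A = B = 1\<close> is admissible for \<open>\<tau> \<le> 1\<close>, and for \<open>\<tau> \<ge> 1\<close>
  minimising over \<open>A = (1 - \<epsilon>)\<^bsup>1-\<tau>\<^esup>\<close>, \<open>B = \<epsilon>\<^bsup>1-\<tau>\<^esup>\<close> recovers Minkowski's inequality.\<close>

definition split_ineq :: "real \<Rightarrow> real \<Rightarrow> real \<Rightarrow> bool" where
  "split_ineq \<tau> A B \<longleftrightarrow> 0 \<le> A \<and> 0 \<le> B \<and> (\<forall>a b. 0 \<le> a \<longrightarrow> 0 \<le> b \<longrightarrow> (a + b) powr \<tau> \<le> A * a powr \<tau> + B * b powr \<tau>)"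

lemma powr_add_le_2:
  fixes a b :: real
  assumes "0 \<le> a" "0 \<le> b" "0 < \<tau>"
  shows "(a + b) powr \<tau> \<le> 2 powr \<tau> * (a powr \<tau> + b powr \<tau>)"
proof -
  have "(a + b) powr \<tau> \<le> (2 * max a b) powr \<tau>" using assms by (intro powr_mono2) auto
  also have "\<dots> = 2 powr \<tau> * max a b powr \<tau>" using assms by (intro powr_mult)
  also have "\<dots> \<le> 2 powr \<tau> * (a powr \<tau> + b powr \<tau>)" by (intro mult_left_mono) (auto simp: max_def)
  finally show ?thesis .
qed

lemma split_ineq_three:
  assumes "split_ineq \<tau> A B" "0 < \<tau>" "\<bar>x\<bar> \<le> \<bar>a\<bar> + (\<bar>b\<bar> + \<bar>c\<bar>)"
  shows "\<bar>x\<bar> powr \<tau> \<le> A * \<bar>a\<bar> powr \<tau> + B * 2 powr \<tau> * (\<bar>b\<bar> powr \<tau> + \<bar>c\<bar> powr \<tau>)"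
proof -
  have "\<bar>x\<bar> powr \<tau> \<le> (\<bar>a\<bar> + (\<bar>b\<bar> + \<bar>c\<bar>)) powr \<tau>" using assms by (intro powr_mono2) auto
  also have "\<dots> \<le> A * \<bar>a\<bar> powr \<tau> + B * (\<bar>b\<bar> + \<bar>c\<bar>) powr \<tau>" using assms(1) unfolding split_ineq_def by auto
  also have "\<dots> \<le> A * \<bar>a\<bar> powr \<tau> + B * (2 powr \<tau> * (\<bar>b\<bar> powr \<tau> + \<bar>c\<bar> powr \<tau>))"
    using assms powr_add_le_2[of "\<bar>b\<bar>" "\<bar>c\<bar>" \<tau>] by (intro add_left_mono mult_left_mono) (auto simp: split_ineq_def)
  finally show ?thesis by (simp add: mult.assoc)
qed

lemma null_set_avoid:
  fixes N :: "real set"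
  assumes "N \<in> null_sets lborel" "a < b"
  obtains x where "a < x" "x < b" "x \<notin> N"
proof -
  have "\<not> {a<..<b} \<subseteq> N"
  proof
    assume "{a<..<b} \<subseteq> N"
    then have "emeasure lborel {a<..<b} \<le> emeasure lborel N" using assms by (intro emeasure_mono) auto
    then have "emeasure lborel {a<..<b} = 0" using assms by (simp add: null_setsD1)
    then show False using assms(2) by simp
  qed
  then show thesis using that by (auto simp: subset_iff)
qed

lemma one_jump_left: "one_jump N s J y c c' \<Longrightarrow> q \<in> J \<Longrightarrow> q \<notin> N \<Longrightarrow> q < y \<Longrightarrow> s q = c"
  unfolding one_jump_def by (metis DiffI less_asym)

lemma one_jump_right: "one_jump N s J y c c' \<Longrightarrow> q \<in> J \<Longrightarrow> q \<notin> N \<Longrightarrow> y < q \<Longrightarrow> s q = c'"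
  unfolding one_jump_def by (metis DiffI less_asym)

text \<open>Close to a proper jump \<open>y'\<close> there are points on both sides with different
  values; if \<open>y' \<noteq> y\<close>, they could be taken on one side of \<open>y\<close>,
  where the function has only one value.\<close>

lemma one_jump_same_point:
  assumes N: "N \<in> null_sets lborel" and d: "0 < d" "0 < d'" and y: "\<bar>y - y'\<bar> < d"
    and j: "one_jump N s {y - d<..<y + d} y c1 c2" and j': "one_jump N s {y' - d'<..<y' + d'} y' c1' c2'"
    and ne: "c1' \<noteq> c2'"
  shows "y = y'"
proof (rule ccontr)
  assume "y \<noteq> y'"
  define k where "k = min d' (min \<bar>y - y'\<bar> (d - \<bar>y - y'\<bar>))"
  have k: "0 < k" "k \<le> d'" "k \<le> \<bar>y - y'\<bar>" "k \<le> d - \<bar>y - y'\<bar>" using d y \<open>y \<noteq> y'\<close> by (auto simp: k_def)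
  obtain p where p: "y' - k < p" "p < y'" "p \<notin> N" using null_set_avoid[OF N, of "y' - k" y'] k by auto
  obtain q where q: "y' < q" "q < y' + k" "q \<notin> N" using null_set_avoid[OF N, of y' "y' + k"] k by auto
  have "p \<in> {y' - d'<..<y' + d'}" "q \<in> {y' - d'<..<y' + d'}" using p q k by auto
  then have "s p = c1'" "s q = c2'" using one_jump_left[OF j'] one_jump_right[OF j'] p q by blast+
  moreover have pq: "p \<in> {y - d<..<y + d}" "q \<in> {y - d<..<y + d}" using p q k by (auto simp: abs_if split: if_splits)
  moreover have "(p < y \<and> q < y) \<or> (y < p \<and> y < q)" using p q k by (auto simp: abs_if split: if_splits)
  ultimately show False using one_jump_left[OF j] one_jump_right[OF j] p(3) q(3) ne by metis
qed

lemma one_jump_between: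
  assumes "one_jump N s J y c c'" "r \<in> J - N" "r' \<in> J - N" "r < r'" "s r \<noteq> s r'"
  shows "r < y" "y < r'" "s r = c" "s r' = c'" "c \<noteq> c'"
proof -
  have "(r < y \<and> s r = c) \<or> (y < r \<and> s r = c')" "(r' < y \<and> s r' = c) \<or> (y < r' \<and> s r' = c')"
    using assms(1-3) unfolding one_jump_def by blast+
  then show "r < y" "y < r'" "s r = c" "s r' = c'" "c \<noteq> c'" using assms(4,5) by auto
qed

lemma AE_shift:
  fixes N :: "real set"
  assumes "N \<in> null_sets lborel"
  shows "AE r in lborel. r + t \<notin> N"
proof -
  have "AE r in distr lborel borel ((+) t). r \<notin> N"
    unfolding lborel_distr_plus using assms by (rule AE_not_in)
  then have "AE r in lborel. t + r \<notin> N" by (rule AE_distrD[rotated]) simp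
  then show ?thesis by (simp add: add.commute)
qed

lemma emeasure_density_const_interval:
  fixes f :: "real \<Rightarrow> ennreal"
  assumes f: "f \<in> borel_measurable borel" and ab: "a \<le> b"
    and AE: "AE r in lborel. a < r \<and> r < b \<longrightarrow> f r = k"
  shows "emeasure (density lborel f) {a<..<b} = k * ennreal (b - a)"
proof -
  have "emeasure (density lborel f) {a<..<b} = (\<integral>\<^sup>+r. f r * indicator {a<..<b} r \<partial>lborel)"
    using f by (intro emeasure_density) auto
  also have "\<dots> = (\<integral>\<^sup>+r. k * indicator {a<..<b} r \<partial>lborel)"
    using AE by (intro nn_integral_cong_AE) (auto simp: indicator_def elim: eventually_mono)
  also have "\<dots> = k * ennreal (b - a)" using ab by (simp add: nn_integral_cmult_indicator)
  finally show ?thesis .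
qed

text \<open>\<open>e\<close> is the shift from the jump \<open>y\<close> of the first function to the jump of the second one; if the
  latter has no jump near \<open>y\<close>, then \<open>e = 0\<close> and \<open>d = d'\<close>.\<close>

lemma matched_jump:
  assumes \<theta>: "0 < \<theta>" "\<theta> \<le> 1" and N: "N \<in> null_sets lborel"
    and \<sigma>: "\<And>r r'. \<bar>\<sigma> r - \<sigma> r'\<bar> \<le> \<bar>r - r'\<bar>"
    and c2: "jump_controlled \<theta> U N \<sigma> s2"
    and y: "100 / \<theta> \<le> \<sigma> y" and h: "h = \<theta> / 4 * \<sigma> y" and U: "{y - h<..<y + h} \<subseteq> U"
  obtains e d d' l r where "\<bar>e\<bar> < h / 4"
    "\<And>q. q \<in> {y - 1 + e<..<y + e} \<Longrightarrow> q \<notin> N \<Longrightarrow> q + 1 \<notin> N \<Longrightarrow> s2 (q + 1) - s2 q = d' - d"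
    "y - h / 2 \<le> l" "l + h / 4 \<le> y" "\<And>q. q \<in> {l<..<l + h / 4} \<Longrightarrow> q \<notin> N \<Longrightarrow> s2 q = d"
    "y \<le> r" "r + h / 4 \<le> y + h / 2" "\<And>q. q \<in> {r<..<r + h / 4} \<Longrightarrow> q \<notin> N \<Longrightarrow> s2 q = d'"
proof -
  have h25: "25 \<le> h" using y \<theta> by (simp add: h field_simps)
  have \<sigma>y: "100 \<le> \<sigma> y" using y \<theta> by (smt (verit) divide_le_eq_1 le_divide_eq mult_left_le zero_less_divide_iff)
  have h\<sigma>: "h \<le> \<sigma> y / 4" using \<theta> \<sigma>y by (simp add: h mult_left_le_one_le)
  show thesis
  proof (cases "\<exists>d. \<forall>q \<in> {y - h / 4<..<y + h / 4} - N. s2 q = d")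
    case True
    then obtain d where d: "\<And>q. q \<in> {y - h / 4<..<y + h / 4} - N \<Longrightarrow> s2 q = d" by blast
    show thesis
      by (rule that[of 0 d d "y - h / 4" y]) (use h25 d in auto)
  next
    case False
    obtain q0 where q0: "q0 \<in> {y - h / 4<..<y + h / 4} - N" using null_set_avoid[OF N, of "y - h / 4" "y + h / 4"] h25 by auto
    then obtain q1 where q1: "q1 \<in> {y - h / 4<..<y + h / 4} - N" "s2 q1 \<noteq> s2 q0" using False by metis
    define q where "q = min q0 q1"
    define q' where "q' = max q0 q1"
    have "q0 \<noteq> q1" using q1 by auto
    then have qq: "q \<in> {y - h / 4<..<y + h / 4} - N" "q' \<in> {y - h / 4<..<y + h / 4} - N" "q < q'" "s2 q \<noteq> s2 q'"
      using q0 q1 by (auto simp: q_def q'_def min_def max_def not_le)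
    have "\<bar>\<sigma> q - \<sigma> y\<bar> \<le> h / 4" using \<sigma>[of q y] qq(1) by (auto simp: abs_if split: if_splits)
    then have "\<sigma> y / 2 \<le> \<sigma> q" using h\<sigma> \<sigma>y by (simp add: abs_if split: if_splits)
    then have "\<theta> * (\<sigma> y / 2) \<le> \<theta> * \<sigma> q" using \<theta> by (intro mult_left_mono) auto
    \<comment> \<open>Control is given at \<open>q\<close> only, but the window about
      \<open>q\<close> has radius at least \<open>2 * h\<close> and so contains the window about
      \<open>y\<close>.\<close>
    then have R: "2 * h \<le> \<theta> * \<sigma> q" by (simp add: h)
    have "closed_segment q q' \<subseteq> U" using U qq h25 by (auto simp: closed_segment_eq_real_ivl)
    moreover have "\<bar>q - q'\<bar> < \<theta> * \<sigma> q" using qq R h25 by auto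
    ultimately obtain z d d' where z: "one_jump N s2 {q - \<theta> * \<sigma> q <..< q + \<theta> * \<sigma> q} z d d'"
      using c2 qq unfolding jump_controlled_def by blast
    have z': "one_jump N s2 {y - h<..<y + h} z d d'"
      using z qq(1) R unfolding one_jump_def by auto
    have "q \<in> {y - h<..<y + h} - N" "q' \<in> {y - h<..<y + h} - N" using qq h25 by auto
    then have zq: "q < z" "z < q'" using one_jump_between(1,2)[OF z' _ _ qq(3,4)] by blast+
    moreover have "y - h / 4 < q" "q' < y + h / 4" using qq(1,2) by auto
    ultimately have zy: "\<bar>z - y\<bar> < h / 4" by linarith
    have left: "s2 p = d" if "p \<in> {y - h<..<z}" "p \<notin> N" for p
      using one_jump_left[OF z', of p] that zy h25 by (auto simp: abs_if split: if_splits)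
    have right: "s2 p = d'" if "p \<in> {z<..<y + h}" "p \<notin> N" for p
      using one_jump_right[OF z', of p] that zy h25 by (auto simp: abs_if split: if_splits)
    show thesis
    \<comment> \<open>The jumps \<open>y\<close> and \<open>z\<close> are less than
      \<open>h / 4\<close> apart, so the intervals of length \<open>h / 4\<close> at the two ends of
      the half window lie on the same side of both. Their length, comparable with \<sigma>, pays for
      the error later.\<close>
    proof (rule that[of "z - y" d' d "y - h / 2" "y + h / 4"])
      show "s2 (q + 1) - s2 q = d' - d" if "q \<in> {y - 1 + (z - y)<..<y + (z - y)}" "q \<notin> N" "q + 1 \<notin> N" for q
      proof -
        have "q \<in> {y - h<..<z}" "q + 1 \<in> {z<..<y + h}" using that zy h25 by (auto simp: abs_if split: if_splits)
        then show ?thesis using left right that by simp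
      qed
      show "s2 q = d" if "q \<in> {y - h / 2<..<y - h / 2 + h / 4}" "q \<notin> N" for q
        using left[of q] that zy h25 by (auto simp: abs_if split: if_splits)
      show "s2 q = d'" if "q \<in> {y + h / 4<..<y + h / 4 + h / 4}" "q \<notin> N" for q
        using right[of q] that zy h25 by (auto simp: abs_if split: if_splits)
    qed (use zy h25 in auto)
  qed
qed

lemma line_diff_borel:
  assumes "closed U" "s \<in> borel_measurable borel"
  shows "line_diff U s \<in> borel_measurable borel"
proof -
  have "closed {r. {r..r+1} \<subseteq> U}"
  proof -
    have "{r. {r..r+1} \<subseteq> U} = (\<Inter>t\<in>{0..1}. {r. r + t \<in> U})"
    proof (intro set_eqI iffI)
      fix r assume r: "r \<in> (\<Inter>t\<in>{0..1}. {r. r + t \<in> U})"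
      have "q \<in> U" if "q \<in> {r..r+1}" for q
      proof -
        have "q - r \<in> {0..1}" using that by auto
        then have "r + (q - r) \<in> U" using r by blast
        then show ?thesis by simp
      qed
      then show "r \<in> {r. {r..r+1} \<subseteq> U}" by auto
    qed (auto simp: subset_iff)
    moreover have "closed {r. r + t \<in> U}" for t
    proof -
      have "closed ((\<lambda>r. r + t) -` U)" by (intro closed_vimage assms(1) continuous_intros)
      then show ?thesis by (simp add: vimage_def)
    qed
    ultimately show ?thesis by auto
  qed
  then have [measurable]: "{r. {r..r+1} \<subseteq> U} \<in> sets borel" by (rule borel_closed)
  note assms(2)[measurable]
  have "line_diff U s = (\<lambda>r. if r \<in> {r. {r..r+1} \<subseteq> U} then s (r + 1) - s r else 0)" by (auto simp: line_diff_def)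
  also have "\<dots> \<in> borel_measurable borel" by measurable
  finally show ?thesis .
qed

text \<open>\<open>Y\<close> is the set of isolated jumps of \<open>s1\<close>. Up to a null set, a
  start \<open>r\<close> with nonzero difference either crosses such a jump and lies in
  \<open>G\<close>, or it lies in \<open>Bad\<close>. On \<open>G\<close> the difference is compared
  with that of \<open>s2\<close> on a translated unit interval, and the error is paid by
  \<open>fe\<close> on the window \<open>H y\<close>. On \<open>Bad\<close> \<sigma> is bounded
  above, so \<open>damp\<close> is bounded below, and both functions are compared at the same point.
  The translates, with union \<open>Im\<close>, are disjoint from each other and from
  \<open>Bad\<close>; so the difference of \<open>s2\<close> is used only once and keeps the factor
  \<open>A\<close>.\<close>

lemma line_difference_inequality:
  assumes \<theta>: "0 < \<theta>" "\<theta> \<le> 1" and \<tau>: "0 < \<tau>" and AB: "split_ineq \<tau> A B"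
    and N: "N \<in> null_sets lborel" "closed N" and U: "closed U"
    and s: "s1 \<in> borel_measurable borel" "s2 \<in> borel_measurable borel"
    and \<sigma>: "\<And>r r'. \<bar>\<sigma> r - \<sigma> r'\<bar> \<le> \<bar>r - r'\<bar>" "\<sigma> \<in> borel_measurable borel"
    and c1: "jump_controlled \<theta> U N \<sigma> s1" and c2: "jump_controlled \<theta> U N \<sigma> s2"
  shows "(\<integral>\<^sup>+r. ennreal (\<bar>line_diff U s1 r\<bar> powr \<tau>) \<partial>lborel)
    \<le> ennreal A * (\<integral>\<^sup>+r. ennreal (\<bar>line_diff U s2 r\<bar> powr \<tau>) \<partial>lborel)
      + ennreal (B * 2 powr \<tau> * (1000 / \<theta>)) * (\<integral>\<^sup>+r. indicator U r * ennreal (\<bar>s1 r - s2 r\<bar> powr \<tau> * damp (\<sigma> r)) \<partial>lborel)"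
proof -
  note s[measurable] \<sigma>(2)[measurable]
  have A0: "0 \<le> A" and B0: "0 \<le> B" using AB by (auto simp: split_ineq_def)
  \<comment> \<open>At an isolated jump this makes the window radius \<open>h y\<close> at least 25,
    so the unit step is small in comparison.\<close>
  define K where "K = 100 / \<theta>"
  have K: "100 \<le> K" using \<theta> by (simp add: K_def field_simps)
  \<comment> \<open>A quarter of the radius in \<open>jump_controlled\<close>: \<sigma> changes by
    at most 1 between a start \<open>r\<close> and the jump \<open>y\<close> it crosses, so the
    window about \<open>y\<close> fits into the one about \<open>r\<close>.\<close>
  define h where "h = (\<lambda>y. \<theta> / 4 * \<sigma> y)"
  define Y where "Y = {y. K \<le> \<sigma> y \<and> {y - h y<..<y + h y} \<subseteq> U \<and> (\<exists>c c'. c \<noteq> c' \<and> one_jump N s1 {y - h y<..<y + h y} y c c')}"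
  define f1 where "f1 = (\<lambda>r. ennreal (\<bar>line_diff U s1 r\<bar> powr \<tau>))"
  define f2 where "f2 = (\<lambda>r. ennreal (\<bar>line_diff U s2 r\<bar> powr \<tau>))"
  define fe where "fe = (\<lambda>r. indicator U r * ennreal (\<bar>s1 r - s2 r\<bar> powr \<tau> * damp (\<sigma> r)))"
  note line_diff_borel[OF U s(1), measurable] line_diff_borel[OF U s(2), measurable]
  have Ub[measurable]: "U \<in> sets borel" using U by (rule borel_closed)
  have Nb[measurable]: "N \<in> sets borel" using N(2) by (rule borel_closed)
  have f1b[measurable]: "f1 \<in> borel_measurable borel" unfolding f1_def by measurable
  have f2b[measurable]: "f2 \<in> borel_measurable borel" unfolding f2_def by measurable
  have feb[measurable]: "fe \<in> borel_measurable borel" unfolding fe_def damp_def by measurable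
  define M1 where "M1 = density lborel f1"
  define M2 where "M2 = density lborel f2"
  define Me where "Me = density lborel fe"
  have setsM[simp]: "sets M1 = sets borel" "sets M2 = sets borel" "sets Me = sets borel"
    by (simp_all add: M1_def M2_def Me_def)
  have h25: "25 \<le> h y" if "y \<in> Y" for y using that \<theta> by (simp add: Y_def h_def K_def field_simps)
  have \<sigma>Y: "K \<le> \<sigma> y" if "y \<in> Y" for y using that by (simp add: Y_def)
  have h\<sigma>: "h y \<le> \<sigma> y / 4" if "y \<in> Y" for y
    using \<theta> \<sigma>Y[OF that] K by (simp add: h_def mult_left_le_one_le)
  have AE_N: "AE r in lborel. r \<notin> N" "AE r in lborel. r + t \<notin> N" for t
    using AE_not_in[OF N(1)] AE_shift[OF N(1)] by blast+
  \<comment> \<open>By \<open>one_jump_same_point\<close> no isolated jump lies in the window of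
    another one; hence the half windows \<open>H y\<close> are disjoint.\<close>
  have sep: "max (h y) (h y') \<le> \<bar>y - y'\<bar>" if y: "y \<in> Y" "y' \<in> Y" "y \<noteq> y'" for y y'
  proof -
    have *: "h y \<le> \<bar>y - y'\<bar>" if y: "y \<in> Y" "y' \<in> Y" "y \<noteq> y'" for y y'
    proof (rule ccontr)
      assume "\<not> ?thesis"
      then have lt: "\<bar>y - y'\<bar> < h y" by simp
      obtain c c' where j: "one_jump N s1 {y - h y<..<y + h y} y c c'" using y by (auto simp: Y_def)
      obtain d d' where j': "d \<noteq> d'" "one_jump N s1 {y' - h y'<..<y' + h y'} y' d d'" using y by (auto simp: Y_def)
      have "y = y'" by (rule one_jump_same_point[OF N(1) _ _ lt j j'(2,1)]) (use h25[OF y(1)] h25[OF y(2)] in auto)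
      then show False using y by simp
    qed
    show ?thesis using *[of y y'] *[of y' y] y by (simp add: abs_minus_commute)
  qed
  have cY: "countable Y"
  proof (rule countableI')
    show "inj_on (\<lambda>y. \<lfloor>y\<rfloor>) Y"
    proof (rule inj_onI, rule ccontr)
      fix y y' assume y: "y \<in> Y" "y' \<in> Y" "\<lfloor>y\<rfloor> = \<lfloor>y'\<rfloor>" "y \<noteq> y'"
      have "25 \<le> \<bar>y - y'\<bar>" using sep[OF y(1,2,4)] h25[OF y(1)] by simp
      moreover have "\<bar>y - y'\<bar> < 1" using y(3) by linarith
      ultimately show False by simp
    qed
  qed
  define H where "H = (\<lambda>y. {y - h y / 2<..<y + h y / 2})"
  have Hdis: "disjoint_family_on H Y"
    unfolding disjoint_family_on_def
  proof (intro ballI impI)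
    fix y y' assume y: "y \<in> Y" "y' \<in> Y" "y \<noteq> y'"
    show "H y \<inter> H y' = {}" using sep[OF y] by (auto simp: H_def abs_if split: if_splits)
  qed
  have damp_ge: "1 / (2 * \<sigma> y) \<le> damp (\<sigma> r)" if y: "y \<in> Y" and r: "r \<in> H y" for y r
  proof -
    have "\<bar>\<sigma> r - \<sigma> y\<bar> \<le> h y / 2" using \<sigma>(1)[of r y] r by (auto simp: H_def abs_if split: if_splits)
    then have "\<sigma> r \<le> 2 * \<sigma> y" "1 < \<sigma> r" using h\<sigma>[OF y] \<sigma>Y[OF y] K by (auto simp: abs_if split: if_splits)
    then show ?thesis by (simp add: damp_def field_simps)
  qed
  have match: "\<exists>e. {y - 1 + e<..<y + e} \<subseteq> H y \<and>
      emeasure M1 {y - 1<..<y} \<le> ennreal A * emeasure M2 {y - 1 + e<..<y + e} + ennreal (B * 2 powr \<tau> * (32 / \<theta>)) * emeasure Me (H y)"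
    if y: "y \<in> Y" for y
  proof -
    obtain c c' where c: "one_jump N s1 {y - h y<..<y + h y} y c c'" using y by (auto simp: Y_def)
    have UY: "{y - h y<..<y + h y} \<subseteq> U" using y by (simp add: Y_def)
    have \<sigma>K: "100 / \<theta> \<le> \<sigma> y" using \<sigma>Y[OF y] by (simp add: K_def)
    have hh: "h y = \<theta> / 4 * \<sigma> y" by (simp add: h_def)
    show ?thesis
    proof (rule matched_jump[OF \<theta> N(1) \<sigma>(1) c2 \<sigma>K hh UY])
      fix e d d' l r
      assume e: "\<bar>e\<bar> < h y / 4"
        and d: "\<And>q. q \<in> {y - 1 + e<..<y + e} \<Longrightarrow> q \<notin> N \<Longrightarrow> q + 1 \<notin> N \<Longrightarrow> s2 (q + 1) - s2 q = d' - d"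
        and l: "y - h y / 2 \<le> l" "l + h y / 4 \<le> y" "\<And>q. q \<in> {l<..<l + h y / 4} \<Longrightarrow> q \<notin> N \<Longrightarrow> s2 q = d"
        and r: "y \<le> r" "r + h y / 4 \<le> y + h y / 2" "\<And>q. q \<in> {r<..<r + h y / 4} \<Longrightarrow> q \<notin> N \<Longrightarrow> s2 q = d'"
      note hy = h25[OF y]
      have sl: "s1 q = c" if "q \<in> {y - h y<..<y}" "q \<notin> N" for q using one_jump_left[OF c, of q] that hy by simp
      have sr: "s1 q = c'" if "q \<in> {y<..<y + h y}" "q \<notin> N" for q using one_jump_right[OF c, of q] that hy by simp
      have im: "{y - 1 + e<..<y + e} \<subseteq> H y" using e hy by (auto simp: H_def abs_if split: if_splits)
      have m1: "emeasure M1 {y - 1<..<y} = ennreal (\<bar>c' - c\<bar> powr \<tau>)"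
      proof -
        have "emeasure M1 {y - 1<..<y} = ennreal (\<bar>c' - c\<bar> powr \<tau>) * ennreal (y - (y - 1))"
          unfolding M1_def
        proof (rule emeasure_density_const_interval[OF f1b])
          show "AE q in lborel. y - 1 < q \<and> q < y \<longrightarrow> f1 q = ennreal (\<bar>c' - c\<bar> powr \<tau>)"
            using AE_N(1) AE_N(2)[of 1]
          proof eventually_elim
            case (elim q)
            show ?case
            proof
              assume q: "y - 1 < q \<and> q < y"
              then have "{q..q+1} \<subseteq> U" using UY hy by auto
              moreover have "s1 q = c" "s1 (q + 1) = c'" using sl[of q] sr[of "q + 1"] q hy elim by auto
              ultimately show "f1 q = ennreal (\<bar>c' - c\<bar> powr \<tau>)" by (simp add: f1_def line_diff_def)
            qed
          qed
        qed simp
        then show ?thesis by simp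
      qed
      have m2: "emeasure M2 {y - 1 + e<..<y + e} = ennreal (\<bar>d' - d\<bar> powr \<tau>)"
      proof -
        have "emeasure M2 {y - 1 + e<..<y + e} = ennreal (\<bar>d' - d\<bar> powr \<tau>) * ennreal (y + e - (y - 1 + e))"
          unfolding M2_def
        proof (rule emeasure_density_const_interval[OF f2b])
          show "AE q in lborel. y - 1 + e < q \<and> q < y + e \<longrightarrow> f2 q = ennreal (\<bar>d' - d\<bar> powr \<tau>)"
            using AE_N(1) AE_N(2)[of 1]
          proof eventually_elim
            case (elim q)
            show ?case
            proof
              assume q: "y - 1 + e < q \<and> q < y + e"
              then have "{q..q+1} \<subseteq> U" using UY hy e by (auto simp: abs_if subset_iff split: if_splits)
              moreover have "s2 (q + 1) - s2 q = d' - d" using d[of q] q elim by auto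
              ultimately show "f2 q = ennreal (\<bar>d' - d\<bar> powr \<tau>)" by (simp add: f2_def line_diff_def)
            qed
          qed
        qed simp
        then show ?thesis by simp
      qed
      \<comment> \<open>The interval has length \<open>h y / 4 = \<theta> * \<sigma> y / 16\<close>,
        and \<open>damp\<close> is at least \<open>1 / (2 * \<sigma> y)\<close> on it. In the
        product \<theta>/32 the scale \<sigma> cancels, which is why the error can be paid with the
        weight \<open>damp\<close> at a uniform cost.\<close>
      have err: "ennreal (\<bar>v\<bar> powr \<tau>) \<le> ennreal (32 / \<theta>) * emeasure Me {a<..<a + h y / 4}"
        if a: "{a<..<a + h y / 4} \<subseteq> H y" and v: "\<And>q. q \<in> {a<..<a + h y / 4} \<Longrightarrow> q \<notin> N \<Longrightarrow> s1 q - s2 q = v" for a v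
      proof -
        have pos: "0 < \<sigma> y" using \<sigma>Y[OF y] K by simp
        have "ennreal (\<bar>v\<bar> powr \<tau> / (2 * \<sigma> y)) * ennreal (a + h y / 4 - a)
            = emeasure (density lborel (\<lambda>q. ennreal (\<bar>v\<bar> powr \<tau> / (2 * \<sigma> y)))) {a<..<a + h y / 4}"
          using hy by (intro emeasure_density_const_interval[symmetric]) auto
        also have "\<dots> = (\<integral>\<^sup>+q. ennreal (\<bar>v\<bar> powr \<tau> / (2 * \<sigma> y)) * indicator {a<..<a + h y / 4} q \<partial>lborel)"
          by (intro emeasure_density) auto
        also have "\<dots> \<le> (\<integral>\<^sup>+q. fe q * indicator {a<..<a + h y / 4} q \<partial>lborel)"
        proof (rule nn_integral_mono_AE)
          show "AE q in lborel. ennreal (\<bar>v\<bar> powr \<tau> / (2 * \<sigma> y)) * indicator {a<..<a + h y / 4} q \<le> fe q * indicator {a<..<a + h y / 4} q"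
            using AE_N(1)
          proof eventually_elim
            case (elim q)
            show ?case
            proof (cases "q \<in> {a<..<a + h y / 4}")
              case True
              then have q: "q \<in> H y" using a by blast
              then have "q \<in> U" using UY hy by (auto simp: H_def)
              moreover have "\<bar>v\<bar> powr \<tau> / (2 * \<sigma> y) \<le> \<bar>v\<bar> powr \<tau> * damp (\<sigma> q)"
                using mult_left_mono[OF damp_ge[OF y q], of "\<bar>v\<bar> powr \<tau>"] by simp
              ultimately show ?thesis using v[OF True elim] True by (simp add: fe_def ennreal_leI)
            qed simp
          qed
        qed
        also have "\<dots> = emeasure Me {a<..<a + h y / 4}" unfolding Me_def by (intro emeasure_density[symmetric]) auto
        finally have "ennreal (32 / \<theta>) * (ennreal (\<bar>v\<bar> powr \<tau> / (2 * \<sigma> y)) * ennreal (a + h y / 4 - a)) \<le> ennreal (32 / \<theta>) * emeasure Me {a<..<a + h y / 4}"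
          by (rule mult_left_mono) simp
        moreover have "ennreal (32 / \<theta>) * (ennreal (\<bar>v\<bar> powr \<tau> / (2 * \<sigma> y)) * ennreal (a + h y / 4 - a)) = ennreal (\<bar>v\<bar> powr \<tau>)"
        proof -
          have "32 / \<theta> * (\<bar>v\<bar> powr \<tau> / (2 * \<sigma> y) * (h y / 4)) = \<bar>v\<bar> powr \<tau>"
            using \<theta> pos by (simp add: h_def field_simps)
          then show ?thesis using \<theta> pos hy by (simp add: ennreal_mult[symmetric])
        qed
        ultimately show ?thesis by simp
      qed
      have el: "ennreal (\<bar>c - d\<bar> powr \<tau>) \<le> ennreal (32 / \<theta>) * emeasure Me {l<..<l + h y / 4}"
        by (rule err) (use l sl hy in \<open>auto simp: H_def\<close>)
      have er: "ennreal (\<bar>c' - d'\<bar> powr \<tau>) \<le> ennreal (32 / \<theta>) * emeasure Me {r<..<r + h y / 4}"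
        by (rule err) (use r sr hy in \<open>auto simp: H_def\<close>)
      have "emeasure Me {l<..<l + h y / 4} + emeasure Me {r<..<r + h y / 4} = emeasure Me ({l<..<l + h y / 4} \<union> {r<..<r + h y / 4})"
        using l r by (intro plus_emeasure) auto
      also have "\<dots> \<le> emeasure Me (H y)" using l r hy by (intro emeasure_mono) (auto simp: H_def)
      finally have "ennreal (32 / \<theta>) * (emeasure Me {l<..<l + h y / 4} + emeasure Me {r<..<r + h y / 4}) \<le> ennreal (32 / \<theta>) * emeasure Me (H y)"
        by (rule mult_left_mono) simp
      then have "ennreal (\<bar>c - d\<bar> powr \<tau>) + ennreal (\<bar>c' - d'\<bar> powr \<tau>) \<le> ennreal (32 / \<theta>) * emeasure Me (H y)"
        using add_mono[OF el er] unfolding distrib_left by (rule order_trans[rotated])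
      then have E: "ennreal (B * 2 powr \<tau>) * (ennreal (\<bar>c - d\<bar> powr \<tau>) + ennreal (\<bar>c' - d'\<bar> powr \<tau>)) \<le> ennreal (B * 2 powr \<tau>) * (ennreal (32 / \<theta>) * emeasure Me (H y))"
        by (rule mult_left_mono) simp
      have "\<bar>c' - c\<bar> powr \<tau> \<le> A * \<bar>d' - d\<bar> powr \<tau> + B * 2 powr \<tau> * (\<bar>c - d\<bar> powr \<tau> + \<bar>c' - d'\<bar> powr \<tau>)"
        by (rule split_ineq_three[OF AB \<tau>]) linarith
      then have "ennreal (\<bar>c' - c\<bar> powr \<tau>) \<le> ennreal A * ennreal (\<bar>d' - d\<bar> powr \<tau>) + ennreal (B * 2 powr \<tau>) * (ennreal (\<bar>c - d\<bar> powr \<tau>) + ennreal (\<bar>c' - d'\<bar> powr \<tau>))"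
        using A0 B0 by (simp add: ennreal_mult[symmetric] ennreal_plus[symmetric] ennreal_leI del: ennreal_plus)
      also have "\<dots> \<le> ennreal A * ennreal (\<bar>d' - d\<bar> powr \<tau>) + ennreal (B * 2 powr \<tau>) * (ennreal (32 / \<theta>) * emeasure Me (H y))"
        using E by (rule add_left_mono)
      also have "ennreal (B * 2 powr \<tau>) * (ennreal (32 / \<theta>) * emeasure Me (H y)) = ennreal (B * 2 powr \<tau> * (32 / \<theta>)) * emeasure Me (H y)"
      proof -
        have "ennreal (B * 2 powr \<tau> * (32 / \<theta>)) = ennreal (B * 2 powr \<tau>) * ennreal (32 / \<theta>)"
          using B0 \<theta> by (intro ennreal_mult) auto
        then show ?thesis by (simp only: mult.assoc)
      qed
      finally show ?thesis using im m1 m2 by auto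
    qed
  qed
  then obtain e where e: "\<And>y. y \<in> Y \<Longrightarrow> {y - 1 + e y<..<y + e y} \<subseteq> H y \<and>
      emeasure M1 {y - 1<..<y} \<le> ennreal A * emeasure M2 {y - 1 + e y<..<y + e y} + ennreal (B * 2 powr \<tau> * (32 / \<theta>)) * emeasure Me (H y)"
    by metis
  define im where "im = (\<lambda>y. {y - 1 + e y<..<y + e y})"
  define G where "G = (\<Union>y\<in>Y. {y - 1<..<y})"
  define Im where "Im = (\<Union>y\<in>Y. im y)"
  define Bad where "Bad = {r. line_diff U s1 r \<noteq> 0 \<and> r \<notin> N \<and> r + 1 \<notin> N} - G"
  have Gb[measurable]: "G \<in> sets borel" unfolding G_def by (intro borel_open open_UN) auto
  have Imb[measurable]: "Im \<in> sets borel" unfolding Im_def im_def by (intro borel_open open_UN) auto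
  have Badb[measurable]: "Bad \<in> sets borel"
  proof -
    have "Measurable.pred borel (\<lambda>r. line_diff U s1 r \<noteq> 0 \<and> r \<notin> N \<and> r + 1 \<notin> N)" by measurable
    then show ?thesis unfolding Bad_def by (intro sets.Diff Gb) (simp add: pred_def)
  qed
  have subH: "{y - 1<..<y} \<subseteq> H y" "im y \<subseteq> H y" if "y \<in> Y" for y
    using e[OF that] h25[OF that] by (auto simp: H_def im_def)
  have dis: "disjoint_family_on X Y" if "\<And>y. y \<in> Y \<Longrightarrow> X y \<subseteq> H y" for X
    using Hdis that unfolding disjoint_family_on_def by blast
  have good: "emeasure M1 G \<le> ennreal A * emeasure M2 Im + ennreal (B * 2 powr \<tau> * (32 / \<theta>)) * emeasure Me UNIV"
  proof -
    have "emeasure M1 G = (\<integral>\<^sup>+y. emeasure M1 {y - 1<..<y} \<partial>count_space Y)"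
      unfolding G_def by (intro emeasure_UN_countable cY dis subH(1)) auto
    also have "\<dots> \<le> (\<integral>\<^sup>+y. ennreal A * emeasure M2 (im y) + ennreal (B * 2 powr \<tau> * (32 / \<theta>)) * emeasure Me (H y) \<partial>count_space Y)"
      using e by (intro nn_integral_mono) (auto simp: im_def)
    also have "\<dots> = ennreal A * (\<integral>\<^sup>+y. emeasure M2 (im y) \<partial>count_space Y) + ennreal (B * 2 powr \<tau> * (32 / \<theta>)) * (\<integral>\<^sup>+y. emeasure Me (H y) \<partial>count_space Y)"
      by (simp add: nn_integral_add nn_integral_cmult)
    also have "(\<integral>\<^sup>+y. emeasure M2 (im y) \<partial>count_space Y) = emeasure M2 Im"
      unfolding Im_def by (intro emeasure_UN_countable[symmetric] cY dis subH(2)) (auto simp: im_def)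
    also have "(\<integral>\<^sup>+y. emeasure Me (H y) \<partial>count_space Y) = emeasure Me (\<Union>y\<in>Y. H y)"
      by (intro emeasure_UN_countable[symmetric] cY Hdis) (auto simp: H_def)
    also have "emeasure Me (\<Union>y\<in>Y. H y) \<le> emeasure Me UNIV"
      by (intro emeasure_mono) (auto simp: Me_def)
    finally show ?thesis by (simp add: add_left_mono mult_left_mono)
  qed
  have bad: "\<sigma> r < K + 1" "{r..r+1} \<subseteq> U" "r \<notin> Im" if r: "r \<in> Bad" for r
  proof -
    have rN: "r \<notin> N" "r + 1 \<notin> N" "r \<notin> G" using r by (auto simp: Bad_def)
    show rU: "{r..r+1} \<subseteq> U" using r by (auto simp: Bad_def line_diff_def split: if_splits)
    have ne: "s1 r \<noteq> s1 (r + 1)" using r rU by (auto simp: Bad_def line_diff_def)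
    \<comment> \<open>A start with large \<sigma> crosses a jump of \<open>s1\<close> that is
      isolated and belongs to \<open>Y\<close>, which would put \<open>r\<close> into
      \<open>G\<close>.\<close>
    show "\<sigma> r < K + 1"
    proof (rule ccontr)
      assume "\<not> ?thesis"
      then have \<sigma>r: "K + 1 \<le> \<sigma> r" by simp
      then have \<theta>\<sigma>: "100 \<le> \<theta> * \<sigma> r" using \<theta> mult_left_mono[of K "\<sigma> r" \<theta>] by (simp add: K_def)
      have "closed_segment r (r + 1) \<subseteq> U" using rU by (simp add: closed_segment_eq_real_ivl)
      then have "{r - \<theta> * \<sigma> r<..<r + \<theta> * \<sigma> r} \<subseteq> U \<and> (\<exists>y c c'. one_jump N s1 {r - \<theta> * \<sigma> r<..<r + \<theta> * \<sigma> r} y c c')"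
        using c1[unfolded jump_controlled_def, rule_format, of r "r + 1"] rN ne \<theta>\<sigma> by auto
      then obtain y c c' where j: "{r - \<theta> * \<sigma> r<..<r + \<theta> * \<sigma> r} \<subseteq> U" "one_jump N s1 {r - \<theta> * \<sigma> r<..<r + \<theta> * \<sigma> r} y c c'" by blast
      have y: "r < y" "y < r + 1" "c \<noteq> c'" using one_jump_between[OF j(2), of r "r + 1"] rN ne \<theta>\<sigma> by auto
      have \<sigma>y: "\<sigma> r - 1 \<le> \<sigma> y" "\<sigma> y \<le> \<sigma> r + 1" using \<sigma>(1)[of r y] y by (auto simp: abs_if split: if_splits)
      have "h y \<le> \<theta> / 4 * (2 * \<sigma> r)" unfolding h_def using \<theta> \<sigma>y \<sigma>r K by (intro mult_left_mono) auto
      then have hy: "h y \<le> \<theta> * \<sigma> r / 2" by simp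
      have sub: "{y - h y<..<y + h y} \<subseteq> {r - \<theta> * \<sigma> r<..<r + \<theta> * \<sigma> r}" using hy y \<theta>\<sigma> by auto
      then have "one_jump N s1 {y - h y<..<y + h y} y c c'" using j(2) unfolding one_jump_def by blast
      moreover have "K \<le> \<sigma> y" using \<sigma>y \<sigma>r by simp
      ultimately have "y \<in> Y" using sub j(1) y(3) unfolding Y_def by blast
      then show False using rN(3) y unfolding G_def by force
    qed
    \<comment> \<open>Near \<open>H y\<close> the function \<open>s1\<close> changes only at
      \<open>y\<close>, so a nonzero difference starting there crosses \<open>y\<close> and starts
      in \<open>G\<close>.\<close>
    show "r \<notin> Im"
    proof
      assume "r \<in> Im"
      then obtain y where y: "y \<in> Y" "r \<in> H y" using subH(2) unfolding Im_def by blast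
      obtain c c' where j: "one_jump N s1 {y - h y<..<y + h y} y c c'" using y by (auto simp: Y_def)
      have "r \<in> {y - h y<..<y + h y} - N" "r + 1 \<in> {y - h y<..<y + h y} - N"
        using y rN h25[OF y(1)] by (auto simp: H_def)
      then have "r < y" "y < r + 1" using one_jump_between[OF j, of r "r + 1"] ne by auto
      then show False using rN(3) y(1) unfolding G_def by force
    qed
  qed
  \<comment> \<open>The bound is \<open>K + 2\<close> because \<sigma> may grow by 1 from
    \<open>r\<close> to \<open>r + 1\<close>.\<close>
  have damp_bad: "1 \<le> (K + 2) * damp x" if "x < K + 2" for x
    using that K by (auto simp: damp_def field_simps)
  have badI: "emeasure M1 Bad \<le> ennreal A * emeasure M2 Bad + ennreal (B * 2 powr \<tau> * (K + 2)) * (2 * emeasure Me UNIV)"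
  proof -
    let ?k = "B * 2 powr \<tau> * (K + 2)"
    have k0: "0 \<le> ?k" using B0 K by simp
    have "emeasure M1 Bad = (\<integral>\<^sup>+r. f1 r * indicator Bad r \<partial>lborel)" unfolding M1_def by (intro emeasure_density) auto
    also have "\<dots> \<le> (\<integral>\<^sup>+r. ennreal A * (f2 r * indicator Bad r) + ennreal ?k * (fe r + fe (r + 1)) \<partial>lborel)"
    proof (rule nn_integral_mono)
      fix r
      show "f1 r * indicator Bad r \<le> ennreal A * (f2 r * indicator Bad r) + ennreal ?k * (fe r + fe (r + 1))"
      proof (cases "r \<in> Bad")
        case True
        note b = bad[OF True]
        have U: "r \<in> U" "r + 1 \<in> U" using b(2) by auto
        have "\<bar>line_diff U s1 r\<bar> \<le> \<bar>line_diff U s2 r\<bar> + (\<bar>s1 r - s2 r\<bar> + \<bar>s1 (r + 1) - s2 (r + 1)\<bar>)"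
          using b(2) by (simp add: line_diff_def)
        from split_ineq_three[OF AB \<tau> this]
        have "\<bar>line_diff U s1 r\<bar> powr \<tau> \<le> A * \<bar>line_diff U s2 r\<bar> powr \<tau> + B * 2 powr \<tau> * (\<bar>s1 r - s2 r\<bar> powr \<tau> + \<bar>s1 (r + 1) - s2 (r + 1)\<bar> powr \<tau>)" .
        also have "\<dots> \<le> A * \<bar>line_diff U s2 r\<bar> powr \<tau> + B * 2 powr \<tau> *
            (\<bar>s1 r - s2 r\<bar> powr \<tau> * ((K + 2) * damp (\<sigma> r)) + \<bar>s1 (r + 1) - s2 (r + 1)\<bar> powr \<tau> * ((K + 2) * damp (\<sigma> (r + 1))))"
        proof (intro add_left_mono mult_left_mono add_mono)
          have g: "x \<le> x * ((K + 2) * damp t)" if "t < K + 2" "0 \<le> x" for x t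
            using mult_left_mono[OF damp_bad[OF that(1)] that(2)] by simp
          show "\<bar>s1 r - s2 r\<bar> powr \<tau> \<le> \<bar>s1 r - s2 r\<bar> powr \<tau> * ((K + 2) * damp (\<sigma> r))" using b(1) by (intro g) auto
          have "\<sigma> (r + 1) < K + 2" using \<sigma>(1)[of "r + 1" r] b(1) by (simp add: abs_if split: if_splits)
          then show "\<bar>s1 (r + 1) - s2 (r + 1)\<bar> powr \<tau> \<le> \<bar>s1 (r + 1) - s2 (r + 1)\<bar> powr \<tau> * ((K + 2) * damp (\<sigma> (r + 1)))" by (intro g) auto
          show "0 \<le> B * 2 powr \<tau>" using B0 by simp
        qed
        also have "\<dots> = A * \<bar>line_diff U s2 r\<bar> powr \<tau> + ?k * (\<bar>s1 r - s2 r\<bar> powr \<tau> * damp (\<sigma> r) + \<bar>s1 (r + 1) - s2 (r + 1)\<bar> powr \<tau> * damp (\<sigma> (r + 1)))"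
          by (simp add: algebra_simps)
        finally have le: "\<bar>line_diff U s1 r\<bar> powr \<tau> \<le> \<dots>" .
        have dp: "0 \<le> damp x" for x by (simp add: damp_def)
        have "f1 r \<le> ennreal (A * \<bar>line_diff U s2 r\<bar> powr \<tau> + ?k * (\<bar>s1 r - s2 r\<bar> powr \<tau> * damp (\<sigma> r) + \<bar>s1 (r + 1) - s2 (r + 1)\<bar> powr \<tau> * damp (\<sigma> (r + 1))))"
          unfolding f1_def by (rule ennreal_leI[OF le])
        also have "\<dots> = ennreal A * f2 r + ennreal ?k * (fe r + fe (r + 1))"
        proof -
          have "fe r + fe (r + 1) = ennreal (\<bar>s1 r - s2 r\<bar> powr \<tau> * damp (\<sigma> r) + \<bar>s1 (r + 1) - s2 (r + 1)\<bar> powr \<tau> * damp (\<sigma> (r + 1)))"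
            using U dp by (simp add: fe_def ennreal_plus)
          then show ?thesis using A0 k0 dp by (simp only: f2_def) (subst ennreal_plus, auto simp: ennreal_mult)
        qed
        finally show ?thesis using True by simp
      qed simp
    qed
    also have "\<dots> = ennreal A * (\<integral>\<^sup>+r. f2 r * indicator Bad r \<partial>lborel) + ennreal ?k * ((\<integral>\<^sup>+r. fe r \<partial>lborel) + (\<integral>\<^sup>+r. fe (r + 1) \<partial>lborel))"
      by (simp add: nn_integral_add nn_integral_cmult)
    also have "(\<integral>\<^sup>+r. fe (r + 1) \<partial>lborel) = (\<integral>\<^sup>+r. fe r \<partial>lborel)"
    proof -
      have "(\<integral>\<^sup>+r. fe r \<partial>lborel) = (\<integral>\<^sup>+r. fe r \<partial>distr lborel borel ((+) 1))" by (simp add: lborel_distr_plus)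
      also have "\<dots> = (\<integral>\<^sup>+r. fe (1 + r) \<partial>lborel)" by (rule nn_integral_distr) auto
      finally show ?thesis by (simp add: add.commute)
    qed
    also have "(\<integral>\<^sup>+r. fe r \<partial>lborel) = emeasure Me UNIV" unfolding Me_def by (simp add: emeasure_density)
    also have "(\<integral>\<^sup>+r. f2 r * indicator Bad r \<partial>lborel) = emeasure M2 Bad" unfolding M2_def by (intro emeasure_density[symmetric]) auto
    finally show ?thesis by (simp only: mult_2)
  qed
  have "(\<integral>\<^sup>+r. f1 r \<partial>lborel) \<le> (\<integral>\<^sup>+r. f1 r * indicator (G \<union> Bad) r \<partial>lborel)"
  proof (rule nn_integral_mono_AE)
    show "AE r in lborel. f1 r \<le> f1 r * indicator (G \<union> Bad) r"
      using AE_N(1) AE_N(2)[of 1]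
    proof eventually_elim
      case (elim r)
      show ?case
      proof (cases "r \<in> G \<union> Bad")
        case False
        then have "line_diff U s1 r = 0" using elim by (auto simp: Bad_def)
        then show ?thesis by (simp add: f1_def)
      qed simp
    qed
  qed
  also have "\<dots> = emeasure M1 (G \<union> Bad)" unfolding M1_def by (intro emeasure_density[symmetric]) auto
  also have "\<dots> \<le> emeasure M1 G + emeasure M1 Bad" by (intro emeasure_subadditive) auto
  also have "\<dots> \<le> (ennreal A * emeasure M2 Im + ennreal (B * 2 powr \<tau> * (32 / \<theta>)) * emeasure Me UNIV)
      + (ennreal A * emeasure M2 Bad + ennreal (B * 2 powr \<tau> * (K + 2)) * (2 * emeasure Me UNIV))"
    by (rule add_mono[OF good badI])
  also have "\<dots> = ennreal A * (emeasure M2 Im + emeasure M2 Bad) + (ennreal (B * 2 powr \<tau> * (32 / \<theta>)) + ennreal (B * 2 powr \<tau> * (K + 2)) * 2) * emeasure Me UNIV"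
    by (simp add: distrib_left distrib_right mult.assoc add_ac)
  also have "emeasure M2 Im + emeasure M2 Bad = emeasure M2 (Im \<union> Bad)"
    using bad(3) by (intro plus_emeasure) auto
  also have "\<dots> \<le> emeasure M2 UNIV" by (intro emeasure_mono) (auto simp: M2_def)
  \<comment> \<open>The sum \<open>32 / \<theta> + 2 * (K + 2)\<close> is at most
    \<open>236 / \<theta>\<close>; 1000 is a round bound.\<close>
  also have "ennreal (B * 2 powr \<tau> * (32 / \<theta>)) + ennreal (B * 2 powr \<tau> * (K + 2)) * 2 \<le> ennreal (B * 2 powr \<tau> * (1000 / \<theta>))"
  proof -
    have "ennreal (B * 2 powr \<tau> * (32 / \<theta>)) + ennreal (B * 2 powr \<tau> * (K + 2)) * 2
       = ennreal (B * 2 powr \<tau> * (32 / \<theta> + 2 * (K + 2)))"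
    proof -
      have "ennreal (B * 2 powr \<tau> * (K + 2)) * 2 = ennreal (B * 2 powr \<tau> * (2 * (K + 2)))"
        using B0 K by (simp add: ennreal_mult'[of _ 2, simplified, symmetric] mult_ac flip: ennreal_numeral ennreal_mult)
      then show ?thesis using B0 K \<theta> by (simp add: ennreal_plus[symmetric] distrib_left del: ennreal_plus)
    qed
    also have "\<dots> \<le> ennreal (B * 2 powr \<tau> * (1000 / \<theta>))"
      using B0 \<theta> by (intro ennreal_leI mult_left_mono) (auto simp: K_def field_simps)
    finally show ?thesis .
  qed
  finally have "(\<integral>\<^sup>+r. f1 r \<partial>lborel) \<le> ennreal A * emeasure M2 UNIV + ennreal (B * 2 powr \<tau> * (1000 / \<theta>)) * emeasure Me UNIV"
    by (simp add: add_mono mult_left_mono mult_right_mono)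
  moreover have "emeasure M2 UNIV = (\<integral>\<^sup>+r. f2 r \<partial>lborel)" unfolding M2_def by (simp add: emeasure_density)
  moreover have "emeasure Me UNIV = (\<integral>\<^sup>+r. fe r \<partial>lborel)" unfolding Me_def by (simp add: emeasure_density)
  ultimately show ?thesis by (simp add: f1_def f2_def fe_def)
qed

section \<open>Differences in the plane\<close>

lemma nn_integral_lborel_shift:
  fixes f :: "'a::euclidean_space \<Rightarrow> ennreal"
  assumes "f \<in> borel_measurable borel"
  shows "(\<integral>\<^sup>+x. f (x + c) \<partial>lborel) = (\<integral>\<^sup>+x. f x \<partial>lborel)"
proof -
  have "(\<integral>\<^sup>+x. f x \<partial>lborel) = (\<integral>\<^sup>+x. f x \<partial>distr lborel borel ((+) c))" by (simp add: lborel_distr_plus)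
  also have "\<dots> = (\<integral>\<^sup>+x. f (c + x) \<partial>lborel)" using assms by (intro nn_integral_distr) auto
  finally show ?thesis by (simp add: add.commute)
qed

text \<open>Instead of rotating coordinates, base points are taken from the strip where the
  component along \<open>h\<close> lies in \<open>[0, 1)\<close>. By translation invariance, each
  \<open>x\<close> is reached from the strip by a set of parameters \<open>r\<close> of length
  exactly 1.\<close>

lemma nn_integral_along_lines:
  fixes F :: "'a::euclidean_space \<Rightarrow> ennreal"
  assumes F[measurable]: "F \<in> borel_measurable borel" and h: "h \<noteq> 0"
  shows "(\<integral>\<^sup>+x. F x \<partial>lborel) =
    (\<integral>\<^sup>+x. indicator {0..<1::real} ((x \<bullet> h) / (h \<bullet> h)) * (\<integral>\<^sup>+r. F (x + r *\<^sub>R h) \<partial>lborel) \<partial>lborel)"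
proof -
  define \<phi> where "\<phi> = (\<lambda>x. (x \<bullet> h) / (h \<bullet> h))"
  have hh: "h \<bullet> h \<noteq> 0" using h by simp
  have \<phi>[measurable]: "\<phi> \<in> borel_measurable borel" unfolding \<phi>_def by measurable
  have \<phi>_line: "\<phi> (x + r *\<^sub>R h) = \<phi> x + r" for x r
    using hh by (simp add: \<phi>_def inner_add_left field_simps)
  have line: "(\<lambda>r. F (x + r *\<^sub>R h)) \<in> borel_measurable lborel" for x by measurable
  have "(\<integral>\<^sup>+x. indicator {0..<1} (\<phi> x) * (\<integral>\<^sup>+r. F (x + r *\<^sub>R h) \<partial>lborel) \<partial>lborel)
      = (\<integral>\<^sup>+x. (\<integral>\<^sup>+r. indicator {0..<1} (\<phi> x) * F (x + r *\<^sub>R h) \<partial>lborel) \<partial>lborel)"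
    by (intro nn_integral_cong nn_integral_cmult[symmetric] line)
  also have "\<dots> = (\<integral>\<^sup>+r. (\<integral>\<^sup>+x. indicator {0..<1} (\<phi> x) * F (x + r *\<^sub>R h) \<partial>lborel) \<partial>lborel)"
    by (rule lborel_pair.Fubini') measurable
  also have "\<dots> = (\<integral>\<^sup>+r. (\<integral>\<^sup>+x. indicator {0..<1} (\<phi> x - r) * F x \<partial>lborel) \<partial>lborel)"
  proof (rule nn_integral_cong)
    fix r :: real
    have "(\<integral>\<^sup>+x. indicator {0..<1} (\<phi> (x + r *\<^sub>R h) - r) * F (x + r *\<^sub>R h) \<partial>lborel) = (\<integral>\<^sup>+x. indicator {0..<1} (\<phi> x - r) * F x \<partial>lborel)"
      by (rule nn_integral_lborel_shift) measurable
    then show "(\<integral>\<^sup>+x. indicator {0..<1} (\<phi> x) * F (x + r *\<^sub>R h) \<partial>lborel) = (\<integral>\<^sup>+x. indicator {0..<1} (\<phi> x - r) * F x \<partial>lborel)"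
      by (simp add: \<phi>_line)
  qed
  also have "\<dots> = (\<integral>\<^sup>+x. (\<integral>\<^sup>+r. indicator {0..<1} (\<phi> x - r) * F x \<partial>lborel) \<partial>lborel)"
    by (rule lborel_pair.Fubini'[symmetric]) measurable
  also have "\<dots> = (\<integral>\<^sup>+x. F x \<partial>lborel)"
  proof (rule nn_integral_cong)
    fix x
    have "(\<integral>\<^sup>+r. indicator {0..<1} (\<phi> x - r) * F x \<partial>lborel) = (\<integral>\<^sup>+r. F x * indicator {\<phi> x - 1<..\<phi> x} r \<partial>lborel)"
      by (intro nn_integral_cong) (auto simp: indicator_def)
    also have "\<dots> = F x * emeasure lborel {\<phi> x - 1<..\<phi> x}" by (intro nn_integral_cmult_indicator) auto
    finally show "(\<integral>\<^sup>+r. indicator {0..<1} (\<phi> x - r) * F x \<partial>lborel) = F x" by simp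
  qed
  finally show ?thesis by (simp add: \<phi>_def)
qed

lemma null_set_along_lines:
  fixes N :: "'a::euclidean_space set"
  assumes N: "N \<in> null_sets lborel" "N \<in> sets borel" and h: "h \<noteq> 0"
  shows "AE x in lborel. 0 \<le> (x \<bullet> h) / (h \<bullet> h) \<and> (x \<bullet> h) / (h \<bullet> h) < 1 \<longrightarrow> {r. x + r *\<^sub>R h \<in> N} \<in> null_sets lborel"
proof -
  note N(2)[measurable]
  have lineN: "{r. x + r *\<^sub>R h \<in> N} \<in> sets borel" for x
  proof -
    have "Measurable.pred borel (\<lambda>r. x + r *\<^sub>R h \<in> N)" by measurable
    then show ?thesis by (simp add: pred_def)
  qed
  have "(\<integral>\<^sup>+x. indicator {0..<1::real} ((x \<bullet> h) / (h \<bullet> h)) * (\<integral>\<^sup>+r. indicator N (x + r *\<^sub>R h) \<partial>lborel) \<partial>lborel) = (\<integral>\<^sup>+x. indicator N x \<partial>lborel)"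
    by (rule nn_integral_along_lines[symmetric, OF _ h]) measurable
  also have "\<dots> = 0" using N by (simp add: null_setsD1)
  finally have "AE x in lborel. indicator {0..<1::real} ((x \<bullet> h) / (h \<bullet> h)) * (\<integral>\<^sup>+r. indicator N (x + r *\<^sub>R h) \<partial>lborel) = 0"
    by (subst (asm) nn_integral_0_iff_AE) measurable
  then show ?thesis
  proof eventually_elim
    case (elim x)
    show ?case
    proof
      assume "0 \<le> (x \<bullet> h) / (h \<bullet> h) \<and> (x \<bullet> h) / (h \<bullet> h) < 1"
      then have "(\<integral>\<^sup>+r. indicator N (x + r *\<^sub>R h) \<partial>lborel) = 0" using elim by (auto simp: indicator_def)
      moreover have "(\<integral>\<^sup>+r. indicator N (x + r *\<^sub>R h) \<partial>lborel) = (\<integral>\<^sup>+r. indicator {r. x + r *\<^sub>R h \<in> N} r \<partial>lborel)"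
        by (intro nn_integral_cong) (auto simp: indicator_def)
      ultimately show "{r. x + r *\<^sub>R h \<in> N} \<in> null_sets lborel" using lineN by (simp add: null_sets_def)
    qed
  qed
qed

lemma line_segment_image:
  fixes x h :: "'a::real_vector"
  shows "closed_segment (x + r *\<^sub>R h) (x + r' *\<^sub>R h) = (\<lambda>q. x + q *\<^sub>R h) ` closed_segment r r'"
proof -
  have "linear (\<lambda>q. q *\<^sub>R h)" by (auto intro!: linearI simp: algebra_simps)
  then have "(\<lambda>q. q *\<^sub>R h) ` closed_segment r r' = closed_segment (r *\<^sub>R h) (r' *\<^sub>R h)"
    by (rule closed_segment_linear_image[symmetric])
  then have "closed_segment (x + r *\<^sub>R h) (x + r' *\<^sub>R h) = (\<lambda>y. x + y) ` ((\<lambda>q. q *\<^sub>R h) ` closed_segment r r')"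
    by (simp only: closed_segment_translation)
  then show ?thesis by (simp only: image_image)
qed

text \<open>The side of the interface, \<open>(z - y) \<bullet> \<nu>\<close>, is an affine function
  of the parameter. Its slope is nonzero because \<open>S\<close> differs at \<open>r\<close> and
  \<open>r'\<close>, so the interface is crossed at a single parameter.\<close>

lemma jump_controlled_line:
  fixes S :: "pt \<Rightarrow> real"
  assumes T: "cell_tiling \<kappa> V I D \<Omega>" and \<kappa>: "0 < \<kappa>" "\<kappa> \<le> 1"
    and S: "S = (\<lambda>x. \<Sum>i\<in>I. c i * indicator (D i) x)" and N: "(\<Union>i\<in>I. frontier (D i)) \<subseteq> N" and h: "h \<noteq> 0"
  shows "jump_controlled (\<kappa> / 4) {r. x0 + r *\<^sub>R h \<in> \<Omega>} {r. x0 + r *\<^sub>R h \<in> N}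
     (\<lambda>r. infdist (x0 + r *\<^sub>R h) V / norm h) (\<lambda>r. S (x0 + r *\<^sub>R h))"
  unfolding jump_controlled_def
proof (intro allI impI)
  fix r r' :: real
  let ?g = "\<lambda>q. x0 + q *\<^sub>R h"
  let ?R = "\<kappa> / 4 * (infdist (?g r) V / norm h)"
  assume r: "r \<notin> {r. ?g r \<in> N}" "r' \<notin> {r. ?g r \<in> N}" and seg: "closed_segment r r' \<subseteq> {r. ?g r \<in> \<Omega>}"
    and lt: "\<bar>r - r'\<bar> < ?R" and ne: "S (?g r) \<noteq> S (?g r')"
  have hp: "norm h > 0" using h by simp
  have dist: "dist (?g r) (?g q) = \<bar>r - q\<bar> * norm h" for q
  proof -
    have "?g r - ?g q = (r - q) *\<^sub>R h" by (simp add: algebra_simps)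
    then show ?thesis by (simp add: dist_norm)
  qed
  have ball: "?g q \<in> ball (?g r) (\<kappa> / 4 * infdist (?g r) V) \<longleftrightarrow> \<bar>r - q\<bar> < ?R" for q
    using hp by (simp add: dist pos_less_divide_eq mult_ac)
  have nN: "?g r \<notin> (\<Union>i\<in>I. frontier (D i))" "?g r' \<notin> (\<Union>i\<in>I. frontier (D i))" using r N by blast+
  have sg: "closed_segment (?g r) (?g r') \<subseteq> \<Omega>" unfolding line_segment_image using seg by auto
  have dl: "dist (?g r) (?g r') < \<kappa> / 4 * infdist (?g r) V" using ball[of r'] lt by simp
  show "{r - ?R<..<r + ?R} \<subseteq> {r. ?g r \<in> \<Omega>} \<and>
    (\<exists>z d d'. one_jump {r. ?g r \<in> N} (\<lambda>r. S (?g r)) {r - ?R<..<r + ?R} z d d')"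
  proof (rule step_function_two_phase[OF T \<kappa> S refl nN sg dl ne])
    fix y \<nu> c1 c2
    assume y: "ball (?g r) (\<kappa> / 4 * infdist (?g r) V) \<subseteq> \<Omega>" "norm \<nu> = 1"
      "\<And>z. z \<in> ball (?g r) (\<kappa> / 4 * infdist (?g r) V) - (\<Union>i\<in>I. frontier (D i)) \<Longrightarrow>
        (0 < (z - y) \<bullet> \<nu> \<and> S z = c1) \<or> ((z - y) \<bullet> \<nu> < 0 \<and> S z = c2)"
    define \<alpha> where "\<alpha> = h \<bullet> \<nu>"
    define b where "b = (x0 - y) \<bullet> \<nu>"
    have eq: "(?g q - y) \<bullet> \<nu> = \<alpha> * q + b" for q by (simp add: \<alpha>_def b_def inner_add_left inner_diff_left)
    have phase: "(0 < \<alpha> * q + b \<and> S (?g q) = c1) \<or> (\<alpha> * q + b < 0 \<and> S (?g q) = c2)"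
      if "\<bar>r - q\<bar> < ?R" "?g q \<notin> N" for q
      using y(3)[of "?g q"] ball[of q] that N unfolding eq by blast
    have "0 < ?R" using lt by linarith
    then have "\<alpha> \<noteq> 0" using phase[of r] phase[of r'] lt r ne by auto
    have iv: "q \<in> {r - ?R<..<r + ?R} \<longleftrightarrow> \<bar>r - q\<bar> < ?R" for q by (auto simp: abs_if)
    have "{r - ?R<..<r + ?R} \<subseteq> {r. ?g r \<in> \<Omega>}" using iv ball y(1) by blast
    moreover have "\<exists>z d d'. one_jump {r. ?g r \<in> N} (\<lambda>r. S (?g r)) {r - ?R<..<r + ?R} z d d'"
    proof (cases "0 < \<alpha>")
      case True
      have s: "0 < \<alpha> * q + b \<longleftrightarrow> - b / \<alpha> < q" "\<alpha> * q + b < 0 \<longleftrightarrow> q < - b / \<alpha>" for q using True by (auto simp: field_simps)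
      have "one_jump {r. ?g r \<in> N} (\<lambda>r. S (?g r)) {r - ?R<..<r + ?R} (- b / \<alpha>) c2 c1"
        unfolding one_jump_def
      proof
        fix q assume q: "q \<in> {r - ?R<..<r + ?R} - {r. ?g r \<in> N}"
        then have "\<bar>r - q\<bar> < ?R" "?g q \<notin> N" using iv by blast+
        then show "(q < - b / \<alpha> \<and> S (?g q) = c2) \<or> (- b / \<alpha> < q \<and> S (?g q) = c1)" using phase[of q] s[of q] by blast
      qed
      then show ?thesis by blast
    next
      case False
      then have "\<alpha> < 0" using \<open>\<alpha> \<noteq> 0\<close> by simp
      then have s: "0 < \<alpha> * q + b \<longleftrightarrow> q < - b / \<alpha>" "\<alpha> * q + b < 0 \<longleftrightarrow> - b / \<alpha> < q" for q by (auto simp: field_simps)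
      have "one_jump {r. ?g r \<in> N} (\<lambda>r. S (?g r)) {r - ?R<..<r + ?R} (- b / \<alpha>) c1 c2"
        unfolding one_jump_def
      proof
        fix q assume q: "q \<in> {r - ?R<..<r + ?R} - {r. ?g r \<in> N}"
        then have "\<bar>r - q\<bar> < ?R" "?g q \<notin> N" using iv by blast+
        then show "(q < - b / \<alpha> \<and> S (?g q) = c1) \<or> (- b / \<alpha> < q \<and> S (?g q) = c2)" using phase[of q] s[of q] by blast
      qed
      then show ?thesis by blast
    qed
    ultimately show "{r - ?R<..<r + ?R} \<subseteq> {r. ?g r \<in> \<Omega>} \<and>
      (\<exists>z d d'. one_jump {r. ?g r \<in> N} (\<lambda>r. S (?g r)) {r - ?R<..<r + ?R} z d d')" by blast
  qed
qed

section \<open>From lines back to the plane\<close>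

lemma kdiff_1: "kdiff \<Omega> 1 h f x = (if closed_segment x (x + h) \<subseteq> \<Omega> then f (x + h) - f x else 0)"
proof -
  have "{..1::nat} = {0, 1}" by auto
  then show ?thesis by (simp add: kdiff_def)
qed

lemma kdiff_borel:
  assumes \<Omega>: "closed \<Omega>" and f: "f \<in> borel_measurable borel"
  shows "kdiff \<Omega> 1 h f \<in> borel_measurable borel"
proof -
  have "{x. closed_segment x (x + h) \<subseteq> \<Omega>} = (\<Inter>t\<in>{0..1}. {x. x + t *\<^sub>R h \<in> \<Omega>})"
  proof -
    have "closed_segment x (x + h) = (\<lambda>t. x + t *\<^sub>R h) ` {0..1}" for x
      using line_segment_image[of x 0 h 1] by (simp add: closed_segment_eq_real_ivl)
    then show ?thesis by auto
  qed
  moreover have "closed {x. x + t *\<^sub>R h \<in> \<Omega>}" for t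
  proof -
    have "closed ((\<lambda>x. x + t *\<^sub>R h) -` \<Omega>)" by (intro closed_vimage \<Omega> continuous_intros)
    then show ?thesis by (simp add: vimage_def)
  qed
  ultimately have "closed {x. closed_segment x (x + h) \<subseteq> \<Omega>}" by auto
  then have [measurable]: "{x. closed_segment x (x + h) \<subseteq> \<Omega>} \<in> sets borel" by (rule borel_closed)
  note f[measurable]
  have "kdiff \<Omega> 1 h f = (\<lambda>x. if x \<in> {x. closed_segment x (x + h) \<subseteq> \<Omega>} then f (x + h) - f x else 0)"
    by (rule ext) (simp add: kdiff_1 del: One_nat_def)
  also have "\<dots> \<in> borel_measurable borel" by measurable
  finally show ?thesis .
qed

lemma kdiff_on_line:
  "kdiff \<Omega> 1 h f (x0 + r *\<^sub>R h) = line_diff {r. x0 + r *\<^sub>R h \<in> \<Omega>} (\<lambda>r. f (x0 + r *\<^sub>R h)) r"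
proof -
  have e: "x0 + r *\<^sub>R h + h = x0 + (r + 1) *\<^sub>R h" by (simp add: algebra_simps)
  have "closed_segment (x0 + r *\<^sub>R h) (x0 + (r + 1) *\<^sub>R h) \<subseteq> \<Omega> \<longleftrightarrow> {r..r+1} \<subseteq> {r. x0 + r *\<^sub>R h \<in> \<Omega>}"
    unfolding line_segment_image by (auto simp: closed_segment_eq_real_ivl)
  then show ?thesis unfolding kdiff_1 e line_diff_def by simp
qed

lemma damp_antimono:
  assumes "x \<le> y" shows "damp y \<le> damp x"
  using assms by (auto simp: damp_def frac_le divide_simps)

text \<open>The line estimate with \<open>\<theta> = \<kappa> / 4\<close>, whence the constant
  \<open>4000 / \<kappa>\<close>, is integrated over the strip of base points. As
  \<open>damp\<close> is antitone, \<open>norm h\<close> may be replaced by \<open>t\<close> in the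
  error, which then no longer depends on \<open>h\<close> and survives the supremum in the
  modulus.\<close>

lemma difference_inequality:
  fixes S1 S2 :: "pt \<Rightarrow> real"
  assumes T1: "cell_tiling \<kappa> V I1 D1 \<Omega>" and T2: "cell_tiling \<kappa> V I2 D2 \<Omega>" and \<kappa>: "0 < \<kappa>" "\<kappa> \<le> 1"
    and S1: "S1 = (\<lambda>x. \<Sum>i\<in>I1. c1 i * indicator (D1 i) x)" and S2: "S2 = (\<lambda>x. \<Sum>i\<in>I2. c2 i * indicator (D2 i) x)"
    and \<tau>: "0 < \<tau>" and AB: "split_ineq \<tau> A B" and h: "norm h \<le> t" and t: "0 < t"
  shows "(\<integral>\<^sup>+x. ennreal (\<bar>kdiff \<Omega> 1 h S1 x\<bar> powr \<tau>) \<partial>lborel)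
    \<le> ennreal A * (\<integral>\<^sup>+x. ennreal (\<bar>kdiff \<Omega> 1 h S2 x\<bar> powr \<tau>) \<partial>lborel)
      + ennreal (B * 2 powr \<tau> * (4000 / \<kappa>)) * (\<integral>\<^sup>+x. indicator \<Omega> x * ennreal (\<bar>S1 x - S2 x\<bar> powr \<tau> * damp (infdist x V / t)) \<partial>lborel)"
proof (cases "h = 0")
  case True
  then have "kdiff \<Omega> 1 h S1 x = 0" for x by (simp add: kdiff_1 del: One_nat_def)
  then show ?thesis by (simp del: One_nat_def)
next
  case False
  have cl: "closed \<Omega>" using T1 unfolding cell_tiling_def by blast
  have S1b[measurable]: "S1 \<in> borel_measurable borel" unfolding S1 by (rule step_function_borel[OF T1])
  have S2b[measurable]: "S2 \<in> borel_measurable borel" unfolding S2 by (rule step_function_borel[OF T2])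
  have \<Omega>b[measurable]: "\<Omega> \<in> sets borel" using cl by (rule borel_closed)
  define N where "N = (\<Union>i\<in>I1. frontier (D1 i)) \<union> (\<Union>i\<in>I2. frontier (D2 i))"
  have N: "closed N" "N \<in> null_sets lborel"
    using frontier_union_null[OF T1] frontier_union_null[OF T2] by (auto simp: N_def)
  define F1 where "F1 = (\<lambda>x. ennreal (\<bar>kdiff \<Omega> 1 h S1 x\<bar> powr \<tau>))"
  define F2 where "F2 = (\<lambda>x. ennreal (\<bar>kdiff \<Omega> 1 h S2 x\<bar> powr \<tau>))"
  define Fe where "Fe = (\<lambda>x. indicator \<Omega> x * ennreal (\<bar>S1 x - S2 x\<bar> powr \<tau> * damp (infdist x V / norm h)))"
  note kdiff_borel[OF cl S1b, measurable] kdiff_borel[OF cl S2b, measurable]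
  have F1b[measurable]: "F1 \<in> borel_measurable borel" unfolding F1_def by measurable
  have F2b[measurable]: "F2 \<in> borel_measurable borel" unfolding F2_def by measurable
  have Feb[measurable]: "Fe \<in> borel_measurable borel" unfolding Fe_def damp_def by measurable
  define k where "k = B * 2 powr \<tau> * (4000 / \<kappa>)"
  let ?ind = "\<lambda>x. indicator {0..<1::real} ((x \<bullet> h) / (h \<bullet> h)) :: ennreal"
  have line: "(\<integral>\<^sup>+r. F1 (x + r *\<^sub>R h) \<partial>lborel)
      \<le> ennreal A * (\<integral>\<^sup>+r. F2 (x + r *\<^sub>R h) \<partial>lborel) + ennreal k * (\<integral>\<^sup>+r. Fe (x + r *\<^sub>R h) \<partial>lborel)"
    if x: "{r. x + r *\<^sub>R h \<in> N} \<in> null_sets lborel" for x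
  proof -
    let ?U = "{r. x + r *\<^sub>R h \<in> \<Omega>}" and ?N = "{r. x + r *\<^sub>R h \<in> N}" and ?\<sigma> = "\<lambda>r. infdist (x + r *\<^sub>R h) V / norm h"
    have cont: "continuous_on UNIV (\<lambda>r. x + r *\<^sub>R h)" by (intro continuous_intros)
    have c: "closed ?U" "closed ?N"
      using closed_vimage[OF cl cont] closed_vimage[OF N(1) cont] by (simp_all add: vimage_def)
    have \<theta>: "0 < \<kappa> / 4" "\<kappa> / 4 \<le> 1" using \<kappa> by auto
    have lip: "\<bar>?\<sigma> r - ?\<sigma> r'\<bar> \<le> \<bar>r - r'\<bar>" for r r'
    proof -
      have d: "dist (x + r *\<^sub>R h) (x + r' *\<^sub>R h) = \<bar>r - r'\<bar> * norm h"
      proof -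
        have "(x + r *\<^sub>R h) - (x + r' *\<^sub>R h) = (r - r') *\<^sub>R h" by (simp add: algebra_simps)
        then show ?thesis by (simp add: dist_norm)
      qed
      have "\<bar>infdist (x + r *\<^sub>R h) V - infdist (x + r' *\<^sub>R h) V\<bar> \<le> \<bar>r - r'\<bar> * norm h"
        using infdist_nbhd[of "x + r *\<^sub>R h" V "x + r' *\<^sub>R h"] infdist_nbhd[of "x + r' *\<^sub>R h" V "x + r *\<^sub>R h"] d
        by (simp add: dist_commute abs_le_iff abs_minus_commute)
      then show ?thesis using False by (simp add: diff_divide_distrib[symmetric] pos_divide_le_eq)
    qed
    have "(\<integral>\<^sup>+r. ennreal (\<bar>line_diff ?U (\<lambda>r. S1 (x + r *\<^sub>R h)) r\<bar> powr \<tau>) \<partial>lborel)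
      \<le> ennreal A * (\<integral>\<^sup>+r. ennreal (\<bar>line_diff ?U (\<lambda>r. S2 (x + r *\<^sub>R h)) r\<bar> powr \<tau>) \<partial>lborel)
       + ennreal (B * 2 powr \<tau> * (1000 / (\<kappa> / 4))) * (\<integral>\<^sup>+r. indicator ?U r * ennreal (\<bar>S1 (x + r *\<^sub>R h) - S2 (x + r *\<^sub>R h)\<bar> powr \<tau> * damp (?\<sigma> r)) \<partial>lborel)"
    proof (rule line_difference_inequality[OF \<theta> \<tau> AB x c(2,1) _ _ lip])
      show "jump_controlled (\<kappa> / 4) ?U ?N ?\<sigma> (\<lambda>r. S1 (x + r *\<^sub>R h))"
        by (rule jump_controlled_line[OF T1 \<kappa> S1 _ False]) (simp add: N_def)
      show "jump_controlled (\<kappa> / 4) ?U ?N ?\<sigma> (\<lambda>r. S2 (x + r *\<^sub>R h))"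
        by (rule jump_controlled_line[OF T2 \<kappa> S2 _ False]) (simp add: N_def)
    qed measurable
    moreover have "indicator ?U r = (indicator \<Omega> (x + r *\<^sub>R h) :: ennreal)" for r by (simp add: indicator_def)
    moreover have "B * 2 powr \<tau> * (1000 / (\<kappa> / 4)) = k" by (simp add: k_def)
    ultimately show ?thesis by (simp add: F1_def F2_def Fe_def kdiff_on_line del: One_nat_def)
  qed
  have "(\<integral>\<^sup>+x. F1 x \<partial>lborel) = (\<integral>\<^sup>+x. ?ind x * (\<integral>\<^sup>+r. F1 (x + r *\<^sub>R h) \<partial>lborel) \<partial>lborel)"
    by (rule nn_integral_along_lines[OF F1b False])
  also have "\<dots> \<le> (\<integral>\<^sup>+x. ennreal A * (?ind x * (\<integral>\<^sup>+r. F2 (x + r *\<^sub>R h) \<partial>lborel)) + ennreal k * (?ind x * (\<integral>\<^sup>+r. Fe (x + r *\<^sub>R h) \<partial>lborel)) \<partial>lborel)"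
  proof (rule nn_integral_mono_AE)
    show "AE x in lborel. ?ind x * (\<integral>\<^sup>+r. F1 (x + r *\<^sub>R h) \<partial>lborel)
      \<le> ennreal A * (?ind x * (\<integral>\<^sup>+r. F2 (x + r *\<^sub>R h) \<partial>lborel)) + ennreal k * (?ind x * (\<integral>\<^sup>+r. Fe (x + r *\<^sub>R h) \<partial>lborel))"
      using null_set_along_lines[OF N(2) borel_closed[OF N(1)] False]
      by eventually_elim (use line in \<open>auto simp: indicator_def\<close>)
  qed
  also have "\<dots> = ennreal A * (\<integral>\<^sup>+x. ?ind x * (\<integral>\<^sup>+r. F2 (x + r *\<^sub>R h) \<partial>lborel) \<partial>lborel) + ennreal k * (\<integral>\<^sup>+x. ?ind x * (\<integral>\<^sup>+r. Fe (x + r *\<^sub>R h) \<partial>lborel) \<partial>lborel)"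
    by (subst nn_integral_add) (auto simp: nn_integral_cmult)
  also have "(\<integral>\<^sup>+x. ?ind x * (\<integral>\<^sup>+r. F2 (x + r *\<^sub>R h) \<partial>lborel) \<partial>lborel) = (\<integral>\<^sup>+x. F2 x \<partial>lborel)"
    by (rule nn_integral_along_lines[symmetric, OF F2b False])
  also have "(\<integral>\<^sup>+x. ?ind x * (\<integral>\<^sup>+r. Fe (x + r *\<^sub>R h) \<partial>lborel) \<partial>lborel) = (\<integral>\<^sup>+x. Fe x \<partial>lborel)"
    by (rule nn_integral_along_lines[symmetric, OF Feb False])
  also have "(\<integral>\<^sup>+x. Fe x \<partial>lborel) \<le> (\<integral>\<^sup>+x. indicator \<Omega> x * ennreal (\<bar>S1 x - S2 x\<bar> powr \<tau> * damp (infdist x V / t)) \<partial>lborel)"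
    unfolding Fe_def
  proof (intro nn_integral_mono mult_left_mono ennreal_leI damp_antimono)
    show "infdist x V / t \<le> infdist x V / norm h" for x
      using h t False by (intro divide_left_mono) (auto simp: infdist_nonneg)
  qed auto
  finally show ?thesis unfolding F1_def F2_def k_def by (simp add: add_left_mono mult_left_mono)
qed

section \<open>Integration over the step size\<close>

lemma epowr_ennreal: "epowr (ennreal x) a = ennreal ((max 0 x) powr a)"
  by (cases "0 \<le> x") (simp_all add: epowr_def max_def ennreal_neg)

lemma epowr_top: "epowr \<infinity> a = \<infinity>"
  by (simp add: epowr_def)

lemma ennreal_cases_inf:
  obtains "x = \<infinity>" | r where "0 \<le> r" "x = ennreal r"
  by (cases x) auto

lemma epowr_mono:
  assumes "x \<le> y" "0 \<le> a"
  shows "epowr x a \<le> epowr y a"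
proof (cases y rule: ennreal_cases_inf)
  case 1
  then show ?thesis by (simp add: epowr_top[simplified])
next
  case (2 r)
  then obtain q where q: "0 \<le> q" "x = ennreal q" using assms(1)
    by (cases x rule: ennreal_cases_inf) (auto simp: top_unique)
  then have "q \<le> r" using assms(1) 2 by simp
  then show ?thesis using q 2 assms(2) by (simp add: epowr_ennreal powr_mono2 ennreal_leI)
qed

lemma epowr_epowr: "epowr (epowr x a) b = epowr x (a * b)"
proof (cases x rule: ennreal_cases_inf)
  case (2 r)
  then show ?thesis by (simp add: epowr_ennreal powr_powr)
qed (simp add: epowr_def)

lemma epowr_one: "epowr x 1 = x"
  by (cases x rule: ennreal_cases_inf) (simp_all add: epowr_ennreal epowr_def)

lemma epowr_inverse:
  assumes "0 < \<tau>"
  shows "epowr (epowr x (1 / \<tau>)) \<tau> = x" "epowr (epowr x \<tau>) (1 / \<tau>) = x"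
  using assms by (simp_all add: epowr_epowr epowr_one)

lemma epowr_cmult:
  assumes "0 < c"
  shows "epowr (ennreal c * x) a = ennreal (c powr a) * epowr x a"
proof (cases x rule: ennreal_cases_inf)
  case 1
  then show ?thesis using assms by (simp add: epowr_def ennreal_mult_top)
next
  case (2 r)
  then show ?thesis using assms by (simp add: epowr_ennreal ennreal_mult[symmetric] powr_mult)
qed

section \<open>Minkowski's inequality from the linearised form\<close>

lemma split_ineq_le_1:
  assumes "0 < \<tau>" "\<tau> \<le> 1"
  shows "split_ineq \<tau> 1 1"
  unfolding split_ineq_def
proof (intro conjI allI impI)
  fix a b :: real assume ab: "0 \<le> a" "0 \<le> b"
  show "(a + b) powr \<tau> \<le> 1 * a powr \<tau> + 1 * b powr \<tau>"
  proof (cases "a + b = 0")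
    case False
    then have s: "a + b > 0" using ab by simp
    have le: "x / (a + b) \<le> (x / (a + b)) powr \<tau>" if "0 \<le> x" "x \<le> a + b" for x
      using powr_mono'[of \<tau> 1 "x / (a + b)"] that s assms by simp
    have "1 = a / (a + b) + b / (a + b)" using s by (simp add: add_divide_distrib[symmetric])
    also have "\<dots> \<le> (a / (a + b)) powr \<tau> + (b / (a + b)) powr \<tau>" using le[of a] le[of b] ab by simp
    also have "\<dots> = (a powr \<tau> + b powr \<tau>) / (a + b) powr \<tau>"
      using ab s by (simp add: powr_divide add_divide_distrib)
    finally show ?thesis using s by (simp add: field_simps)
  qed (use ab in auto)
qed auto

text \<open>Convexity of the power at the points \<open>a / (1 - \<epsilon>)\<close> and
  \<open>b / \<epsilon>\<close> with weights \<open>1 - \<epsilon>\<close> and \<epsilon>. If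
  \<open>a\<close> or \<open>b\<close> is 0, it suffices that both factors are at least 1.\<close>

lemma split_ineq_ge_1:
  assumes \<tau>: "1 \<le> \<tau>" and e: "0 < \<epsilon>" "\<epsilon> < 1"
  shows "split_ineq \<tau> ((1 - \<epsilon>) powr (1 - \<tau>)) (\<epsilon> powr (1 - \<tau>))"
  unfolding split_ineq_def
proof (intro conjI allI impI)
  fix a b :: real assume ab: "0 \<le> a" "0 \<le> b"
  have ge1: "1 \<le> x powr (1 - \<tau>)" if "0 < x" "x < 1" for x
  proof -
    have "x powr 0 \<le> x powr (1 - \<tau>)" using that \<tau> by (intro powr_mono') auto
    then show ?thesis using that by simp
  qed
  have g: "y \<le> x powr (1 - \<tau>) * y" if "0 < x" "x < 1" "0 \<le> y" for x y
    using mult_right_mono[OF ge1[OF that(1,2)] that(3)] by simp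
  show "(a + b) powr \<tau> \<le> (1 - \<epsilon>) powr (1 - \<tau>) * a powr \<tau> + \<epsilon> powr (1 - \<tau>) * b powr \<tau>"
  proof (cases "a = 0 \<or> b = 0")
    case True
    then show ?thesis using g[of \<epsilon> "b powr \<tau>"] g[of "1 - \<epsilon>" "a powr \<tau>"] e \<tau> by auto
  next
    case False
    then have pos: "0 < a / (1 - \<epsilon>)" "0 < b / \<epsilon>" using ab e by auto
    have "((1 - \<epsilon>) *\<^sub>R (a / (1 - \<epsilon>)) + \<epsilon> *\<^sub>R (b / \<epsilon>)) powr \<tau> \<le> (1 - \<epsilon>) * (a / (1 - \<epsilon>)) powr \<tau> + \<epsilon> * (b / \<epsilon>) powr \<tau>"
      using convex_onD[OF powr_convex[OF \<tau>], of \<epsilon> "a / (1 - \<epsilon>)" "b / \<epsilon>"] pos e by simp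
    moreover have "(1 - \<epsilon>) *\<^sub>R (a / (1 - \<epsilon>)) + \<epsilon> *\<^sub>R (b / \<epsilon>) = a + b" using e by simp
    moreover have "x * (y / x) powr \<tau> = x powr (1 - \<tau>) * y powr \<tau>" if "0 < x" "0 \<le> y" for x y
      using that by (simp add: powr_divide powr_diff)
    ultimately show ?thesis using ab e by simp
  qed
qed auto

text \<open>Write \<open>x\<close> and \<open>y\<close> for the two terms on the right. The choice
  \<epsilon> = y/(x + y) would turn the bound of the hypothesis into
  \<open>(x + y) powr \<tau>\<close>. Adding \<open>e / 2\<close> to both keeps \<epsilon> strictly
  between 0 and 1 when one of them is 0; afterwards \<open>e\<close> tends to 0.\<close>

lemma minkowski_limit:
  assumes \<tau>: "1 \<le> \<tau>" and R: "0 \<le> R"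
    and le: "\<And>\<epsilon>. 0 < \<epsilon> \<Longrightarrow> \<epsilon> < 1 \<Longrightarrow> J1 \<le> ennreal ((1 - \<epsilon>) powr (1 - \<tau>)) * J2 + ennreal (\<epsilon> powr (1 - \<tau>) * R)"
  shows "epowr J1 (1 / \<tau>) \<le> epowr J2 (1 / \<tau>) + ennreal (R powr (1 / \<tau>))"
proof (cases J2 rule: ennreal_cases_inf)
  case 1
  then show ?thesis by (simp add: epowr_top[simplified])
next
  case (2 j)
  define x where "x = j powr (1 / \<tau>)"
  define y where "y = R powr (1 / \<tau>)"
  have xy: "0 \<le> x" "0 \<le> y" "x powr \<tau> = j" "y powr \<tau> = R"
    using \<tau> 2 R by (simp_all add: x_def y_def powr_powr)
  have "epowr J1 (1 / \<tau>) \<le> ennreal (x + y) + ennreal e" if e: "0 < e" for e :: real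
  proof -
    define d where "d = e / 2"
    define \<epsilon> where "\<epsilon> = (y + d) / (x + y + e)"
    have d: "0 < d" "e = d + d" using e by (auto simp: d_def)
    have T: "0 < x + y + e" using xy e by simp
    have \<epsilon>: "0 < \<epsilon>" "\<epsilon> < 1" "1 - \<epsilon> = (x + d) / (x + y + e)" using xy d T by (simp_all add: \<epsilon>_def field_simps)
    have b: "u powr (1 - \<tau>) * q \<le> (w / (x + y + e)) * (x + y + e) powr \<tau>"
      if "u = w / (x + y + e)" "0 < w" "0 \<le> q" "q \<le> w powr \<tau>" for u w q
    proof -
      have "u powr (1 - \<tau>) * q \<le> u powr (1 - \<tau>) * w powr \<tau>" using that by (intro mult_left_mono) auto
      also have "w = u * (x + y + e)" using that T by simp
      then have "w powr \<tau> = u powr \<tau> * (x + y + e) powr \<tau>" using that T by (simp add: powr_mult[symmetric])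
      then have "u powr (1 - \<tau>) * w powr \<tau> = u powr (1 - \<tau> + \<tau>) * (x + y + e) powr \<tau>" by (simp only: powr_add mult.assoc)
      also have "u powr (1 - \<tau> + \<tau>) = u" using that T by simp
      finally show ?thesis using that by simp
    qed
    have "j \<le> (x + d) powr \<tau>" "R \<le> (y + d) powr \<tau>"
      using powr_mono2[of \<tau> x "x + d"] powr_mono2[of \<tau> y "y + d"] xy d \<tau> by auto
    then have "(1 - \<epsilon>) powr (1 - \<tau>) * j + \<epsilon> powr (1 - \<tau>) * R
        \<le> ((x + d) / (x + y + e)) * (x + y + e) powr \<tau> + ((y + d) / (x + y + e)) * (x + y + e) powr \<tau>"
      using b[OF \<epsilon>(3) _ 2(1)] b[OF \<epsilon>_def _ R] xy(1,2) d(1) by (intro add_mono) auto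
    also have "\<dots> = (x + y + e) powr \<tau>"
    proof -
      have "(x + d) / (x + y + e) + (y + d) / (x + y + e) = 1" using T d by (simp add: add_divide_distrib[symmetric])
      then show ?thesis by (simp only: distrib_right[symmetric] mult_1_left)
    qed
    finally have r: "(1 - \<epsilon>) powr (1 - \<tau>) * j + \<epsilon> powr (1 - \<tau>) * R \<le> (x + y + e) powr \<tau>" .
    have "J1 \<le> ennreal ((1 - \<epsilon>) powr (1 - \<tau>)) * J2 + ennreal (\<epsilon> powr (1 - \<tau>) * R)" by (rule le) (use \<epsilon> in auto)
    also have "\<dots> = ennreal ((1 - \<epsilon>) powr (1 - \<tau>) * j + \<epsilon> powr (1 - \<tau>) * R)"
      using 2 R by (simp add: ennreal_mult[symmetric] ennreal_plus[symmetric] del: ennreal_plus)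
    also have "\<dots> \<le> ennreal ((x + y + e) powr \<tau>)" using r by (rule ennreal_leI)
    finally have "epowr J1 (1 / \<tau>) \<le> epowr (ennreal ((x + y + e) powr \<tau>)) (1 / \<tau>)" using \<tau> by (intro epowr_mono) auto
    also have "\<dots> = ennreal (x + y + e)" using \<tau> T by (simp add: epowr_ennreal powr_powr)
    finally show ?thesis using xy e by (simp add: ennreal_plus[symmetric] del: ennreal_plus)
  qed
  then have "epowr J1 (1 / \<tau>) \<le> ennreal (x + y)" by (rule ennreal_le_epsilon)
  also have "\<dots> = epowr J2 (1 / \<tau>) + ennreal (R powr (1 / \<tau>))"
    using xy 2 by (simp add: x_def y_def epowr_ennreal)
  finally show ?thesis .
qed

section \<open>The modulus of smoothness and the integral over the step sizes\<close>

lemma Lnorm_kdiff_powr: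
  assumes "0 < \<tau>"
  shows "epowr (Lnorm \<Omega> \<tau> (kdiff \<Omega> 1 h f)) \<tau> = (\<integral>\<^sup>+x. ennreal (\<bar>kdiff \<Omega> 1 h f x\<bar> powr \<tau>) \<partial>lborel)"
proof -
  have "kdiff \<Omega> 1 h f x = 0" if "x \<notin> \<Omega>" for x
    unfolding kdiff_1 using that by (meson ends_in_segment(1) subsetD)
  then have "indicator \<Omega> x * ennreal (\<bar>kdiff \<Omega> 1 h f x\<bar> powr \<tau>) = ennreal (\<bar>kdiff \<Omega> 1 h f x\<bar> powr \<tau>)" for x
    by (cases "x \<in> \<Omega>") auto
  then show ?thesis using assms by (simp add: Lnorm_def epowr_inverse)
qed

lemma modulus_inequality:
  fixes S1 S2 :: "pt \<Rightarrow> real"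
  assumes T1: "cell_tiling \<kappa> V I1 D1 \<Omega>" and T2: "cell_tiling \<kappa> V I2 D2 \<Omega>" and \<kappa>: "0 < \<kappa>" "\<kappa> \<le> 1"
    and S1: "S1 = (\<lambda>x. \<Sum>i\<in>I1. c1 i * indicator (D1 i) x)" and S2: "S2 = (\<lambda>x. \<Sum>i\<in>I2. c2 i * indicator (D2 i) x)"
    and \<tau>: "0 < \<tau>" and AB: "split_ineq \<tau> A B" and t: "0 < t"
  shows "epowr (modulus_smoothness \<Omega> 1 S1 t \<tau>) \<tau>
    \<le> ennreal A * epowr (modulus_smoothness \<Omega> 1 S2 t \<tau>) \<tau>
      + ennreal (B * 2 powr \<tau> * (4000 / \<kappa>)) * (\<integral>\<^sup>+x. indicator \<Omega> x * ennreal (\<bar>S1 x - S2 x\<bar> powr \<tau> * damp (infdist x V / t)) \<partial>lborel)"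
    (is "_ \<le> ?rhs")
proof -
  have "modulus_smoothness \<Omega> 1 S1 t \<tau> \<le> epowr ?rhs (1 / \<tau>)"
    unfolding modulus_smoothness_def[of \<Omega> 1 S1]
  proof (rule SUP_least)
    fix h :: pt assume h: "h \<in> {h. norm h \<le> t}"
    have "Lnorm \<Omega> \<tau> (kdiff \<Omega> 1 h S2) \<le> modulus_smoothness \<Omega> 1 S2 t \<tau>"
      unfolding modulus_smoothness_def using h by (rule SUP_upper)
    then have "epowr (Lnorm \<Omega> \<tau> (kdiff \<Omega> 1 h S2)) \<tau> \<le> epowr (modulus_smoothness \<Omega> 1 S2 t \<tau>) \<tau>"
      using \<tau> by (intro epowr_mono) auto
    then have *: "(\<integral>\<^sup>+x. ennreal (\<bar>kdiff \<Omega> 1 h S2 x\<bar> powr \<tau>) \<partial>lborel) \<le> epowr (modulus_smoothness \<Omega> 1 S2 t \<tau>) \<tau>"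
      unfolding Lnorm_kdiff_powr[OF \<tau>] .
    have "epowr (Lnorm \<Omega> \<tau> (kdiff \<Omega> 1 h S1)) \<tau> = (\<integral>\<^sup>+x. ennreal (\<bar>kdiff \<Omega> 1 h S1 x\<bar> powr \<tau>) \<partial>lborel)"
      by (rule Lnorm_kdiff_powr[OF \<tau>])
    also have "\<dots> \<le> ennreal A * (\<integral>\<^sup>+x. ennreal (\<bar>kdiff \<Omega> 1 h S2 x\<bar> powr \<tau>) \<partial>lborel)
      + ennreal (B * 2 powr \<tau> * (4000 / \<kappa>)) * (\<integral>\<^sup>+x. indicator \<Omega> x * ennreal (\<bar>S1 x - S2 x\<bar> powr \<tau> * damp (infdist x V / t)) \<partial>lborel)"
      using h by (intro difference_inequality[OF T1 T2 \<kappa> S1 S2 \<tau> AB _ t]) simp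
    also have "\<dots> \<le> ?rhs" by (intro add_right_mono mult_left_mono *) simp
    finally have "epowr (epowr (Lnorm \<Omega> \<tau> (kdiff \<Omega> 1 h S1)) \<tau>) (1 / \<tau>) \<le> epowr ?rhs (1 / \<tau>)"
      using \<tau> by (intro epowr_mono) auto
    then show "Lnorm \<Omega> \<tau> (kdiff \<Omega> 1 h S1) \<le> epowr ?rhs (1 / \<tau>)"
      unfolding epowr_inverse(2)[OF \<tau>] .
  qed
  then have "epowr (modulus_smoothness \<Omega> 1 S1 t \<tau>) \<tau> \<le> epowr (epowr ?rhs (1 / \<tau>)) \<tau>"
    using \<tau> by (intro epowr_mono) auto
  then show ?thesis unfolding epowr_inverse(1)[OF \<tau>] .
qed

lemma mono_ennreal_borel:
  fixes f :: "real \<Rightarrow> ennreal"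
  assumes "mono f"
  shows "f \<in> borel_measurable borel"
proof (rule borel_measurableI_greater)
  fix y
  have "is_interval {x. y < f x}"
    unfolding is_interval_1 using assms by (auto dest: monoD intro: less_le_trans)

  then show "{x \<in> space borel. y < f x} \<in> sets borel"
    using real_interval_borel_measurable by simp
qed

text \<open>The modulus is a supremum over uncountably many \<open>h\<close>; measurability in
  \<open>t\<close> comes from monotonicity.\<close>

lemma modulus_borel:
  assumes "0 < \<tau>"
  shows "(\<lambda>t. epowr (modulus_smoothness \<Omega> k f t \<tau>) \<tau>) \<in> borel_measurable borel"
proof (rule mono_ennreal_borel, rule monoI)
  fix t t' :: real assume "t \<le> t'"
  then have "modulus_smoothness \<Omega> k f t \<tau> \<le> modulus_smoothness \<Omega> k f t' \<tau>"
    unfolding modulus_smoothness_def by (intro SUP_subset_mono) auto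
  then show "epowr (modulus_smoothness \<Omega> k f t \<tau>) \<tau> \<le> epowr (modulus_smoothness \<Omega> k f t' \<tau>) \<tau>"
    using assms by (intro epowr_mono) auto
qed

text \<open>The integral is split at \<open>t = r\<close>. Below,
  \<open>damp (r / t) = t / r\<close>, and \<open>t powr (- a) / r\<close> is integrable at 0 as
  \<open>a < 1\<close>; above, \<open>damp\<close> is 1, and \<open>t powr (- a - 1)\<close> is
  integrable at infinity as \<open>a > 0\<close>.\<close>

lemma damp_integral:
  assumes a: "0 < a" "a < 1" and r: "0 < r"
  shows "(\<integral>\<^sup>+t. indicator {0<..} t * (ennreal (t powr (- a) * (1 / t)) * ennreal (damp (r / t))) \<partial>lborel)
     \<le> ennreal ((1 / (1 - a) + 1 / a) * r powr (- a))"
proof -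
  have "((\<lambda>t. t powr (- a)) has_integral (r powr (- a + 1) / (- a + 1))) {0..r}"
    using a r by (intro has_integral_powr_from_0) auto
  then have 1: "(\<integral>\<^sup>+t. indicator {0..r} t * ennreal (t powr (- a)) \<partial>lborel) = ennreal (r powr (- a + 1) / (- a + 1))"
    using nn_integral_has_integral_lebesgue'[of "{0..r}" "\<lambda>t. t powr (- a)"] by (simp add: mult.commute)
  have "((\<lambda>t. t powr (- a - 1)) has_integral (- (r powr ((- a - 1) + 1)) / ((- a - 1) + 1))) {r..}"
    using a r by (intro has_integral_powr_to_inf) auto
  then have 2: "(\<integral>\<^sup>+t. indicator {r..} t * ennreal (t powr (- a - 1)) \<partial>lborel) = ennreal (- (r powr ((- a - 1) + 1)) / ((- a - 1) + 1))"
    using nn_integral_has_integral_lebesgue'[of "{r..}" "\<lambda>t. t powr (- a - 1)"] by (simp add: mult.commute)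
  have "(\<integral>\<^sup>+t. indicator {0<..} t * (ennreal (t powr (- a) * (1 / t)) * ennreal (damp (r / t))) \<partial>lborel)
     \<le> (\<integral>\<^sup>+t. ennreal (1 / r) * (indicator {0..r} t * ennreal (t powr (- a))) + indicator {r..} t * ennreal (t powr (- a - 1)) \<partial>lborel)"
  proof (rule nn_integral_mono)
    fix t :: real
    show "indicator {0<..} t * (ennreal (t powr (- a) * (1 / t)) * ennreal (damp (r / t)))
      \<le> ennreal (1 / r) * (indicator {0..r} t * ennreal (t powr (- a))) + indicator {r..} t * ennreal (t powr (- a - 1))"
    proof (cases "0 < t")
      case True
      show ?thesis
      proof (cases "t < r")
        case t: True
        have "t powr (- a) * (1 / t) * damp (r / t) = 1 / r * t powr (- a)" using True t r by (simp add: damp_def)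
        then have "ennreal (t powr (- a) * (1 / t)) * ennreal (damp (r / t)) = ennreal (1 / r) * ennreal (t powr (- a))"
          using True r by (simp add: ennreal_mult[symmetric] damp_def)
        then show ?thesis using True t by (simp add: indicator_def)
      next
        case False
        have "damp (r / t) = 1" using False True by (simp add: damp_def)
        moreover have "t powr (- a) * (1 / t) = t powr (- a - 1)" using True by (simp add: powr_diff)
        ultimately show ?thesis using True False by (simp add: indicator_def)
      qed
    qed simp
  qed
  also have "\<dots> = ennreal (1 / r) * ennreal (r powr (- a + 1) / (- a + 1)) + ennreal (- (r powr ((- a - 1) + 1)) / ((- a - 1) + 1))"
    unfolding 1[symmetric] 2[symmetric] by (subst nn_integral_add) (auto simp: nn_integral_cmult)
  also have "\<dots> = ennreal ((1 / (1 - a) + 1 / a) * r powr (- a))"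
  proof -
    have "r powr (- a + 1) = r powr (- a) * r powr 1" by (rule powr_add)
    then have "r powr (- a + 1) = r powr (- a) * r" using r by simp
    then have "1 / r * (r powr (- a + 1) / (- a + 1)) = 1 / (1 - a) * r powr (- a)" using r a by (simp add: field_simps)
    moreover have "- (r powr ((- a - 1) + 1)) / ((- a - 1) + 1) = 1 / a * r powr (- a)" using a by simp
    ultimately show ?thesis using a r
      by (simp add: ennreal_mult[symmetric] ennreal_plus[symmetric] distrib_right del: ennreal_plus)
  qed
  finally show ?thesis .
qed

text \<open>The \<tau>-th power of the seminorm: at this level integrals can be added and
  interchanged, and the root is taken only in the final step.\<close>

definition besov_power :: "pt set \<Rightarrow> real \<Rightarrow> real \<Rightarrow> (pt \<Rightarrow> real) \<Rightarrow> ennreal" where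
  "besov_power \<Omega> s \<tau> f = (\<integral>\<^sup>+ t. indicator {0<..} t *
        epowr (ennreal (t powr (- s)) * modulus_smoothness \<Omega> 1 f t \<tau>) \<tau> * ennreal (1 / t) \<partial>lborel)"

lemma besov1_eq: "besov1 \<Omega> s \<tau> f = epowr (besov_power \<Omega> s \<tau> f) (1 / \<tau>)"
  by (simp add: besov_seminorm_def besov_power_def)

lemma damp_nonneg: "0 \<le> damp x"
  by (simp add: damp_def)

text \<open>The error of \<open>modulus_inequality\<close> is integrated over the step sizes. By
  Tonelli the integral over \<open>t\<close> is done first, for fixed \<open>x\<close>, and
  \<open>damp_integral\<close> turns \<open>damp\<close> into the power of the distance to
  \<open>V\<close>.\<close>

lemma besov_power_inequality:
  fixes S1 S2 :: "pt \<Rightarrow> real"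
  assumes T1: "cell_tiling \<kappa> V I1 D1 \<Omega>" and T2: "cell_tiling \<kappa> V I2 D2 \<Omega>" and \<kappa>: "0 < \<kappa>" "\<kappa> \<le> 1"
    and S1: "S1 = (\<lambda>x. \<Sum>i\<in>I1. c1 i * indicator (D1 i) x)" and S2: "S2 = (\<lambda>x. \<Sum>i\<in>I2. c2 i * indicator (D2 i) x)"
    and \<tau>: "0 < \<tau>" and AB: "split_ineq \<tau> A B" and s: "0 < s" "s * \<tau> < 1"
  shows "besov_power \<Omega> s \<tau> S1 \<le> ennreal A * besov_power \<Omega> s \<tau> S2
     + ennreal (B * 2 powr \<tau> * (4000 / \<kappa>) * (1 / (1 - s * \<tau>) + 1 / (s * \<tau>)))
       * (\<integral>\<^sup>+x. indicator \<Omega> x * ennreal (\<bar>S1 x - S2 x\<bar> powr \<tau> * infdist x V powr (- (s * \<tau>))) \<partial>lborel)"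
proof -
  define a where "a = s * \<tau>"
  have a: "0 < a" "a < 1" using s \<tau> by (auto simp: a_def)
  have V: "finite V" "V \<noteq> {}" and cl: "closed \<Omega>" using T1 unfolding cell_tiling_def by blast+
  have S1b[measurable]: "S1 \<in> borel_measurable borel" unfolding S1 by (rule step_function_borel[OF T1])
  have S2b[measurable]: "S2 \<in> borel_measurable borel" unfolding S2 by (rule step_function_borel[OF T2])
  have \<Omega>b[measurable]: "\<Omega> \<in> sets borel" using cl by (rule borel_closed)
  define g where "g = (\<lambda>t. indicator {0<..} t * ennreal (t powr (- a) * (1 / t)))"
  have gb[measurable]: "g \<in> borel_measurable borel" unfolding g_def by measurable
  define W where "W = (\<lambda>x. indicator \<Omega> x * ennreal (\<bar>S1 x - S2 x\<bar> powr \<tau>))"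
  have Wb[measurable]: "W \<in> borel_measurable borel" unfolding W_def by measurable
  define E where "E = (\<lambda>t. \<integral>\<^sup>+x. W x * ennreal (damp (infdist x V / t)) \<partial>lborel)"
  have [measurable]: "(\<lambda>(x, t). ennreal (damp (infdist x V / t))) \<in> borel_measurable ((borel :: pt measure) \<Otimes>\<^sub>M borel)"
    unfolding damp_def by measurable
  have Eb[measurable]: "E \<in> borel_measurable borel" unfolding E_def by measurable
  have Eeq: "(\<integral>\<^sup>+x. indicator \<Omega> x * ennreal (\<bar>S1 x - S2 x\<bar> powr \<tau> * damp (infdist x V / t)) \<partial>lborel) = E t" for t
    unfolding E_def W_def by (intro nn_integral_cong) (simp add: ennreal_mult mult.assoc damp_nonneg)
  have pw: "besov_power \<Omega> s \<tau> f = (\<integral>\<^sup>+t. g t * epowr (modulus_smoothness \<Omega> 1 f t \<tau>) \<tau> \<partial>lborel)" for f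
    unfolding besov_power_def
  proof (rule nn_integral_cong)
    fix t :: real
    show "indicator {0<..} t * epowr (ennreal (t powr (- s)) * modulus_smoothness \<Omega> 1 f t \<tau>) \<tau> * ennreal (1 / t)
      = g t * epowr (modulus_smoothness \<Omega> 1 f t \<tau>) \<tau>"
    proof (cases "0 < t")
      case True
      then have "epowr (ennreal (t powr (- s)) * modulus_smoothness \<Omega> 1 f t \<tau>) \<tau> = ennreal (t powr (- a)) * epowr (modulus_smoothness \<Omega> 1 f t \<tau>) \<tau>"
        by (subst epowr_cmult) (auto simp: powr_powr a_def)
      moreover have "g t = ennreal (t powr (- a)) * ennreal (1 / t)"
        using True by (simp add: g_def ennreal_mult[symmetric])
      ultimately show ?thesis using True by (simp add: mult_ac del: One_nat_def)
    qed (simp add: g_def)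
  qed
  define k where "k = B * 2 powr \<tau> * (4000 / \<kappa>)"
  note mb = modulus_borel[OF \<tau>, of \<Omega> 1 S2, measurable]
  have "besov_power \<Omega> s \<tau> S1 \<le> (\<integral>\<^sup>+t. ennreal A * (g t * epowr (modulus_smoothness \<Omega> 1 S2 t \<tau>) \<tau>) + ennreal k * (g t * E t) \<partial>lborel)"
    unfolding pw
  proof (rule nn_integral_mono)
    fix t :: real
    show "g t * epowr (modulus_smoothness \<Omega> 1 S1 t \<tau>) \<tau> \<le> ennreal A * (g t * epowr (modulus_smoothness \<Omega> 1 S2 t \<tau>) \<tau>) + ennreal k * (g t * E t)"
    proof (cases "0 < t")
      case True
      have "g t * epowr (modulus_smoothness \<Omega> 1 S1 t \<tau>) \<tau> \<le> g t * (ennreal A * epowr (modulus_smoothness \<Omega> 1 S2 t \<tau>) \<tau> + ennreal k * E t)"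
        using modulus_inequality[OF T1 T2 \<kappa> S1 S2 \<tau> AB True] unfolding Eeq k_def by (rule mult_left_mono) simp
      then show ?thesis by (simp only: distrib_left mult.left_commute)
    qed (simp add: g_def)
  qed
  also have "\<dots> = ennreal A * besov_power \<Omega> s \<tau> S2 + ennreal k * (\<integral>\<^sup>+t. g t * E t \<partial>lborel)"
    unfolding pw using mb by (subst nn_integral_add) (auto simp: nn_integral_cmult)
  also have "(\<integral>\<^sup>+t. g t * E t \<partial>lborel) \<le> ennreal (1 / (1 - a) + 1 / a) * (\<integral>\<^sup>+x. W x * ennreal (infdist x V powr (- a)) \<partial>lborel)"
  proof -
    have "(\<integral>\<^sup>+t. g t * E t \<partial>lborel) = (\<integral>\<^sup>+t. (\<integral>\<^sup>+x. g t * (W x * ennreal (damp (infdist x V / t))) \<partial>lborel) \<partial>lborel)"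
      unfolding E_def by (intro nn_integral_cong nn_integral_cmult[symmetric]) measurable
    also have "\<dots> = (\<integral>\<^sup>+x. (\<integral>\<^sup>+t. g t * (W x * ennreal (damp (infdist x V / t))) \<partial>lborel) \<partial>lborel)"
      by (rule lborel_pair.Fubini') measurable
    also have "\<dots> = (\<integral>\<^sup>+x. W x * (\<integral>\<^sup>+t. g t * ennreal (damp (infdist x V / t)) \<partial>lborel) \<partial>lborel)"
    proof (rule nn_integral_cong)
      fix x
      have "(\<integral>\<^sup>+t. g t * (W x * ennreal (damp (infdist x V / t))) \<partial>lborel) = (\<integral>\<^sup>+t. W x * (g t * ennreal (damp (infdist x V / t))) \<partial>lborel)"
        by (simp only: mult.left_commute)
      also have "\<dots> = W x * (\<integral>\<^sup>+t. g t * ennreal (damp (infdist x V / t)) \<partial>lborel)"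
        by (rule nn_integral_cmult) (simp add: damp_def)
      finally show "(\<integral>\<^sup>+t. g t * (W x * ennreal (damp (infdist x V / t))) \<partial>lborel) = W x * (\<integral>\<^sup>+t. g t * ennreal (damp (infdist x V / t)) \<partial>lborel)" .
    qed
    also have "\<dots> \<le> (\<integral>\<^sup>+x. ennreal (1 / (1 - a) + 1 / a) * (W x * ennreal (infdist x V powr (- a))) \<partial>lborel)"
    proof (rule nn_integral_mono_AE)
      have "AE x in lborel. x \<notin> V" using V(1) by (intro AE_not_in finite_imp_null_set_lborel)
      then show "AE x in lborel. W x * (\<integral>\<^sup>+t. g t * ennreal (damp (infdist x V / t)) \<partial>lborel)
          \<le> ennreal (1 / (1 - a) + 1 / a) * (W x * ennreal (infdist x V powr (- a)))"
      proof eventually_elim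
        case (elim x)
        have "0 < infdist x V" by (rule infdist_pos[OF V elim])
        from damp_integral[OF a this]
        have "(\<integral>\<^sup>+t. g t * ennreal (damp (infdist x V / t)) \<partial>lborel) \<le> ennreal ((1 / (1 - a) + 1 / a) * infdist x V powr (- a))"
          by (simp only: g_def mult.assoc)
        also have "\<dots> = ennreal (1 / (1 - a) + 1 / a) * ennreal (infdist x V powr (- a))"
          using a by (intro ennreal_mult) auto
        finally show ?case by (metis mult.left_commute mult_left_mono zero_le)
      qed
    qed
    also have "\<dots> = ennreal (1 / (1 - a) + 1 / a) * (\<integral>\<^sup>+x. W x * ennreal (infdist x V powr (- a)) \<partial>lborel)"
      by (rule nn_integral_cmult) measurable
    finally show ?thesis .
  qed
  also have "(\<integral>\<^sup>+x. W x * ennreal (infdist x V powr (- a)) \<partial>lborel)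
      = (\<integral>\<^sup>+x. indicator \<Omega> x * ennreal (\<bar>S1 x - S2 x\<bar> powr \<tau> * infdist x V powr (- a)) \<partial>lborel)"
    unfolding W_def by (intro nn_integral_cong) (simp add: ennreal_mult mult.assoc)
  finally have "besov_power \<Omega> s \<tau> S1 \<le> ennreal A * besov_power \<Omega> s \<tau> S2 + ennreal k * (ennreal (1 / (1 - a) + 1 / a) *
      (\<integral>\<^sup>+x. indicator \<Omega> x * ennreal (\<bar>S1 x - S2 x\<bar> powr \<tau> * infdist x V powr (- a)) \<partial>lborel))"
    by (simp add: add_left_mono mult_left_mono)
  moreover have "ennreal k * ennreal (1 / (1 - a) + 1 / a) = ennreal (k * (1 / (1 - a) + 1 / a))"
    using AB \<kappa> a by (intro ennreal_mult[symmetric]) (auto simp: k_def split_ineq_def)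
  ultimately show ?thesis unfolding a_def k_def by (simp only: mult.assoc[symmetric])
qed

section \<open>A common node set and the conclusion\<close>

lemma cell_tiling_mono:
  assumes "cell_tiling \<kappa> V I D \<Omega>" "V \<subseteq> V'" "finite V'" "0 \<le> \<kappa>"
  shows "cell_tiling \<kappa> V' I D \<Omega>"
proof -
  have "half_disc_cell \<kappa> V' (D i)" if "i \<in> I" for i
    by (rule half_disc_cell_mono[of \<kappa> V]) (use assms that in \<open>auto simp: cell_tiling_def\<close>)
  then show ?thesis using assms unfolding cell_tiling_def by blast
qed

text \<open>\<open>K\<close> is fixed before \<open>A\<close> and \<open>B\<close>, so one constant
  serves for every \<epsilon> in the limit that proves Minkowski's inequality. With
  \<open>a = s * \<tau>\<close> the relation between \<tau>, \<open>s\<close> and \<open>p\<close>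
  reads \<open>\<tau> / p = 1 - a / 2\<close>, as \<open>weighted_estimate\<close> requires.\<close>

lemma besov_power_step_functions:
  fixes p s \<tau> c0 \<beta> :: real and N0 :: nat
  assumes p: "0 < p" and s: "0 < s" "s < 2 / p" and \<tau>: "1 / \<tau> = s / 2 + 1 / p"
    and c0: "1 \<le> c0" and \<beta>: "0 < \<beta>" "\<beta> \<le> pi / 3"
  obtains K where "0 < K" "\<And>\<Omega> n0 n S1 S2 A B X. admissible_domain N0 c0 \<beta> n0 \<Omega> \<Longrightarrow> n0 \<le> n \<Longrightarrow>
      S1 \<in> step_functions N0 c0 \<beta> \<Omega> n \<Longrightarrow> S2 \<in> step_functions N0 c0 \<beta> \<Omega> n \<Longrightarrow> split_ineq \<tau> A B \<Longrightarrow> 0 \<le> X \<Longrightarrow>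
      (\<integral>\<^sup>+x. indicator \<Omega> x * ennreal (\<bar>S1 x - S2 x\<bar> powr p) \<partial>lborel) = ennreal X \<Longrightarrow>
      besov_power \<Omega> s \<tau> S1 \<le> ennreal A * besov_power \<Omega> s \<tau> S2 + ennreal (B * (K * X powr (\<tau> / p) * real n powr (\<tau> * s / 2)))"
proof -
  have "0 < 1 / \<tau>" unfolding \<tau> using p s by (intro add_pos_pos) auto
  then have \<tau>0: "0 < \<tau>" by simp
  define a where "a = s * \<tau>"
  have half: "\<tau> / p = 1 - a / 2"
  proof -
    have "\<tau> * (1 / \<tau>) = \<tau> * (s / 2) + \<tau> * (1 / p)" unfolding \<tau> by (rule distrib_left)
    then show ?thesis using \<tau>0 by (simp add: a_def mult.commute)
  qed
  have "s / 2 < 1 / p" using s p by (simp add: field_simps)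
  then have "s < 1 / \<tau>" unfolding \<tau> by simp
  then have a: "0 < a" "a < 1" "a < 2" using s \<tau>0 by (simp_all add: a_def field_simps)
  have \<tau>p: "\<tau> = p * (1 - a / 2)" using half p by (simp add: field_simps)
  \<comment> \<open>\<open>sin \<beta>\<close> comes from the triangles of the rings,
    \<open>1 / (2 * c0)\<close> from the hole of the outer ring.\<close>
  define \<kappa> where "\<kappa> = min (sin \<beta>) (1 / (2 * c0))"
  have "sin \<beta> > 0" using \<beta> pi_gt_zero by (intro sin_gt_zero) linarith+
  then have \<kappa>: "0 < \<kappa>" "\<kappa> \<le> 1" using c0 sin_le_one[of \<beta>] by (auto simp: \<kappa>_def min_def)
  show thesis
  proof (rule weighted_estimate[OF \<kappa> a(1,3) p \<tau>p])
    fix K0 assume K0: "0 < K0" "\<And>V I D \<Omega> I' D' c c' S X. cell_tiling \<kappa> V I D \<Omega> \<Longrightarrow> cell_tiling \<kappa> V I' D' \<Omega> \<Longrightarrow>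
        S = (\<lambda>x. (\<Sum>i\<in>I. c i * indicator (D i) x) - (\<Sum>i\<in>I'. c' i * indicator (D' i) x)) \<Longrightarrow>
        0 < X \<Longrightarrow> (\<integral>\<^sup>+x. indicator \<Omega> x * ennreal (\<bar>S x\<bar> powr p) \<partial>lborel) \<le> ennreal X \<Longrightarrow>
        (\<integral>\<^sup>+x. indicator \<Omega> x * ennreal (\<bar>S x\<bar> powr \<tau> * infdist x V powr (- a)) \<partial>lborel)
          \<le> ennreal (K0 * X powr (1 - a / 2) * real (card V) powr (a / 2))"
    define k where "k = 2 powr \<tau> * (4000 / \<kappa>) * (1 / (1 - s * \<tau>) + 1 / (s * \<tau>))"
    have k: "0 < k" using \<kappa> a unfolding k_def a_def[symmetric] by (intro mult_pos_pos add_pos_pos divide_pos_pos) auto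
    \<comment> \<open>Each partition has at most \<open>2 * n * node_bound N0\<close> nodes, where
      the factor 2 makes room for the hole of the outer ring; the two node sets are united.\<close>
    define M where "M = 4 * real (node_bound N0)"
    have "0 < node_bound N0" by (simp add: node_bound_def Let_def)
    then have M: "0 < M" by (simp add: M_def)
    define K where "K = k * K0 * M powr (a / 2)"
    have "besov_power \<Omega> s \<tau> S1 \<le> ennreal A * besov_power \<Omega> s \<tau> S2 + ennreal (B * (K * X powr (\<tau> / p) * real n powr (\<tau> * s / 2)))"
      if \<Omega>: "admissible_domain N0 c0 \<beta> n0 \<Omega>" "n0 \<le> n" and S1: "S1 \<in> step_functions N0 c0 \<beta> \<Omega> n"
        and S2: "S2 \<in> step_functions N0 c0 \<beta> \<Omega> n" and AB: "split_ineq \<tau> A B" and X: "0 \<le> X"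
        "(\<integral>\<^sup>+x. indicator \<Omega> x * ennreal (\<bar>S1 x - S2 x\<bar> powr p) \<partial>lborel) = ennreal X"
      for \<Omega> n0 n S1 S2 A B X
    proof -
      obtain V1 I1 D1 c1 where t1: "cell_tiling \<kappa> V1 I1 D1 \<Omega>" "card V1 \<le> 2 * n * node_bound N0" "S1 = (\<lambda>x. \<Sum>i\<in>I1. c1 i * indicator (D1 i) x)"
        unfolding \<kappa>_def by (rule step_function_tiling[OF \<beta> c0 \<Omega> S1])
      obtain V2 I2 D2 c2 where t2: "cell_tiling \<kappa> V2 I2 D2 \<Omega>" "card V2 \<le> 2 * n * node_bound N0" "S2 = (\<lambda>x. \<Sum>i\<in>I2. c2 i * indicator (D2 i) x)"
        unfolding \<kappa>_def by (rule step_function_tiling[OF \<beta> c0 \<Omega> S2])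
      define V where "V = V1 \<union> V2"
      have finV: "finite V" using t1(1) t2(1) by (simp add: V_def cell_tiling_def)
      have T1: "cell_tiling \<kappa> V I1 D1 \<Omega>" by (rule cell_tiling_mono[OF t1(1) _ finV]) (use \<kappa> in \<open>auto simp: V_def\<close>)
      have T2: "cell_tiling \<kappa> V I2 D2 \<Omega>" by (rule cell_tiling_mono[OF t2(1) _ finV]) (use \<kappa> in \<open>auto simp: V_def\<close>)
      have "card V \<le> 4 * n * node_bound N0" using card_Un_le[of V1 V2] t1(2) t2(2) unfolding V_def by linarith
      then have "real (card V) \<le> real (4 * n * node_bound N0)" by (simp only: of_nat_le_iff)
      also have "\<dots> = M * real n" by (simp add: M_def)
      finally have cV: "real (card V) \<le> M * real n" .
      define Wt where "Wt = (\<integral>\<^sup>+x. indicator \<Omega> x * ennreal (\<bar>S1 x - S2 x\<bar> powr \<tau> * infdist x V powr (- a)) \<partial>lborel)"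
      have Wt: "Wt \<le> ennreal (K0 * X powr (1 - a / 2) * real (card V) powr (a / 2))"
      proof (cases "X = 0")
        case False
        then show ?thesis unfolding Wt_def
          using K0(2)[OF T1 T2, of "\<lambda>x. S1 x - S2 x" c1 c2 X] X t1(3) t2(3) by simp
      next
        \<comment> \<open>\<open>weighted_estimate\<close> asks for \<open>X > 0\<close>; for
          \<open>X = 0\<close> the two functions agree almost everywhere on \<Omega>.\<close>
        case True
        have b: "S1 \<in> borel_measurable borel" "S2 \<in> borel_measurable borel" "\<Omega> \<in> sets borel"
          using step_function_borel[OF t1(1)] step_function_borel[OF t2(1)] t1 t2 borel_closed by (auto simp: cell_tiling_def)
        note b[measurable]
        have "(\<integral>\<^sup>+x. indicator \<Omega> x * ennreal (\<bar>S1 x - S2 x\<bar> powr p) \<partial>lborel) = 0"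
          using X(2) True by simp
        then have "AE x in lborel. indicator \<Omega> x * ennreal (\<bar>S1 x - S2 x\<bar> powr p) = 0"
          by (subst (asm) nn_integral_0_iff_AE) measurable
        then have "AE x in lborel. indicator \<Omega> x * ennreal (\<bar>S1 x - S2 x\<bar> powr \<tau> * infdist x V powr (- a)) = 0"
          by eventually_elim (auto simp: indicator_def split: if_splits)
        then have "Wt = (\<integral>\<^sup>+x. 0 \<partial>(lborel :: pt measure))" unfolding Wt_def by (rule nn_integral_cong_AE)
        then show ?thesis by simp
      qed
      have B: "0 \<le> B" using AB by (simp add: split_ineq_def)
      have "besov_power \<Omega> s \<tau> S1 \<le> ennreal A * besov_power \<Omega> s \<tau> S2
         + ennreal (B * 2 powr \<tau> * (4000 / \<kappa>) * (1 / (1 - s * \<tau>) + 1 / (s * \<tau>))) * Wt"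
        unfolding Wt_def a_def by (rule besov_power_inequality[OF T1 T2 \<kappa> t1(3) t2(3) \<tau>0 AB s(1) a(2)[unfolded a_def]])
      also have "B * 2 powr \<tau> * (4000 / \<kappa>) * (1 / (1 - s * \<tau>) + 1 / (s * \<tau>)) = B * k" by (simp only: k_def mult.assoc)
      also have "ennreal A * besov_power \<Omega> s \<tau> S2 + ennreal (B * k) * Wt
          \<le> ennreal A * besov_power \<Omega> s \<tau> S2 + ennreal (B * k) * ennreal (K0 * X powr (1 - a / 2) * real (card V) powr (a / 2))"
        by (intro add_left_mono mult_left_mono Wt) simp
      also have "ennreal (B * k) * ennreal (K0 * X powr (1 - a / 2) * real (card V) powr (a / 2))
          = ennreal (B * k * (K0 * X powr (1 - a / 2) * real (card V) powr (a / 2)))"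
        using B k K0(1) by (intro ennreal_mult[symmetric]) auto
      also have "B * k * (K0 * X powr (1 - a / 2) * real (card V) powr (a / 2)) \<le> B * k * (K0 * X powr (1 - a / 2) * (M * real n) powr (a / 2))"
        using B k K0(1) a cV by (intro mult_left_mono powr_mono2) auto
      also have "B * k * (K0 * X powr (1 - a / 2) * (M * real n) powr (a / 2)) = B * (K * X powr (\<tau> / p) * real n powr (\<tau> * s / 2))"
        using M by (simp add: K_def powr_mult half a_def mult_ac)
      finally show ?thesis by (simp add: add_left_mono ennreal_leI)
    qed
    moreover have "0 < K" using k K0(1) M by (simp add: K_def)
    ultimately show thesis using that[of K] by blast
  qed
qed

theorem theorem3p2:
  fixes p s \<tau> c0 \<beta> :: real and N0 :: nat
  assumes "0 < p" and "0 < s" and "s < 2 / p" and "1 / \<tau> = s / 2 + 1 / p"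
    and "1 \<le> c0" and "0 < \<beta>" and "\<beta> \<le> pi / 3"
  shows "\<exists>c > 0. \<forall>\<Omega> n0 n S1 S2.
           admissible_domain N0 c0 \<beta> n0 \<Omega> \<and> n0 \<le> n \<and>
           S1 \<in> step_functions N0 c0 \<beta> \<Omega> n \<and> S2 \<in> step_functions N0 c0 \<beta> \<Omega> n \<longrightarrow>
           (if 1 \<le> \<tau> then
              besov1 \<Omega> s \<tau> S1 \<le> besov1 \<Omega> s \<tau> S2
                + ennreal (c * real n powr (s / 2)) * Lnorm \<Omega> p (\<lambda>x. S1 x - S2 x)
            else
              epowr (besov1 \<Omega> s \<tau> S1) \<tau> \<le> epowr (besov1 \<Omega> s \<tau> S2) \<tau>
                + ennreal (c * real n powr (\<tau> * s / 2)) * epowr (Lnorm \<Omega> p (\<lambda>x. S1 x - S2 x)) \<tau>)"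
proof -
  show ?thesis
  proof (rule besov_power_step_functions[OF assms, where ?N0.0 = N0])
    fix K assume K: "0 < K" "\<And>\<Omega> n0 n S1 S2 A B X. admissible_domain N0 c0 \<beta> n0 \<Omega> \<Longrightarrow> n0 \<le> n \<Longrightarrow>
        S1 \<in> step_functions N0 c0 \<beta> \<Omega> n \<Longrightarrow> S2 \<in> step_functions N0 c0 \<beta> \<Omega> n \<Longrightarrow> split_ineq \<tau> A B \<Longrightarrow> 0 \<le> X \<Longrightarrow>
        (\<integral>\<^sup>+x. indicator \<Omega> x * ennreal (\<bar>S1 x - S2 x\<bar> powr p) \<partial>lborel) = ennreal X \<Longrightarrow>
        besov_power \<Omega> s \<tau> S1 \<le> ennreal A * besov_power \<Omega> s \<tau> S2 + ennreal (B * (K * X powr (\<tau> / p) * real n powr (\<tau> * s / 2)))"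
    have "0 < 1 / \<tau>" unfolding assms(4) using assms(1,2) by (intro add_pos_pos) auto
    then have \<tau>: "0 < \<tau>" by simp
    \<comment> \<open>For \<tau> >= 1 the seminorms themselves are compared, so the \<tau>-th root
      of \<open>K\<close> is taken.\<close>
    define c where "c = (if 1 \<le> \<tau> then K powr (1 / \<tau>) else K)"
    have c: "0 < c" using K(1) by (simp add: c_def)
    have main: "if 1 \<le> \<tau> then
                besov1 \<Omega> s \<tau> S1 \<le> besov1 \<Omega> s \<tau> S2
                  + ennreal (c * real n powr (s / 2)) * Lnorm \<Omega> p (\<lambda>x. S1 x - S2 x)
              else
                epowr (besov1 \<Omega> s \<tau> S1) \<tau> \<le> epowr (besov1 \<Omega> s \<tau> S2) \<tau>
                  + ennreal (c * real n powr (\<tau> * s / 2)) * epowr (Lnorm \<Omega> p (\<lambda>x. S1 x - S2 x)) \<tau>"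
      if H: "admissible_domain N0 c0 \<beta> n0 \<Omega>" "n0 \<le> n" "S1 \<in> step_functions N0 c0 \<beta> \<Omega> n" "S2 \<in> step_functions N0 c0 \<beta> \<Omega> n"
      for \<Omega> n0 n S1 S2
    proof -
      have n: "0 < n" using H(1,2) by (auto simp: admissible_domain_def)
      define L where "L = Lnorm \<Omega> p (\<lambda>x. S1 x - S2 x)"
      show ?thesis
      proof (cases "(\<integral>\<^sup>+x. indicator \<Omega> x * ennreal (\<bar>S1 x - S2 x\<bar> powr p) \<partial>lborel)" rule: ennreal_cases_inf)
        case 1
        \<comment> \<open>Since \<open>c\<close> and \<open>n\<close> are positive, an infinite norm
          makes the right side infinite and not a product of 0 and infinity.\<close>
        then have "L = \<infinity>" by (simp add: L_def Lnorm_def epowr_def)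
        moreover have "ennreal (c * real n powr q) * \<infinity> = \<infinity>" for q using c n by (simp add: ennreal_mult_top)
        ultimately have top: "ennreal (c * real n powr q) * L = \<infinity>" "ennreal (c * real n powr q) * epowr L \<tau> = \<infinity>" for q
          by (simp_all only: epowr_top)
        show ?thesis unfolding L_def[symmetric] top by simp
      next
        case (2 X)
        have L: "L = ennreal (X powr (1 / p))" using 2 by (simp add: L_def Lnorm_def epowr_ennreal)
        define R where "R = K * X powr (\<tau> / p) * real n powr (\<tau> * s / 2)"
        have R: "0 \<le> R" using K(1) by (simp add: R_def)
        have le: "besov_power \<Omega> s \<tau> S1 \<le> ennreal A * besov_power \<Omega> s \<tau> S2 + ennreal (B * R)" if "split_ineq \<tau> A B" for A B
          using K(2)[OF H that 2] unfolding R_def .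
        show ?thesis
        proof (cases "1 \<le> \<tau>")
          case True
          have "besov1 \<Omega> s \<tau> S1 \<le> besov1 \<Omega> s \<tau> S2 + ennreal (R powr (1 / \<tau>))"
            unfolding besov1_eq by (rule minkowski_limit[OF True R]) (rule le[OF split_ineq_ge_1[OF True]])
          also have "R powr (1 / \<tau>) = c * real n powr (s / 2) * X powr (1 / p)"
            using True K(1) 2 \<tau> by (simp add: R_def c_def powr_mult powr_powr mult_ac)
          also have "ennreal \<dots> = ennreal (c * real n powr (s / 2)) * L"
            unfolding L using c by (intro ennreal_mult) auto
          finally show ?thesis using True unfolding L_def by simp
        next
          case False
          have "besov_power \<Omega> s \<tau> S1 \<le> besov_power \<Omega> s \<tau> S2 + ennreal R"
            using le[OF split_ineq_le_1[OF \<tau>]] False by simp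
          moreover have "ennreal R = ennreal (c * real n powr (\<tau> * s / 2)) * epowr L \<tau>"
          proof -
            have "epowr L \<tau> = ennreal (X powr (\<tau> / p))" unfolding L by (simp add: epowr_ennreal powr_powr)
            moreover have "R = c * real n powr (\<tau> * s / 2) * X powr (\<tau> / p)" using False by (simp add: R_def c_def)
            ultimately show ?thesis using c by (simp add: ennreal_mult)
          qed
          ultimately show ?thesis using False unfolding besov1_eq epowr_inverse(1)[OF \<tau>] L_def by simp
        qed
      qed
    qed
    show ?thesis using c main by blast
  qed
qed

end
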